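(* There exist absolute constants $c, C>0$ such that the following holds. Fix any $\delta \le 1/4$. Under the data model below, take any covariance splitting $\Sigma = \Sigma_1\oplus\Sigma_2$ with $\Sigma_2\neq 0$. There exists $$\epsilon \le C\left(\sqrt{\frac{\log(1/\delta)}{r(\Sigma_2)}} + \sqrt{\frac{\log(1/\delta)}{n}} + \frac{n\log(1/\delta)}{R(\Sigma_2)}\right)$$ such that, if $\epsilon\le 1$ and $R(\Sigma_2) \ge c\log(1/\delta)^2$, then with probability at least $1-\delta$ the minimal Euclidean norm interpolator $\hat w$ satisfies $$\|\hat w\|_2 \le \|w^*\|_2 + (1+\epsilon)^{1/2}\,\sigma\sqrt{\frac{n}{\operatorname{Tr}(\Sigma_2)}}.$$
   Context: Data model: $d \ge n$; $\Sigma \in \mathbb{R}^{d\times d}$ is positive semidefinite; $w^* \in \mathbb{R}^d$ arbitrary; $\sigma\ge0$. $X \in \mathbb{R}^{n\times d}$ has i.i.d. rows $X_i \sim N(0,\Sigma)$, $\xi \sim N(0,\sigma^2 I_n)$ independent of $X$, $Y = Xw^*+\xi$. The minimal Euclidean norm interpolator is $\hat w \in \arg\min\{\|w\|_2 : Xw = Y\}$. Covariance splitting: $\Sigma = \Sigma_1\oplus\Sigma_2$ means $\Sigma=\Sigma_1+\Sigma_2$, both positive semidefinite, with orthogonal column spaces. Effective ranks for nonzero positive semidefinite $A$: $r(A) = \operatorname{Tr}(A)/\|A\|_{op}$ and $R(A) = \operatorname{Tr}(A)^2/\operatorname{Tr}(A^2)$. *)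

theory Defs
  imports "HOL-Probability.Probability"
begin

text \<open>Vectors in R^d are functions nat => real (only indices < d matter);
  d x d (or n x d) matrices are functions nat => nat => real.\<close>

definition vnorm :: "nat \<Rightarrow> (nat \<Rightarrow> real) \<Rightarrow> real" where
  "vnorm d v = sqrt (\<Sum>j<d. (v j)\<^sup>2)"

definition mv :: "nat \<Rightarrow> (nat \<Rightarrow> nat \<Rightarrow> real) \<Rightarrow> (nat \<Rightarrow> real) \<Rightarrow> nat \<Rightarrow> real" where
  "mv d M v = (\<lambda>i. \<Sum>j<d. M i j * v j)"

definition mtrace :: "nat \<Rightarrow> (nat \<Rightarrow> nat \<Rightarrow> real) \<Rightarrow> real" where
  "mtrace d M = (\<Sum>i<d. M i i)"

definition opnorm :: "nat \<Rightarrow> (nat \<Rightarrow> nat \<Rightarrow> real) \<Rightarrow> real" where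
  "opnorm d M = Sup {vnorm d (mv d M v) | v. vnorm d v \<le> 1}"

definition eff_r :: "nat \<Rightarrow> (nat \<Rightarrow> nat \<Rightarrow> real) \<Rightarrow> real" where
  "eff_r d M = mtrace d M / opnorm d M"

definition eff_R :: "nat \<Rightarrow> (nat \<Rightarrow> nat \<Rightarrow> real) \<Rightarrow> real" where
  "eff_R d M = (mtrace d M)\<^sup>2 / (\<Sum>i<d. \<Sum>j<d. M i j * M j i)"

definition psd :: "nat \<Rightarrow> (nat \<Rightarrow> nat \<Rightarrow> real) \<Rightarrow> bool" where
  "psd d M \<longleftrightarrow> (\<forall>i<d. \<forall>j<d. M i j = M j i) \<and> (\<forall>v. 0 \<le> (\<Sum>i<d. v i * mv d M v i))"

definition cov_split :: "nat \<Rightarrow> (nat \<Rightarrow> nat \<Rightarrow> real) \<Rightarrow> (nat \<Rightarrow> nat \<Rightarrow> real) \<Rightarrow> (nat \<Rightarrow> nat \<Rightarrow> real) \<Rightarrow> bool" where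
  "cov_split d S S1 S2 \<longleftrightarrow> psd d S1 \<and> psd d S2 \<and>
     (\<forall>i<d. \<forall>j<d. S i j = S1 i j + S2 i j) \<and>
     (\<forall>u v. (\<Sum>i<d. mv d S1 u i * mv d S2 v i) = 0)"

definition nonzero_mat :: "nat \<Rightarrow> (nat \<Rightarrow> nat \<Rightarrow> real) \<Rightarrow> bool" where
  "nonzero_mat d M \<longleftrightarrow> (\<exists>i<d. \<exists>j<d. M i j \<noteq> 0)"

text \<open>Underlying probability space: i.i.d. standard normals g_(i,k) (i<n, k<d) for the design
  and z_i (i<n) for the noise.\<close>
definition gauss_space :: "nat \<Rightarrow> nat \<Rightarrow> ((nat \<times> nat) + nat \<Rightarrow> real) measure" where
  "gauss_space n d = PiM (({..<n} \<times> {..<d}) <+> {..<n}) (\<lambda>_. density lborel std_normal_density)"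

text \<open>Design matrix: row i is X_i = A g_i, hence X_i ~ N(0, A A^T).\<close>
definition design :: "nat \<Rightarrow> (nat \<Rightarrow> nat \<Rightarrow> real) \<Rightarrow> ((nat \<times> nat) + nat \<Rightarrow> real) \<Rightarrow> nat \<Rightarrow> nat \<Rightarrow> real" where
  "design d A \<omega> = (\<lambda>i j. \<Sum>k<d. \<omega> (Inl (i, k)) * A j k)"

definition response :: "nat \<Rightarrow> (nat \<Rightarrow> nat \<Rightarrow> real) \<Rightarrow> (nat \<Rightarrow> real) \<Rightarrow> real \<Rightarrow> ((nat \<times> nat) + nat \<Rightarrow> real) \<Rightarrow> nat \<Rightarrow> real" where
  "response d A wstar \<sigma> \<omega> = (\<lambda>i. mv d (design d A \<omega>) wstar i + \<sigma> * \<omega> (Inr i))"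

definition min_norm_interp :: "nat \<Rightarrow> nat \<Rightarrow> (nat \<Rightarrow> nat \<Rightarrow> real) \<Rightarrow> (nat \<Rightarrow> real) \<Rightarrow> (nat \<Rightarrow> real) \<Rightarrow> bool" where
  "min_norm_interp n d X Y w \<longleftrightarrow> (\<forall>i<n. mv d X w i = Y i) \<and>
     (\<forall>v. (\<forall>i<n. mv d X v i = Y i) \<longrightarrow> vnorm d w \<le> vnorm d v)"

end

theory Submission
  imports Defs
begin

text \<open>Rotating the rows of the Gaussian design shows that, for fixed noise \<open>z\<close>, solving
  \<open>X u = z\<close> with \<open>\<parallel>u\<parallel>\<^sup>2 \<le> \<rho>\<close> has the same probability as solving \<open>X u = (0, \<dots>, 0, \<parallel>z\<parallel>)\<close>.
  Let \<open>Q\<^sub>k\<close> project onto the complement of the column space of \<open>\<Sigma>\<^sub>1\<close> and of the rows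
  \<open>x\<^sub>0, \<dots>, x\<^sub>k\<^sub>-\<^sub>1\<close>, and let \<open>D\<^sub>k = \<parallel>Q\<^sub>k x\<^sub>k\<parallel>\<^sup>2\<close>. A multiple of \<open>Q\<^sub>m x\<^sub>m\<close>, where \<open>m = n - 1\<close>, solves
  the rotated system and has squared norm \<open>\<parallel>z\<parallel>\<^sup>2 / D\<^sub>m\<close>. Given the earlier rows, \<open>D\<^sub>k\<close> is a
  Gaussian quadratic form of mean \<open>T\<^sub>k = Tr (Q\<^sub>k \<Sigma>\<^sub>2)\<close> and squared Frobenius norm at most
  \<open>Tr (\<Sigma>\<^sub>2\<^sup>2)\<close>, so it concentrates from below. Moreover \<open>T\<^sub>k\<^sub>+\<^sub>1 = T\<^sub>k - N\<^sub>k / D\<^sub>k\<close>, where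
  \<open>N\<^sub>k\<close> is a quadratic form of mean at most \<open>Tr (\<Sigma>\<^sub>2\<^sup>2)\<close>; since \<open>D\<^sub>k \<ge> Tr \<Sigma>\<^sub>2 / 2\<close> for all \<open>k\<close> with high
  probability, the total loss \<open>Tr \<Sigma>\<^sub>2 - T\<^sub>m\<close> is of relative order \<open>n log (1 / \<delta>) / R (\<Sigma>\<^sub>2)\<close>.\<close>


section \<open>Gaussian quadratic forms\<close>

text \<open>If \<open>X u = z\<close> for the standardized noise \<open>z\<close>, then
  \<open>wstar + \<sigma> u\<close> interpolates \<open>Y\<close>, so the excess norm is at most
  \<open>\<sigma>\<close> times the norm of \<open>u\<close>, and the signal plays no further part.
  The least squared norm of such a \<open>u\<close> is a quadratic form in the inverse Gram matrix
  of the rows; for a general \<open>z\<close> it would call for control of the smallest eigenvalue.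
  For a right-hand side supported on one coordinate a single residual decides, which is why the
  rotation is made. Searching for \<open>u\<close> in the complement of the columns of
  \<open>\<Sigma>\<^sub>1\<close> gives up optimality but makes every estimate depend on
  \<open>\<Sigma>\<^sub>2\<close> alone. The trace \<open>T\<^sub>m\<close> is bounded in two
  rounds. A deterministic Cauchy-Schwarz bound loses a relative \<open>sqrt (n / R)\<close>, more
  than the claimed rate allows in general; it only seeds
  \<open>D\<^sub>k \<ge> Tr \<Sigma>\<^sub>2 / 2\<close>, after which the recursion for
  \<open>T\<close> gives the sharper loss. No matrix is diagonalized: moments of quadratic forms
  come from integrating out one coordinate at a time.\<close>

abbreviation N01 :: "real measure" where
  "N01 \<equiv> density lborel std_normal_density"

lemma prob_space_N01: "prob_space N01"
  using prob_space_normal_density[of 1 0] by simp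

interpretation N01: prob_space N01 by (rule prob_space_N01)

interpretation PN: product_prob_space "\<lambda>_. N01" I for I
  by unfold_locales

text \<open>Completing the square turns the integrand times the standard density into a multiple of
  the normal density with mean \<open>\<beta> * s\<^sup>2\<close> and standard deviation
  \<open>s\<close>, where \<open>s\<^sup>2 = 1 / (1 - 2*\<alpha>)\<close>.\<close>

lemma nn_integral_N01_exp_quadratic:
  assumes "\<alpha> < 1/2"
  shows "(\<integral>\<^sup>+x. ennreal (exp (\<alpha> * x\<^sup>2 + \<beta> * x)) \<partial>N01)
    = ennreal (exp (\<beta>\<^sup>2 / (2 * (1 - 2*\<alpha>))) / sqrt (1 - 2*\<alpha>))"
proof -
  define s where "s = 1 / sqrt (1 - 2*\<alpha>)"
  have s: "s > 0" "s\<^sup>2 = 1 / (1 - 2*\<alpha>)" using assms by (auto simp: s_def power_divide)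
  have a: "\<alpha> = 1 / 2 - 1 / (2 * s\<^sup>2)" using s assms by (simp add: field_simps)
  have eq: "std_normal_density x * exp (\<alpha> * x\<^sup>2 + \<beta> * x)
      = (s * exp (\<beta>\<^sup>2 * s\<^sup>2 / 2)) * normal_density (\<beta> * s\<^sup>2) s x" for x
  proof -
    have "- x\<^sup>2 / 2 + (\<alpha> * x\<^sup>2 + \<beta> * x) = \<beta>\<^sup>2 * s\<^sup>2 / 2 + (- (x - \<beta> * s\<^sup>2)\<^sup>2 / (2 * s\<^sup>2))"
      using s(1) unfolding a by (simp add: field_simps power2_eq_square)
    then have e: "exp (- x\<^sup>2 / 2) * exp (\<alpha> * x\<^sup>2 + \<beta> * x)
        = exp (\<beta>\<^sup>2 * s\<^sup>2 / 2) * exp (- (x - \<beta> * s\<^sup>2)\<^sup>2 / (2 * s\<^sup>2))"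
      by (simp flip: exp_add)
    have "sqrt (2 * pi * s\<^sup>2) = sqrt (2*pi) * s" using s(1) by (simp add: real_sqrt_mult)
    then show ?thesis using e s(1) by (simp add: normal_density_def std_normal_density_def)
  qed
  have "(\<integral>\<^sup>+x. ennreal (exp (\<alpha> * x\<^sup>2 + \<beta> * x)) \<partial>N01)
      = (\<integral>\<^sup>+x. ennreal (std_normal_density x) * ennreal (exp (\<alpha> * x\<^sup>2 + \<beta> * x)) \<partial>lborel)"
    by (subst nn_integral_density) auto
  also have "\<dots> = (\<integral>\<^sup>+x. ennreal (s * exp (\<beta>\<^sup>2 * s\<^sup>2 / 2)) * ennreal (normal_density (\<beta> * s\<^sup>2) s x) \<partial>lborel)"
    using s(1) by (intro nn_integral_cong) (simp add: eq flip: ennreal_mult)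
  also have "\<dots> = ennreal (s * exp (\<beta>\<^sup>2 * s\<^sup>2 / 2)) * (\<integral>\<^sup>+x. ennreal (normal_density (\<beta> * s\<^sup>2) s x) \<partial>lborel)"
    by (rule nn_integral_cmult) auto
  also have "(\<integral>\<^sup>+x. ennreal (normal_density (\<beta> * s\<^sup>2) s x) \<partial>lborel) = 1"
    using integral_normal_density[OF s(1)] integrable_normal_density[OF s(1)]
    by (subst nn_integral_eq_integral) auto
  finally show ?thesis by (simp add: s(2)) (simp add: s_def field_simps)
qed

text \<open>The index set is arbitrary so that coordinates can be removed one by one in an
  induction, and so that the results apply to a single row of the design inside a larger product
  space.\<close>

definition quad :: "'i set \<Rightarrow> ('i \<Rightarrow> 'i \<Rightarrow> real) \<Rightarrow> ('i \<Rightarrow> real) \<Rightarrow> real" where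
  "quad I M g = (\<Sum>i\<in>I. \<Sum>j\<in>I. g i * M i j * g j)"

definition psd_on :: "'i set \<Rightarrow> ('i \<Rightarrow> 'i \<Rightarrow> real) \<Rightarrow> bool" where
  "psd_on I M \<longleftrightarrow> (\<forall>i\<in>I. \<forall>j\<in>I. M i j = M j i) \<and> (\<forall>v. 0 \<le> quad I M v)"

lemma psd_on_sym: "psd_on I M \<Longrightarrow> \<forall>i\<in>I. \<forall>j\<in>I. M i j = M j i"
  unfolding psd_on_def by (rule conjunct1)

lemma psd_on_nonneg: "psd_on I M \<Longrightarrow> 0 \<le> quad I M v"
  unfolding psd_on_def by (elim conjE allE)

lemma quad_insert:
  assumes "finite I" "i \<notin> I" "\<forall>k\<in>insert i I. \<forall>j\<in>insert i I. M k j = M j k"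
  shows "quad (insert i I) M (g(i := x)) = M i i * x\<^sup>2 + 2 * x * (\<Sum>j\<in>I. M i j * g j) + quad I M g"
proof -
  have sym: "M j i = M i j" and ne: "j \<noteq> i" if "j \<in> I" for j using assms(2,3) that by blast+
  have 1: "(\<Sum>j\<in>I. (g(i:=x)) j * M j i * x) = x * (\<Sum>j\<in>I. M i j * g j)"
    unfolding sum_distrib_left by (intro sum.cong refl) (simp add: sym ne)
  have 2: "(\<Sum>j\<in>I. x * M i j * (g(i:=x)) j) = x * (\<Sum>j\<in>I. M i j * g j)"
    unfolding sum_distrib_left by (intro sum.cong refl) (simp add: ne)
  have 3: "(\<Sum>j\<in>I. \<Sum>k\<in>I. (g(i:=x)) j * M j k * (g(i:=x)) k) = quad I M g"
    unfolding quad_def by (intro sum.cong refl) (simp add: ne)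
  have "quad (insert i I) M (g(i := x)) = M i i * x\<^sup>2 + (\<Sum>j\<in>I. x * M i j * (g(i:=x)) j)
     + ((\<Sum>j\<in>I. (g(i:=x)) j * M j i * x) + (\<Sum>j\<in>I. \<Sum>k\<in>I. (g(i:=x)) j * M j k * (g(i:=x)) k))"
    unfolding quad_def sum.distrib[symmetric] using assms(1,2)
    by (simp add: power2_eq_square algebra_simps)
  then show ?thesis unfolding 1 2 3 by simp
qed

lemma quad_rank_one_update:
  "quad I (\<lambda>j k. M j k + c * b j * b k) g = quad I M g + c * (\<Sum>j\<in>I. b j * g j)\<^sup>2"
  unfolding quad_def power2_eq_square sum_product unfolding sum_distrib_left sum.distrib[symmetric]
  by (intro sum.cong refl) (simp add: algebra_simps)

lemma measurable_quad [measurable]: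
  "quad I M \<in> borel_measurable (PiM I (\<lambda>_. N01))"
  unfolding quad_def by measurable

text \<open>One step of Gaussian elimination. In the variable \<open>x\<close> at index
  \<open>i\<close> the exponent is quadratic with linear coefficient
  \<open>2 * \<theta> * b\<close>, so integrating it out adds a multiple of \<open>b\<^sup>2\<close>
  to the exponent: the remaining matrix changes by a rank-one term. Both moment bounds below iterate
  this step.\<close>

lemma nn_integral_exp_quad_insert:
  fixes M :: "'i \<Rightarrow> 'i \<Rightarrow> real"
  assumes I: "finite I" "i \<notin> I" and M: "\<forall>k\<in>insert i I. \<forall>j\<in>insert i I. M k j = M j k"
    and th: "2 * \<theta> * M i i < 1"
  shows "(\<integral>\<^sup>+g. ennreal (exp (\<theta> * quad (insert i I) M g)) \<partial>PiM (insert i I) (\<lambda>_. N01))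
    = ennreal (1 / sqrt (1 - 2*\<theta>*M i i)) *
      (\<integral>\<^sup>+g. ennreal (exp (\<theta> * quad I (\<lambda>j k. M j k + 2*\<theta> / (1 - 2*\<theta>*M i i) * M i j * M i k) g)) \<partial>PiM I (\<lambda>_. N01))"
proof -
  define a where "a = 1 - 2*\<theta>*M i i"
  have a: "a > 0" using th by (simp add: a_def)
  have "(\<integral>\<^sup>+g. ennreal (exp (\<theta> * quad (insert i I) M g)) \<partial>PiM (insert i I) (\<lambda>_. N01))
    = (\<integral>\<^sup>+g. (\<integral>\<^sup>+x. ennreal (exp (\<theta> * quad (insert i I) M (g(i:=x)))) \<partial>N01) \<partial>PiM I (\<lambda>_. N01))"
    using I by (intro PN.product_nn_integral_insert) auto
  also have "\<dots> = (\<integral>\<^sup>+g. ennreal (1 / sqrt a) * ennreal (exp (\<theta> * quad I (\<lambda>j k. M j k + 2*\<theta> / a * M i j * M i k) g)) \<partial>PiM I (\<lambda>_. N01))"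
  proof (intro nn_integral_cong)
    fix g
    define b where "b = (\<Sum>j\<in>I. M i j * g j)"
    have "(\<integral>\<^sup>+x. ennreal (exp (\<theta> * quad (insert i I) M (g(i:=x)))) \<partial>N01)
      = (\<integral>\<^sup>+x. ennreal (exp (\<theta> * quad I M g)) * ennreal (exp (\<theta> * M i i * x\<^sup>2 + (2 * \<theta> * b) * x)) \<partial>N01)"
      unfolding quad_insert[OF I M] b_def[symmetric]
      by (intro nn_integral_cong) (simp add: algebra_simps flip: ennreal_mult exp_add)
    also have "\<dots> = ennreal (exp (\<theta> * quad I M g)) * (\<integral>\<^sup>+x. ennreal (exp (\<theta> * M i i * x\<^sup>2 + (2 * \<theta> * b) * x)) \<partial>N01)"
      by (intro nn_integral_cmult) auto
    also have "\<dots> = ennreal (exp (\<theta> * quad I M g)) * ennreal (exp ((2*\<theta>*b)\<^sup>2 / (2*a)) / sqrt a)"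
      using th by (subst nn_integral_N01_exp_quadratic) (auto simp: a_def algebra_simps)
    also have "\<dots> = ennreal (1 / sqrt a) * ennreal (exp (\<theta> * (quad I M g + 2*\<theta>/a * b\<^sup>2)))"
    proof -
      have "(2*\<theta>*b)\<^sup>2 / (2*a) = \<theta> * (2*\<theta>/a * b\<^sup>2)" using a by (simp add: field_simps power2_eq_square)
      then show ?thesis using a by (simp add: distrib_left exp_add flip: ennreal_mult)
    qed
    also have "quad I M g + 2*\<theta>/a * b\<^sup>2 = quad I (\<lambda>j k. M j k + 2*\<theta> / a * M i j * M i k) g"
      unfolding b_def by (rule quad_rank_one_update[symmetric])
    finally show "(\<integral>\<^sup>+x. ennreal (exp (\<theta> * quad (insert i I) M (g(i:=x)))) \<partial>N01) = 
      ennreal (1 / sqrt a) * ennreal (exp (\<theta> * quad I (\<lambda>j k. M j k + 2*\<theta> / a * M i j * M i k) g))" .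
  qed
  also have "\<dots> = ennreal (1 / sqrt a) * (\<integral>\<^sup>+g. ennreal (exp (\<theta> * quad I (\<lambda>j k. M j k + 2*\<theta> / a * M i j * M i k) g)) \<partial>PiM I (\<lambda>_. N01))"
    by (intro nn_integral_cmult) auto
  finally show ?thesis by (simp add: a_def)
qed

lemma psd_on_insert_nonneg:
  assumes "finite I" "i \<notin> I" "psd_on (insert i I) M"
  shows "0 \<le> M i i * x\<^sup>2 + 2 * x * (\<Sum>j\<in>I. M i j * v j) + quad I M v"
  unfolding quad_insert[OF assms(1,2) psd_on_sym[OF assms(3)], symmetric] by (rule psd_on_nonneg[OF assms(3)])

lemma psd_on_diag_nonneg:
  assumes "finite I" "psd_on I M" "i \<in> I"
  shows "0 \<le> M i i"
proof -
  have "quad I M (\<lambda>j. if j = i then 1 else 0) = M i i"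
    using assms(1,3) by (simp add: quad_def if_distrib[of "\<lambda>x. x * _"] if_distrib[of "\<lambda>x. _ * x"] sum.delta' cong: if_cong)
  then show ?thesis using psd_on_nonneg[OF assms(2)] by metis
qed

text \<open>The polynomial \<open>M i i * x\<^sup>2 + 2 * x * M i j + M j j\<close> is nonnegative.
  It is tested at its minimizer, or, if \<open>M i i = 0\<close>, at the point where a nonzero
  linear term would make it equal to -1.\<close>

lemma psd_on_minor:
  assumes "finite I" "i \<notin> I" "psd_on (insert i I) M" "j \<in> I"
  shows "(M i j)\<^sup>2 \<le> M i i * M j j"
proof -
  let ?v = "\<lambda>k. if k = j then 1 else 0 :: real"
  have q: "quad I M ?v = M j j"
    using assms(1,4) by (simp add: quad_def if_distrib[of "\<lambda>x. x * _"] if_distrib[of "\<lambda>x. _ * x"] sum.delta' cong: if_cong)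
  have s: "(\<Sum>k\<in>I. M i k * ?v k) = M i j"
    using assms(1,4) by (simp add: if_distrib[of "\<lambda>x. _ * x"] cong: if_cong)
  have *: "0 \<le> M i i * x\<^sup>2 + 2 * x * M i j + M j j" for x
    using psd_on_insert_nonneg[OF assms(1-3), of x ?v] by (simp only: q s)
  have a: "0 \<le> M i i" using psd_on_diag_nonneg[of "insert i I" M i] assms by auto
  show ?thesis
  proof (cases "M i i = 0")
    case True
    have "M i j = 0"
    proof (rule ccontr)
      assume "M i j \<noteq> 0"
      then show False using *[of "- (M j j + 1) / (2 * M i j)"] True by (simp add: field_simps)
    qed
    then show ?thesis using True by simp
  next
    case False
    then show ?thesis using a *[of "- M i j / M i i"] by (simp add: field_simps power2_eq_square)
  qed
qed

text \<open>The integral is the inverse square root of the determinant of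
  \<open>1 - 2 \<theta> M\<close>, and that determinant is at least one minus the trace of
  \<open>2 \<theta> M\<close>. In the induction the 2 by 2 minors bound the trace of the updated
  matrix by \<open>T / a\<close>, and \<open>a * (1 - 2*\<theta>*T / a)\<close> is again one minus
  the full trace.\<close>

lemma nn_integral_exp_quad_upper:
  assumes "finite I" "psd_on I M" "0 \<le> \<theta>" "2 * \<theta> * (\<Sum>i\<in>I. M i i) < 1"
  shows "(\<integral>\<^sup>+g. ennreal (exp (\<theta> * quad I M g)) \<partial>PiM I (\<lambda>_. N01)) \<le> ennreal (1 / sqrt (1 - 2 * \<theta> * (\<Sum>i\<in>I. M i i)))"
  using assms
proof (induction I arbitrary: M rule: finite_induct)
  case empty
  then show ?case by (simp add: quad_def PiM_empty prob_space.emeasure_space_1)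
next
  case (insert i I)
  define a where "a = 1 - 2*\<theta>*M i i"
  define T where "T = (\<Sum>j\<in>I. M j j)"
  define M' where "M' = (\<lambda>j k. M j k + 2*\<theta> / a * M i j * M i k)"
  have diag: "0 \<le> M j j" if "j \<in> insert i I" for j
    using psd_on_diag_nonneg[OF _ insert.prems(1) that] insert.hyps by auto
  have T0: "0 \<le> T" using diag by (auto simp: T_def intro!: sum_nonneg)
  have lt: "2*\<theta>*M i i + 2*\<theta>*T < 1" using insert by (simp add: T_def algebra_simps)
  then have a: "a > 0" "2*\<theta>*T < a" using T0 insert.prems(2) unfolding a_def
    by (smt (verit, best) mult_nonneg_nonneg)+
  have ai: "2*\<theta>*M i i < 1" using a by (simp add: a_def)
  have k: "0 \<le> 2*\<theta>/a" using a insert.prems by simp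
  have psd': "psd_on I M'"
    unfolding psd_on_def
  proof (intro conjI ballI allI)
    fix j l assume "j \<in> I" "l \<in> I"
    then have "M j l = M l j" using psd_on_sym[OF insert.prems(1)] by blast
    then show "M' j l = M' l j" by (simp add: M'_def)
  next
    fix v show "0 \<le> quad I M' v"
      using k psd_on_insert_nonneg[OF insert.hyps insert.prems(1), of 0 v]
      by (simp add: M'_def quad_rank_one_update del: divide_nonneg_nonneg times_divide_eq_left)
  qed
  have "(\<Sum>j\<in>I. M' j j) = T + 2*\<theta>/a * (\<Sum>j\<in>I. (M i j)\<^sup>2)"
    by (simp add: M'_def T_def sum.distrib sum_distrib_left power2_eq_square mult.assoc)
  also have "\<dots> \<le> T + 2*\<theta>/a * (M i i * T)"
    using k psd_on_minor[OF insert.hyps insert.prems(1)]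
    unfolding T_def sum_distrib_left[of "M i i"] by (intro add_left_mono mult_left_mono sum_mono)
  also have "\<dots> = T / a" using a by (simp add: a_def field_simps)
  finally have tr: "(\<Sum>j\<in>I. M' j j) \<le> T / a" .
  then have tr2: "2*\<theta>*(\<Sum>j\<in>I. M' j j) \<le> 2*\<theta>*T / a" using insert.prems(2)
    by (metis mult_left_mono times_divide_eq_right mult_nonneg_nonneg zero_le_numeral)
  also have "\<dots> < 1" using a by simp
  finally have lt': "2*\<theta>*(\<Sum>j\<in>I. M' j j) < 1" .
  have "(\<integral>\<^sup>+g. ennreal (exp (\<theta> * quad (insert i I) M g)) \<partial>PiM (insert i I) (\<lambda>_. N01))
    = ennreal (1 / sqrt a) * (\<integral>\<^sup>+g. ennreal (exp (\<theta> * quad I M' g)) \<partial>PiM I (\<lambda>_. N01))"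
    unfolding M'_def a_def
    by (intro nn_integral_exp_quad_insert insert.hyps ai psd_on_sym insert.prems(1))
  also have "\<dots> \<le> ennreal (1 / sqrt a) * ennreal (1 / sqrt (1 - 2*\<theta>*(\<Sum>j\<in>I. M' j j)))"
    by (intro mult_left_mono insert.IH psd' insert.prems lt') auto
  also have "\<dots> \<le> ennreal (1 / sqrt a) * ennreal (1 / sqrt (1 - 2*\<theta>*T / a))"
    using tr2 a by (intro mult_left_mono ennreal_leI divide_left_mono real_sqrt_le_mono mult_pos_pos) (auto simp: lt' intro: order.strict_trans1)
  also have "\<dots> = ennreal (1 / sqrt (a - 2*\<theta>*T))"
    using a by (simp flip: ennreal_mult real_sqrt_mult) (simp add: field_simps)
  also have "a - 2*\<theta>*T = 1 - 2*\<theta>*(\<Sum>j\<in>insert i I. M j j)"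
    using insert.hyps by (simp add: a_def T_def algebra_simps)
  finally show ?case .
qed

text \<open>This is \<open>ln (1 + x) \<ge> x - x\<^sup>2 / 2\<close> at \<open>x = 2*y\<close>,
  halved; the difference of the two sides has derivative \<open>x\<^sup>2 / (1 + x)\<close>.\<close>

lemma inverse_sqrt_one_plus_le:
  fixes y :: real
  assumes "0 \<le> y"
  shows "1 / sqrt (1 + 2*y) \<le> exp (- y + y\<^sup>2)"
proof -
  have "(\<lambda>x::real. ln (1+x) - x + x\<^sup>2/2) 0 \<le> (\<lambda>x. ln (1+x) - x + x\<^sup>2/2) (2*y)"
  proof (rule DERIV_nonneg_imp_nondecreasing[where f="\<lambda>x::real. ln (1+x) - x + x\<^sup>2/2"])
    fix x :: real assume x: "0 \<le> x" "x \<le> 2*y"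
    have "((\<lambda>x. ln (1+x) - x + x\<^sup>2/2) has_real_derivative x\<^sup>2 / (1+x)) (at x)"
      using x by (auto intro!: derivative_eq_intros simp: field_simps power2_eq_square)
    then show "\<exists>D. ((\<lambda>x::real. ln (1+x) - x + x\<^sup>2/2) has_real_derivative D) (at x) \<and> 0 \<le> D" using x by auto
  qed (use assms in auto)
  then have "2*y - 2*y\<^sup>2 \<le> ln (1 + 2*y)" by (simp add: power_mult_distrib)
  then have "exp (2*y - 2*y\<^sup>2) \<le> 1 + 2*y"
    using assms by (simp add: ln_ge_iff)
  then have "sqrt (exp (2*y - 2*y\<^sup>2)) \<le> sqrt (1+2*y)" by simp
  moreover have "sqrt (exp (2*y - 2*y\<^sup>2)) = exp (y - y\<^sup>2)"
    by (rule real_sqrt_unique) (auto simp: algebra_simps simp flip: exp_of_nat_mult exp_double)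
  ultimately have "1 / sqrt (1 + 2*y) \<le> 1 / exp (y - y\<^sup>2)"
    using assms by (intro divide_left_mono) auto
  then show ?thesis by (simp add: exp_minus[symmetric] divide_inverse)
qed

text \<open>A nonnegative form has a sub-Gaussian lower tail governed by the Frobenius norm, for
  every \<open>\<theta> \<ge> 0\<close>. Eliminating index \<open>i\<close> now subtracts a rank-one
  term, so the induction must check that the rest stays positive semidefinite and that the trace it
  loses is paid for by the off-diagonal entries of row \<open>i\<close>.\<close>

lemma nn_integral_exp_quad_lower:
  assumes "finite I" "psd_on I M" "0 \<le> \<theta>"
  shows "(\<integral>\<^sup>+g. ennreal (exp (- \<theta> * quad I M g)) \<partial>PiM I (\<lambda>_. N01))
    \<le> ennreal (exp (- \<theta> * (\<Sum>i\<in>I. M i i) + \<theta>\<^sup>2 * (\<Sum>i\<in>I. \<Sum>j\<in>I. (M i j)\<^sup>2)))"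
  using assms
proof (induction I arbitrary: M rule: finite_induct)
  case empty
  then show ?case by (simp add: quad_def PiM_empty prob_space.emeasure_space_1)
next
  case (insert i I)
  define a where "a = 1 + 2*\<theta>*M i i"
  define \<kappa> where "\<kappa> = 2*\<theta> / a"
  define M' where "M' = (\<lambda>j k. M j k + 2*(-\<theta>) / a * M i j * M i k)"
  have M'_eq: "M' j k = M j k + (-\<kappa>) * M i j * M i k" for j k by (simp add: M'_def \<kappa>_def)
  have sym: "\<forall>k\<in>insert i I. \<forall>j\<in>insert i I. M k j = M j k" by (rule psd_on_sym[OF insert.prems(1)])
  have Mii: "0 \<le> M i i" using psd_on_diag_nonneg[OF _ insert.prems(1)] insert.hyps by auto
  have a: "a \<ge> 1" using Mii insert.prems by (simp add: a_def)
  have k: "0 \<le> \<kappa>" using a insert.prems by (simp add: \<kappa>_def)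
  have ka: "\<kappa> * M i i \<le> 1" using a by (simp add: \<kappa>_def field_simps) (simp add: a_def)
  have k2: "\<kappa> \<le> 2*\<theta>" using a insert.prems divide_left_mono[of 1 a "2*\<theta>"] by (simp add: \<kappa>_def)
  have q': "quad I M' v = quad I M v - \<kappa> * (\<Sum>j\<in>I. M i j * v j)\<^sup>2" for v
    unfolding M'_eq quad_rank_one_update by simp
  have nn: "0 \<le> quad I M' v" for v
  proof -
    let ?b = "\<Sum>j\<in>I. M i j * v j"
    \<comment> \<open>Choosing the value \<open>-\<kappa> * ?b\<close> at index \<open>i\<close>
      leaves the factor \<open>2 - \<kappa> * M i i\<close>, which is at least 1 because
      \<open>\<kappa> * M i i \<le> 1\<close>.\<close>
    have "0 \<le> M i i * (-\<kappa> * ?b)\<^sup>2 + 2 * (-\<kappa> * ?b) * ?b + quad I M v"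
      by (rule psd_on_insert_nonneg[OF insert.hyps insert.prems(1)])
    also have "\<dots> = quad I M v - \<kappa> * ?b\<^sup>2 * (2 - \<kappa> * M i i)" by (simp add: algebra_simps power2_eq_square)
    also have "\<dots> \<le> quad I M v - \<kappa> * ?b\<^sup>2 * 1" using k ka by (intro diff_left_mono mult_left_mono) auto
    finally show ?thesis by (simp add: q')
  qed
  have psd': "psd_on I M'"
    unfolding psd_on_def
  proof (intro conjI ballI allI nn)
    fix j l assume "j \<in> I" "l \<in> I"
    then have "M j l = M l j" using sym by blast
    then show "M' j l = M' l j" by (simp add: M'_def)
  qed
  define b2 where "b2 = (\<Sum>j\<in>I. (M i j)\<^sup>2)"
  define T where "T = (\<Sum>j\<in>I. M j j)"
  define F where "F = (\<Sum>j\<in>I. \<Sum>k\<in>I. (M j k)\<^sup>2)"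
  define F' where "F' = (\<Sum>j\<in>I. \<Sum>k\<in>I. (M' j k)\<^sup>2)"
  have tr: "(\<Sum>j\<in>I. M' j j) = T - \<kappa> * b2"
    by (simp add: M'_eq T_def b2_def sum_subtractf sum_distrib_left power2_eq_square mult.assoc)
  have b2: "b2 \<ge> 0" by (simp add: b2_def sum_nonneg)
  \<comment> \<open>Expansion of \<open>M = M' + \<kappa> b b\<^sup>T\<close> with
    \<open>b = M i\<close>. All terms are nonnegative, the cross term because \<open>M'\<close> is
    positive semidefinite, so the Frobenius norm does not grow.\<close>
  have "F = F' + 2 * \<kappa> * quad I M' (M i) + \<kappa>\<^sup>2 * b2\<^sup>2"
  proof -
    have b22: "b2\<^sup>2 = (\<Sum>j\<in>I. \<Sum>k\<in>I. (M i j)\<^sup>2 * (M i k)\<^sup>2)"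
      unfolding b2_def power2_eq_square[of "sum _ _"] sum_product ..
    have "F = (\<Sum>j\<in>I. \<Sum>k\<in>I. (M' j k)\<^sup>2 + 2*\<kappa>*(M i j * M' j k * M i k) + \<kappa>\<^sup>2 * ((M i j)\<^sup>2 * (M i k)\<^sup>2))"
      unfolding F_def by (intro sum.cong refl) (simp add: M'_eq power2_eq_square algebra_simps)
    then show ?thesis unfolding F'_def quad_def b22 sum.distrib sum_distrib_left .
  qed
  then have FF: "F' \<le> F" using nn[of "M i"] k b2 by (smt (verit) mult_nonneg_nonneg zero_le_power2)
  have Ftot: "(\<Sum>j\<in>insert i I. \<Sum>k\<in>insert i I. (M j k)\<^sup>2) = (M i i)\<^sup>2 + 2 * b2 + F"
  proof -
    have "M j i = M i j" if "j \<in> I" for j using sym that by blast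
    then have "(\<Sum>j\<in>I. (M j i)\<^sup>2) = b2" unfolding b2_def by (intro sum.cong) auto
    then show ?thesis using insert.hyps by (simp add: sum.distrib F_def b2_def)
  qed
  have "(\<integral>\<^sup>+g. ennreal (exp (-\<theta> * quad (insert i I) M g)) \<partial>PiM (insert i I) (\<lambda>_. N01))
    = ennreal (1 / sqrt a) * (\<integral>\<^sup>+g. ennreal (exp (-\<theta> * quad I M' g)) \<partial>PiM I (\<lambda>_. N01))"
  proof -
    have "2 * (-\<theta>) * M i i < 1" using a by (simp add: a_def)
    from nn_integral_exp_quad_insert[OF insert.hyps sym this] show ?thesis
      unfolding M'_def a_def by (simp only: mult_minus_left mult_minus_right diff_minus_eq_add)
  qed
  also have "\<dots> \<le> ennreal (1 / sqrt a) * ennreal (exp (- \<theta> * (\<Sum>j\<in>I. M' j j) + \<theta>\<^sup>2 * F'))"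
    unfolding F'_def by (intro mult_left_mono insert.IH psd' insert.prems) auto
  also have "\<dots> \<le> ennreal (exp (- (\<theta> * M i i) + (\<theta> * M i i)\<^sup>2)) * ennreal (exp (- \<theta> * (\<Sum>j\<in>I. M' j j) + \<theta>\<^sup>2 * F'))"
    using inverse_sqrt_one_plus_le[of "\<theta> * M i i"] Mii insert.prems
    by (intro mult_right_mono ennreal_leI) (auto simp: a_def mult.assoc)
  also have "\<dots> = ennreal (exp (- \<theta> * M i i + (\<theta> * M i i)\<^sup>2 - \<theta> * (T - \<kappa> * b2) + \<theta>\<^sup>2 * F'))"
    by (simp add: tr flip: ennreal_mult exp_add)
  also have "\<dots> \<le> ennreal (exp (- \<theta> * (M i i + T) + \<theta>\<^sup>2 * ((M i i)\<^sup>2 + 2 * b2 + F)))"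
  proof (intro ennreal_leI, unfold exp_le_cancel_iff)
    \<comment> \<open>The lost trace \<open>\<kappa> * b2\<close> costs at most
      \<open>2 * \<theta>\<^sup>2 * b2\<close>, exactly what row and column \<open>i\<close>
      contribute off the diagonal in \<open>Ftot\<close>.\<close>
    have "\<theta> * (\<kappa> * b2) \<le> \<theta> * (2 * \<theta> * b2)" using k2 b2 insert.prems by (intro mult_left_mono mult_right_mono) auto
    moreover have "\<theta>\<^sup>2 * F' \<le> \<theta>\<^sup>2 * F" using FF by (intro mult_left_mono) auto
    ultimately show "- \<theta> * M i i + (\<theta> * M i i)\<^sup>2 - \<theta> * (T - \<kappa> * b2) + \<theta>\<^sup>2 * F'
      \<le> - \<theta> * (M i i + T) + \<theta>\<^sup>2 * ((M i i)\<^sup>2 + 2 * b2 + F)"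
      by (simp add: algebra_simps power2_eq_square)
  qed
  finally show ?case using insert.hyps unfolding Ftot by (simp add: T_def)
qed

section \<open>Orthogonal projections and minimal norm solutions\<close>

definition dot :: "nat \<Rightarrow> (nat \<Rightarrow> real) \<Rightarrow> (nat \<Rightarrow> real) \<Rightarrow> real" where
  "dot d u v = (\<Sum>i<d. u i * v i)"

definition unit_vec :: "nat \<Rightarrow> nat \<Rightarrow> real" where
  "unit_vec j = (\<lambda>i. if i = j then 1 else 0)"

definition trprod :: "nat \<Rightarrow> (nat \<Rightarrow> nat \<Rightarrow> real) \<Rightarrow> (nat \<Rightarrow> nat \<Rightarrow> real) \<Rightarrow> real" where
  "trprod d P Q = (\<Sum>i<d. \<Sum>j<d. P i j * Q j i)"

definition frob2 :: "nat \<Rightarrow> (nat \<Rightarrow> nat \<Rightarrow> real) \<Rightarrow> real" where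
  "frob2 d M = (\<Sum>i<d. \<Sum>j<d. (M i j)\<^sup>2)"

definition symmetric :: "nat \<Rightarrow> (nat \<Rightarrow> nat \<Rightarrow> real) \<Rightarrow> bool" where
  "symmetric d M \<longleftrightarrow> (\<forall>i<d. \<forall>j<d. M i j = M j i)"

text \<open>Idempotence is stated through the action on coordinates below \<open>d\<close>; equality
  of matrices as functions would also constrain meaningless entries.\<close>

definition projector :: "nat \<Rightarrow> (nat \<Rightarrow> nat \<Rightarrow> real) \<Rightarrow> bool" where
  "projector d Q \<longleftrightarrow> symmetric d Q \<and> (\<forall>v. \<forall>i<d. mv d Q (mv d Q v) i = mv d Q v i)"

lemma dot_cong: "(\<And>i. i < d \<Longrightarrow> u i = u' i) \<Longrightarrow> (\<And>i. i < d \<Longrightarrow> v i = v' i) \<Longrightarrow> dot d u v = dot d u' v'"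
  by (auto simp: dot_def)

lemma mv_cong: "(\<And>i. i < d \<Longrightarrow> v i = v' i) \<Longrightarrow> mv d M v = mv d M v'"
  by (auto simp: mv_def)

lemma dot_commute: "dot d u v = dot d v u"
  by (simp add: dot_def mult.commute)

lemma dot_self_nonneg: "0 \<le> dot d v v"
  by (simp add: dot_def sum_nonneg)

lemma dot_self_eq_0: "dot d v v = 0 \<Longrightarrow> i < d \<Longrightarrow> v i = 0"
  unfolding dot_def by (subst (asm) sum_nonneg_eq_0_iff) auto

lemma dot_diff_right: "dot d u (\<lambda>i. v i - c * w i) = dot d u v - c * dot d u w"
  by (simp add: dot_def sum_subtractf sum_distrib_left algebra_simps)

lemma dot_add_right: "dot d u (\<lambda>i. v i + c * w i) = dot d u v + c * dot d u w"
  by (simp add: dot_def sum.distrib sum_distrib_left algebra_simps)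

lemma mv_diff: "mv d M (\<lambda>i. v i - c * w i) i = mv d M v i - c * mv d M w i"
  by (simp add: mv_def sum_subtractf sum_distrib_left algebra_simps)

lemma mv_add: "mv d M (\<lambda>i. v i + c * w i) i = mv d M v i + c * mv d M w i"
  by (simp add: mv_def sum.distrib sum_distrib_left algebra_simps)

lemma mv_zero: "(\<And>i. i < d \<Longrightarrow> v i = 0) \<Longrightarrow> mv d M v i = 0"
  by (simp add: mv_def)

lemma mv_eq_dot: "mv d M v i = dot d (M i) v"
  by (simp add: mv_def dot_def)

lemma mv_unit_vec: "j < d \<Longrightarrow> mv d M (unit_vec j) i = M i j"
  by (simp add: mv_def unit_vec_def if_distrib[of "\<lambda>x. _ * x"] cong: if_cong)

lemma dot_unit_vec: "j < d \<Longrightarrow> dot d (unit_vec j) v = v j"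
  by (simp add: dot_def unit_vec_def if_distrib[of "\<lambda>x. x * _"] cong: if_cong)

lemma mv_eq_sum_columns: "mv d M v i = (\<Sum>k<d. v k * mv d M (unit_vec k) i)"
  unfolding mv_def[of d M v] by (intro sum.cong refl) (simp add: mv_unit_vec)

lemma trprod_eq: "trprod d P Q = (\<Sum>i<d. mv d P (mv d Q (unit_vec i)) i)"
  unfolding trprod_def mv_def[of d P] by (intro sum.cong refl) (simp add: mv_unit_vec)

lemma frob2_eq: "frob2 d M = (\<Sum>j<d. dot d (mv d M (unit_vec j)) (mv d M (unit_vec j)))"
  unfolding frob2_def dot_def by (subst sum.swap) (intro sum.cong refl, simp add: mv_unit_vec power2_eq_square)

lemma frob2_nonneg: "0 \<le> frob2 d M"
  by (simp add: frob2_def sum_nonneg)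

lemma vnorm_eq: "vnorm d v = sqrt (dot d v v)"
  by (simp add: vnorm_def dot_def power2_eq_square)

lemma dot_mv_symmetric:
  assumes "symmetric d M"
  shows "dot d (mv d M u) v = dot d u (mv d M v)"
proof -
  have "dot d (mv d M u) v = (\<Sum>i<d. \<Sum>j<d. M i j * u j * v i)"
    by (simp add: dot_def mv_def sum_distrib_right)
  also have "\<dots> = (\<Sum>j<d. \<Sum>i<d. M i j * u j * v i)" by (rule sum.swap)
  also have "\<dots> = (\<Sum>j<d. \<Sum>i<d. u j * (M j i * v i))"
    using assms[unfolded symmetric_def] by (intro sum.cong refl) (metis lessThan_iff mult.commute mult.left_commute)
  also have "\<dots> = dot d u (mv d M v)" by (simp add: dot_def mv_def sum_distrib_left)
  finally show ?thesis .
qed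

lemma projector_idem: "projector d Q \<Longrightarrow> i < d \<Longrightarrow> mv d Q (mv d Q v) i = mv d Q v i"
  unfolding projector_def by blast

lemma dot_projector:
  assumes "projector d Q"
  shows "dot d (mv d Q u) (mv d Q v) = dot d u (mv d Q v)"
  using assms dot_mv_symmetric[of d Q u "mv d Q v"]
  by (metis projector_def dot_cong)

lemma projector_complement_norm:
  assumes "projector d Q"
  shows "dot d (\<lambda>i. v i - mv d Q v i) (\<lambda>i. v i - mv d Q v i) = dot d v v - dot d (mv d Q v) (mv d Q v)"
proof -
  have "dot d (\<lambda>i. v i - 1 * mv d Q v i) (\<lambda>i. v i - 1 * mv d Q v i)
    = dot d v v - 2 * dot d v (mv d Q v) + dot d (mv d Q v) (mv d Q v)"
    unfolding dot_diff_right by (subst (1 2) dot_commute, unfold dot_diff_right) (simp add: dot_commute)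
  then show ?thesis using dot_projector[OF assms, of v v] by simp
qed

lemma projector_contraction:
  assumes "projector d Q"
  shows "dot d (mv d Q v) (mv d Q v) \<le> dot d v v"
  using projector_complement_norm[OF assms, of v] dot_self_nonneg by (metis diff_ge_0_iff_ge)

definition id_mat :: "nat \<Rightarrow> nat \<Rightarrow> real" where
  "id_mat = (\<lambda>i j. if i = j then 1 else 0)"

lemma mv_id_mat: "i < d \<Longrightarrow> mv d id_mat v i = v i"
  by (simp add: mv_def id_mat_def if_distrib[of "\<lambda>x. x * _"] cong: if_cong)

lemma projector_id_mat: "projector d id_mat"
  by (simp add: projector_def symmetric_def mv_id_mat) (simp add: id_mat_def)

text \<open>If \<open>mv d Q x\<close> vanishes, the division by zero makes this the identity on \<open>Q\<close>.\<close>
definition remove_dir :: "nat \<Rightarrow> (nat \<Rightarrow> nat \<Rightarrow> real) \<Rightarrow> (nat \<Rightarrow> real) \<Rightarrow> nat \<Rightarrow> nat \<Rightarrow> real" where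
  "remove_dir d Q x = (\<lambda>i j. Q i j - mv d Q x i * mv d Q x j / dot d (mv d Q x) (mv d Q x))"

text \<open>Gram-Schmidt carried out on projectors instead of vectors: no normalization is chosen,
  and linearly dependent vectors need no separate case.\<close>

primrec gram_schmidt :: "nat \<Rightarrow> (nat \<Rightarrow> nat \<Rightarrow> real) \<Rightarrow> (nat \<Rightarrow> nat \<Rightarrow> real) \<Rightarrow> nat \<Rightarrow> nat \<Rightarrow> nat \<Rightarrow> real" where
  "gram_schmidt d Q x 0 = Q"
| "gram_schmidt d Q x (Suc k) = remove_dir d (gram_schmidt d Q x k) (x k)"

lemma mv_remove_dir:
  "mv d (remove_dir d Q x) v i = mv d Q v i - (dot d (mv d Q x) v / dot d (mv d Q x) (mv d Q x)) * mv d Q x i"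
proof -
  define a where "a = mv d Q x"
  define D where "D = dot d a a"
  have "(\<Sum>j<d. (Q i j - a i * a j / D) * v j) = (\<Sum>j<d. Q i j * v j) - (\<Sum>j<d. a j * v j) / D * a i"
    by (simp add: left_diff_distrib sum_subtractf sum_divide_distrib sum_distrib_left algebra_simps)
  then show ?thesis
    unfolding remove_dir_def a_def[symmetric] D_def[symmetric] dot_def[of d a v]
    unfolding mv_def[of d "\<lambda>i j. Q i j - a i * a j / D"] mv_def[of d Q v] .
qed

lemma projector_remove_dir:
  assumes Q: "projector d Q"
  shows "projector d (remove_dir d Q x)"
  unfolding projector_def
proof (intro conjI allI impI)
  have "Q i j = Q j i" if "i < d" "j < d" for i j using Q that unfolding projector_def symmetric_def by blast
  then show "symmetric d (remove_dir d Q x)" unfolding symmetric_def remove_dir_def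
    by (auto simp: mult.commute)
next
  fix v i assume i: "i < d"
  define a where "a = mv d Q x"
  define D where "D = dot d a a"
  have Qa: "mv d Q a j = a j" if "j < d" for j using projector_idem[OF Q that] by (simp add: a_def)
  have aQ: "dot d a (mv d Q w) = dot d a w" for w
    using dot_mv_symmetric[of d Q a w] Q Qa unfolding projector_def by (metis dot_cong)
  define c where "c = dot d a v / D"
  have eq: "mv d (remove_dir d Q x) v = (\<lambda>i. mv d Q v i - c * a i)"
    by (rule ext) (simp add: mv_remove_dir a_def c_def D_def)
  have "mv d (remove_dir d Q x) (\<lambda>i. mv d Q v i - c * a i) i = mv d Q v i - c * a i - (dot d a v - c * D) / D * a i"
    unfolding mv_remove_dir mv_diff dot_diff_right a_def[symmetric] D_def[symmetric] aQ
    unfolding Qa[OF i] projector_idem[OF Q i] by (simp add: field_simps)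
  \<comment> \<open>For \<open>D = 0\<close> the quotient is 0 by convention, otherwise
    \<open>c * D = dot d a v\<close>: the second removal of the direction has no effect.\<close>
  also have "(dot d a v - c * D) / D = 0"
    by (cases "D = 0") (simp_all add: c_def)
  finally show "mv d (remove_dir d Q x) (mv d (remove_dir d Q x) v) i = mv d (remove_dir d Q x) v i"
    unfolding eq by simp
qed

lemma projector_gram_schmidt: "projector d Q \<Longrightarrow> projector d (gram_schmidt d Q x m)"
  by (induction m) (auto intro: projector_remove_dir)

lemma mv_remove_dir_self:
  assumes "projector d Q" "i < d"
  shows "mv d (remove_dir d Q x) x i = 0"
proof -
  have "dot d (mv d Q x) x = dot d (mv d Q x) (mv d Q x)"
    using dot_projector[OF assms(1), of x x] by (simp add: dot_commute)
  then show ?thesis using dot_self_eq_0[OF _ assms(2), of "mv d Q x"]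
    by (cases "dot d (mv d Q x) (mv d Q x) = 0") (auto simp: mv_remove_dir)
qed

lemma mv_remove_dir_zero:
  assumes "projector d Q" "\<And>i. i < d \<Longrightarrow> mv d Q y i = 0" "i < d"
  shows "mv d (remove_dir d Q x) y i = 0"
proof -
  have "dot d (mv d Q x) y = dot d x (mv d Q y)"
    using assms(1) by (intro dot_mv_symmetric) (simp add: projector_def)
  also have "\<dots> = 0" using assms(2) by (simp add: dot_def)
  finally show ?thesis using assms by (simp add: mv_remove_dir)
qed

lemma gram_schmidt_zero:
  assumes "projector d Q" "\<And>i. i < d \<Longrightarrow> mv d Q y i = 0" "i < d"
  shows "mv d (gram_schmidt d Q x m) y i = 0"
  using assms(3)
proof (induction m arbitrary: i)
  case (Suc m)
  then show ?case using mv_remove_dir_zero[OF projector_gram_schmidt[OF assms(1)], of x m y i] by simp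
qed (use assms in auto)

lemma gram_schmidt_kills:
  assumes "projector d Q" "k < m" "i < d"
  shows "mv d (gram_schmidt d Q x m) (x k) i = 0"
  using assms(2,3)
proof (induction m arbitrary: i)
  case (Suc m)
  note pr = projector_gram_schmidt[OF assms(1), of x m]
  show ?case
  proof (cases "k = m")
    case True
    then show ?thesis using mv_remove_dir_self[OF pr Suc.prems(2)] by simp
  next
    case False
    then show ?thesis using Suc mv_remove_dir_zero[OF pr, of "x k" i] by simp
  qed
qed simp

lemma gram_schmidt_fixes:
  assumes "projector d Q" "\<And>i. i < d \<Longrightarrow> mv d Q y i = y i" "\<And>k. k < m \<Longrightarrow> dot d (x k) y = 0" "i < d"
  shows "mv d (gram_schmidt d Q x m) y i = y i"
  using assms(3,4)
proof (induction m arbitrary: i)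
  case (Suc m)
  let ?Q = "gram_schmidt d Q x m"
  have IH: "mv d ?Q y i = y i" if "i < d" for i using Suc that by simp
  have "dot d (mv d ?Q (x m)) y = dot d (x m) (mv d ?Q y)"
    using projector_gram_schmidt[OF assms(1), of x m] by (intro dot_mv_symmetric) (simp add: projector_def)
  also have "\<dots> = dot d (x m) y" using IH by (intro dot_cong) auto
  finally show ?case using Suc.prems IH[OF Suc.prems(2)] by (simp add: mv_remove_dir)
qed (use assms in auto)

lemma gram_schmidt_absorb:
  assumes "projector d Q" "i < d"
  shows "mv d Q (mv d (gram_schmidt d Q x m) v) i = mv d (gram_schmidt d Q x m) v i"
  using assms(2)
proof (induction m arbitrary: i v)
  case 0
  then show ?case using projector_idem[OF assms(1)] by simp
next
  case (Suc m)
  let ?Q = "gram_schmidt d Q x m" and ?P = "gram_schmidt d Q x (Suc m)"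
  define c where "c = dot d (mv d ?Q (x m)) v / dot d (mv d ?Q (x m)) (mv d ?Q (x m))"
  have eq: "mv d ?P v = (\<lambda>i. mv d ?Q v i - c * mv d ?Q (x m) i)"
    by (rule ext) (simp add: mv_remove_dir c_def)
  show ?case unfolding eq mv_diff Suc.IH[OF Suc.prems] ..
qed

lemma gram_schmidt_cong:
  assumes "\<And>k. k < m \<Longrightarrow> x k = y k"
  shows "gram_schmidt d Q x m = gram_schmidt d Q y m"
  using assms by (induction m) auto

section \<open>Traces along the Gram-Schmidt process\<close>

lemma trprod_remove_dir:
  fixes d Q x defines "a \<equiv> mv d Q x"
  shows "trprod d (remove_dir d Q x) S = trprod d Q S - dot d a (mv d S a) / dot d a a"
proof -
  have "trprod d (remove_dir d Q x) S = trprod d Q S - (\<Sum>i<d. \<Sum>j<d. a i * a j * S j i) / dot d a a"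
    by (simp add: trprod_def remove_dir_def a_def left_diff_distrib sum_subtractf sum_divide_distrib)
  also have "(\<Sum>i<d. \<Sum>j<d. a i * a j * S j i) = dot d a (mv d S a)"
    unfolding dot_def mv_def sum_distrib_left
    by (subst sum.swap) (intro sum.cong refl, simp add: mult_ac)
  finally show ?thesis .
qed

lemma trprod_id_mat: "trprod d Q id_mat = mtrace d Q"
  by (simp add: trprod_def mtrace_def id_mat_def if_distrib[of "\<lambda>x. _ * x"] cong: if_cong)

text \<open>The trace of a projector is its rank. Removing a direction lowers it by
  \<open>dot d a a / dot d a a\<close>, which is 1, or 0 if the direction has already
  vanished.\<close>

lemma mtrace_gram_schmidt:
  assumes "projector d Q"
  shows "mtrace d Q - real m \<le> mtrace d (gram_schmidt d Q x m)"
proof (induction m)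
  case (Suc m)
  define a where "a = mv d (gram_schmidt d Q x m) (x m)"
  have "dot d a (mv d id_mat a) = dot d a a" by (intro dot_cong) (auto simp: mv_id_mat)
  then have "mtrace d (gram_schmidt d Q x (Suc m)) = mtrace d (gram_schmidt d Q x m) - dot d a a / dot d a a"
    by (simp add: trprod_id_mat[symmetric] trprod_remove_dir a_def)
  moreover have "dot d a a / dot d a a \<le> 1" by (cases "dot d a a = 0") auto
  ultimately show ?case using Suc by simp
qed simp

lemma sum_sum_Cauchy_Schwarz:
  fixes a b :: "nat \<Rightarrow> nat \<Rightarrow> real"
  shows "(\<Sum>i<d. \<Sum>j<d. a i j * b i j)\<^sup>2 \<le> (\<Sum>i<d. \<Sum>j<d. (a i j)\<^sup>2) * (\<Sum>i<d. \<Sum>j<d. (b i j)\<^sup>2)"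
  unfolding sum.cartesian_product
  using Cauchy_Schwarz_ineq_sum[of "\<lambda>(i,j). a i j" "\<lambda>(i,j). b i j" "{..<d}\<times>{..<d}"]
  by (simp add: case_prod_unfold)

text \<open>The difference \<open>P\<close> of the two projectors is a projector of rank at most
  \<open>m\<close>, so its squared Frobenius norm is at most \<open>m\<close>, and Cauchy-Schwarz
  bounds the trace of \<open>P S\<close>. The bound is deterministic.\<close>

lemma trprod_gram_schmidt_ge:
  assumes Q: "projector d Q" and S: "symmetric d S"
  shows "trprod d Q S - sqrt (real m * frob2 d S) \<le> trprod d (gram_schmidt d Q x m) S"
proof -
  define Q' where "Q' = gram_schmidt d Q x m"
  define P where "P = (\<lambda>i j. Q i j - Q' i j)"
  have Q': "projector d Q'" unfolding Q'_def by (rule projector_gram_schmidt[OF Q])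
  have mvP: "mv d P v i = mv d Q v i - mv d Q' v i" for v i
    by (simp add: P_def mv_def left_diff_distrib sum_subtractf)
  \<comment> \<open>The range of \<open>Q'\<close> lies in that of \<open>Q\<close>, so
    \<open>Q Q' = Q'\<close> and the square of \<open>Q - Q'\<close> is \<open>Q - Q'\<close>; its
    diagonal is compared with the squared column norms.\<close>
  have col: "dot d (mv d P (unit_vec j)) (mv d P (unit_vec j)) = Q j j - Q' j j" if j: "j < d" for j
  proof -
    let ?u = "mv d Q (unit_vec j)" and ?w = "mv d Q' (unit_vec j)"
    have "dot d (\<lambda>i. ?u i - 1 * ?w i) (\<lambda>i. ?u i - 1 * ?w i) = dot d ?u ?u - 2 * dot d ?u ?w + dot d ?w ?w"
      unfolding dot_diff_right by (subst (1 2) dot_commute, unfold dot_diff_right) (simp add: dot_commute)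
    moreover have "dot d ?u ?u = Q j j" using dot_projector[OF Q] j by (simp add: dot_unit_vec mv_unit_vec)
    moreover have "dot d ?w ?w = Q' j j" using dot_projector[OF Q'] j by (simp add: dot_unit_vec mv_unit_vec)
    moreover have "dot d ?u ?w = Q' j j"
    proof -
      have "dot d ?u ?w = dot d (unit_vec j) (mv d Q ?w)"
        using Q by (intro dot_mv_symmetric) (simp add: projector_def)
      also have "\<dots> = mv d Q ?w j" using j by (simp add: dot_unit_vec)
      also have "\<dots> = ?w j" unfolding Q'_def by (rule gram_schmidt_absorb[OF Q j])
      finally show ?thesis using j by (simp add: mv_unit_vec)
    qed
    ultimately show ?thesis by (simp add: mvP[abs_def])
  qed
  have "frob2 d P = mtrace d Q - mtrace d Q'"
    using col by (simp add: frob2_eq mtrace_def sum_subtractf)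
  then have fP: "frob2 d P \<le> real m" using mtrace_gram_schmidt[OF Q, of m x] by (simp add: Q'_def)
  have "(trprod d P S)\<^sup>2 \<le> frob2 d P * (\<Sum>i<d. \<Sum>j<d. (S j i)\<^sup>2)"
    unfolding trprod_def frob2_def by (rule sum_sum_Cauchy_Schwarz)
  also have "(\<Sum>i<d. \<Sum>j<d. (S j i)\<^sup>2) = frob2 d S" unfolding frob2_def by (rule sum.swap)
  also have "frob2 d P * frob2 d S \<le> real m * frob2 d S"
    using fP by (intro mult_right_mono) (auto simp: frob2_nonneg)
  finally have "\<bar>trprod d P S\<bar> \<le> sqrt (real m * frob2 d S)"
    by (metis real_sqrt_abs real_sqrt_le_mono)
  moreover have "trprod d P S = trprod d Q S - trprod d Q' S"
    by (simp add: trprod_def P_def left_diff_distrib sum_subtractf)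
  ultimately show ?thesis by (simp add: Q'_def)
qed

section \<open>The splitting projector and minimal norm solutions\<close>

lemma psd_symmetric: "psd d S \<Longrightarrow> symmetric d S"
  by (simp add: psd_def symmetric_def)

lemma psd_dot_nonneg: "psd d S \<Longrightarrow> 0 \<le> dot d v (mv d S v)"
  by (simp add: psd_def dot_def)

text \<open>Gram-Schmidt over the columns of \<open>S1\<close>, started from the identity, kills the
  column space of \<open>S1\<close>; it fixes the columns of \<open>S2\<close> because they are
  orthogonal to all removed vectors.\<close>

lemma cov_split_projector:
  assumes "cov_split d S S1 S2"
  obtains Q where "projector d Q" "\<And>v i. i < d \<Longrightarrow> mv d Q (mv d S1 v) i = 0"
    "\<And>v i. i < d \<Longrightarrow> mv d Q (mv d S2 v) i = mv d S2 v i"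
proof
  define x where "x k = mv d S1 (unit_vec k)" for k
  let ?Q = "gram_schmidt d id_mat x d"
  show "projector d ?Q" by (intro projector_gram_schmidt projector_id_mat)
  show "mv d ?Q (mv d S1 v) i = 0" if i: "i < d" for v i
  proof -
    have "mv d ?Q (mv d S1 v) i = (\<Sum>j<d. ?Q i j * (\<Sum>k<d. v k * x k j))"
      unfolding mv_def[of d ?Q] using mv_eq_sum_columns[of d S1 v] by (simp add: x_def)
    also have "\<dots> = (\<Sum>k<d. v k * mv d ?Q (x k) i)"
      unfolding mv_def[of d ?Q] sum_distrib_left by (subst sum.swap) (intro sum.cong refl, simp add: mult_ac)
    also have "\<dots> = 0" using gram_schmidt_kills[OF projector_id_mat _ i, of _ d x] by simp
    finally show ?thesis .
  qed
  show "mv d ?Q (mv d S2 v) i = mv d S2 v i" if i: "i < d" for v i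
  proof (rule gram_schmidt_fixes[OF projector_id_mat _ _ i])
    show "mv d id_mat (mv d S2 v) i = mv d S2 v i" if "i < d" for i using that by (rule mv_id_mat)
    show "dot d (x k) (mv d S2 v) = 0" for k
      using assms by (simp add: cov_split_def x_def dot_def)
  qed
qed

text \<open>An explicit formula for the minimal norm solution of \<open>dot d (x k) u = z k\<close>:
  step \<open>k\<close> repairs equation \<open>k\<close> along the residual of \<open>x k\<close>,
  which is orthogonal to the earlier vectors. It is built from arithmetic operations, hence
  measurable in the data. For an inconsistent system its value has no meaning, and users must test
  the equations.\<close>

primrec min_sol :: "nat \<Rightarrow> (nat \<Rightarrow> nat \<Rightarrow> real) \<Rightarrow> (nat \<Rightarrow> real) \<Rightarrow> nat \<Rightarrow> nat \<Rightarrow> real" where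
  "min_sol d x z 0 = (\<lambda>i. 0)"
| "min_sol d x z (Suc k) = (let a = mv d (gram_schmidt d id_mat x k) (x k) in
     (\<lambda>i. min_sol d x z k i + (z k - dot d (x k) (min_sol d x z k)) / dot d a a * a i))"

text \<open>Subtracting from any solution \<open>v\<close> its component orthogonal to all
  \<open>x k\<close> gives the same vector. Solvability and minimality of \<open>min_sol\<close>
  follow from this.\<close>

lemma min_sol_eq:
  assumes "\<And>k. k < m \<Longrightarrow> dot d (x k) v = z k" "i < d"
  shows "min_sol d x z m i = v i - mv d (gram_schmidt d id_mat x m) v i"
  using assms
proof (induction m arbitrary: i)
  case 0
  then show ?case by (simp add: mv_id_mat)
next
  case (Suc m)
  let ?Q = "gram_schmidt d id_mat x m" and ?u = "min_sol d x z m"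
  let ?a = "mv d ?Q (x m)"
  have IH: "?u i = v i - 1 * mv d ?Q v i" if "i < d" for i using Suc that by simp
  have "dot d ?a v = dot d (x m) (mv d ?Q v)"
    using projector_gram_schmidt[OF projector_id_mat, of d x m] by (intro dot_mv_symmetric) (simp add: projector_def)
  moreover have "dot d (x m) ?u = dot d (x m) v - 1 * dot d (x m) (mv d ?Q v)"
    unfolding dot_diff_right[symmetric] by (intro dot_cong IH) auto
  ultimately have "dot d ?a v = z m - dot d (x m) ?u" using Suc.prems(1)[of m] by simp
  then show ?case using IH[OF Suc.prems(2)] by (simp add: Let_def mv_remove_dir)
qed

lemma min_sol_solves:
  assumes "\<And>k. k < m \<Longrightarrow> dot d (x k) v = z k" "k < m"
  shows "dot d (x k) (min_sol d x z m) = z k"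
proof -
  let ?Q = "gram_schmidt d id_mat x m"
  have "dot d (x k) (min_sol d x z m) = dot d (x k) (\<lambda>i. v i - 1 * mv d ?Q v i)"
    using min_sol_eq[of m d x v z] assms(1) by (intro dot_cong) auto
  also have "\<dots> = z k - dot d (x k) (mv d ?Q v)" unfolding dot_diff_right using assms by simp
  also have "dot d (x k) (mv d ?Q v) = dot d (mv d ?Q (x k)) v"
    using projector_gram_schmidt[OF projector_id_mat, of d x m] by (intro dot_mv_symmetric[symmetric]) (simp add: projector_def)
  also have "\<dots> = 0" using gram_schmidt_kills[OF projector_id_mat assms(2)] by (simp add: dot_def)
  finally show ?thesis by simp
qed

lemma min_sol_minimal:
  assumes "\<And>k. k < m \<Longrightarrow> dot d (x k) v = z k"
  shows "dot d (min_sol d x z m) (min_sol d x z m) \<le> dot d v v"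
proof -
  let ?Q = "gram_schmidt d id_mat x m"
  have "dot d (min_sol d x z m) (min_sol d x z m) = dot d (\<lambda>i. v i - mv d ?Q v i) (\<lambda>i. v i - mv d ?Q v i)"
    using min_sol_eq[of m d x v z] assms(1) by (intro dot_cong) auto
  then show ?thesis using projector_complement_norm[OF projector_gram_schmidt[OF projector_id_mat, of d x m], of v]
    dot_self_nonneg[of d "mv d ?Q v"] by linarith
qed

section \<open>Operator norm, Frobenius norm and trace\<close>

lemma dot_Cauchy_Schwarz: "(dot d u v)\<^sup>2 \<le> dot d u u * dot d v v"
  using Cauchy_Schwarz_ineq_sum[of u v "{..<d}"] by (simp add: dot_def power2_eq_square)

lemma mv_norm_le_frob: "dot d (mv d M v) (mv d M v) \<le> frob2 d M * dot d v v"
proof -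
  have "(mv d M v i)\<^sup>2 \<le> (\<Sum>j<d. (M i j)\<^sup>2) * dot d v v" for i
    using dot_Cauchy_Schwarz[of d "M i" v] by (simp add: mv_eq_dot dot_def[of d "M i" "M i"] power2_eq_square)
  then have "(\<Sum>i<d. (mv d M v i)\<^sup>2) \<le> (\<Sum>i<d. (\<Sum>j<d. (M i j)\<^sup>2) * dot d v v)" by (rule sum_mono)
  then show ?thesis by (simp add: frob2_def dot_def[of d "mv d M v"] power2_eq_square[of "mv d M v _"] sum_distrib_right)
qed

text \<open>The Frobenius bound shows that the set in \<open>opnorm\<close> is bounded above, so its
  supremum is a genuine one; the rest is scaling to unit length.\<close>

lemma opnorm_bound: "vnorm d (mv d M v) \<le> opnorm d M * vnorm d v"
proof -
  let ?A = "{vnorm d (mv d M v) | v. vnorm d v \<le> 1}"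
  have bdd: "bdd_above ?A"
  proof (rule bdd_aboveI)
    fix y assume "y \<in> ?A"
    then obtain v where v: "y = vnorm d (mv d M v)" "vnorm d v \<le> 1" by auto
    have "dot d v v \<le> 1" using v(2) by (simp add: vnorm_eq)
    then have "dot d (mv d M v) (mv d M v) \<le> frob2 d M * 1"
      using mv_norm_le_frob[of d M v] frob2_nonneg[of d M] by (meson mult_left_mono order_trans)
    then show "y \<le> sqrt (frob2 d M)" by (simp add: v(1) vnorm_eq)
  qed
  show ?thesis
  proof (cases "dot d v v = 0")
    case True
    then have "mv d M v i = 0" for i using dot_self_eq_0 by (intro mv_zero) blast
    then show ?thesis using True by (simp add: vnorm_eq dot_def)
  next
    case False
    define r where "r = vnorm d v"
    have r: "r > 0" "r\<^sup>2 = dot d v v" using False dot_self_nonneg[of d v] by (auto simp: r_def vnorm_eq)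
    define w where "w = (\<lambda>i. 0 + (1/r) * v i)"
    have "dot d w w = dot d v v / r\<^sup>2" by (simp add: w_def dot_def sum_divide_distrib power2_eq_square)
    then have "vnorm d w = 1" using r False by (simp add: vnorm_eq)
    then have "vnorm d (mv d M w) \<le> opnorm d M" unfolding opnorm_def by (intro cSup_upper bdd) auto
    moreover have "vnorm d (mv d M w) = vnorm d (mv d M v) / r"
    proof -
      have "mv d M w i = mv d M v i / r" for i unfolding w_def mv_add by (simp add: mv_def)
      then have "dot d (mv d M w) (mv d M w) = dot d (mv d M v) (mv d M v) / r\<^sup>2"
        by (simp add: dot_def sum_divide_distrib power2_eq_square)
      then show ?thesis using r(1) by (simp add: vnorm_eq[of d "mv d M _"] real_sqrt_divide del: r(2))
    qed
    ultimately show ?thesis using r by (simp add: r_def[symmetric] field_simps)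
  qed
qed

lemma psd_Cauchy_Schwarz:
  assumes "psd d S"
  shows "(dot d u (mv d S v))\<^sup>2 \<le> dot d u (mv d S u) * dot d v (mv d S v)"
proof -
  let ?B = "\<lambda>u v. dot d u (mv d S v)"
  have sym: "?B v u = ?B u v"
    using dot_mv_symmetric[OF psd_symmetric[OF assms], of v u] by (metis dot_commute)
  have q: "0 \<le> ?B u u + 2 * c * ?B u v + c\<^sup>2 * ?B v v" for c
  proof -
    let ?w = "\<lambda>i. u i + c * v i"
    have m: "mv d S ?w = (\<lambda>i. mv d S u i + c * mv d S v i)" by (rule ext) (rule mv_add)
    have "?B ?w ?w = ?B ?w u + c * ?B ?w v" unfolding m dot_add_right ..
    also have "\<dots> = ?B u u + c * ?B v u + c * (?B u v + c * ?B v v)"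
      by (subst (1 2) dot_commute, unfold dot_add_right) (simp add: dot_commute)
    finally show ?thesis using psd_dot_nonneg[OF assms, of ?w] by (simp add: sym power2_eq_square algebra_simps)
  qed
  show ?thesis
  proof (cases "?B v v = 0")
    case True
    have "?B u v = 0"
    proof (rule ccontr)
      assume "?B u v \<noteq> 0"
      then show False using q[of "- (?B u u + 1) / (2 * ?B u v)"] True by (simp add: field_simps)
    qed
    then show ?thesis using True by simp
  next
    case False
    then have "?B v v > 0" using psd_dot_nonneg[OF assms, of v] by linarith
    then show ?thesis using q[of "- ?B u v / ?B v v"] by (simp add: field_simps power2_eq_square)
  qed
qed

text \<open>It suffices to bound the squared norm of \<open>u = S v\<close> by
  \<open>opnorm d S\<close> times the form of \<open>S\<close> at \<open>v\<close>, and to sum over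
  unit vectors. The Cauchy-Schwarz inequality of the form \<open>S\<close>, applied to
  \<open>u\<close> and \<open>v\<close>, gives this without eigenvalues. In terms of effective ranks
  the lemma says \<open>r \<le> R\<close>.\<close>

lemma frob2_le_opnorm_trace:
  assumes "psd d S"
  shows "frob2 d S \<le> opnorm d S * mtrace d S"
proof -
  have col: "dot d (mv d S v) (mv d S v) \<le> opnorm d S * dot d v (mv d S v)" for v
  proof -
    let ?u = "mv d S v"
    define n where "n = dot d ?u ?u"
    have n0: "0 \<le> n" by (simp add: n_def dot_self_nonneg)
    have vv: "0 \<le> dot d v ?u" by (rule psd_dot_nonneg[OF assms])
    have "dot d ?u (mv d S ?u) \<le> \<bar>dot d ?u (mv d S ?u)\<bar>" by simp
    also have "\<dots> \<le> sqrt (n * dot d (mv d S ?u) (mv d S ?u))"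
      using dot_Cauchy_Schwarz[of d ?u "mv d S ?u"] unfolding n_def by (metis real_sqrt_abs real_sqrt_le_mono)
    also have "\<dots> = sqrt n * vnorm d (mv d S ?u)" by (simp add: real_sqrt_mult vnorm_eq)
    also have "\<dots> \<le> sqrt n * (opnorm d S * sqrt n)"
      using opnorm_bound[of d S ?u] n0 by (intro mult_left_mono) (auto simp: vnorm_eq n_def)
    also have "\<dots> = opnorm d S * n" using n0 by simp
    finally have "dot d ?u (mv d S ?u) \<le> opnorm d S * n" .
    then have "n\<^sup>2 \<le> opnorm d S * n * dot d v ?u"
      using psd_Cauchy_Schwarz[OF assms, of ?u v] vv by (simp add: n_def) (meson mult_right_mono order_trans)
    then have *: "n * n \<le> n * (opnorm d S * dot d v ?u)" by (simp add: power2_eq_square algebra_simps)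
    show ?thesis
    proof (cases "n = 0")
      case True
      have "0 \<le> opnorm d S * dot d v ?u"
      proof (cases "dot d v ?u = 0")
        case False
        then have "vnorm d v \<noteq> 0" using dot_Cauchy_Schwarz[of d v ?u] True by (auto simp: n_def)
        then have "0 < vnorm d v" using dot_self_nonneg by (simp add: vnorm_eq order.strict_iff_order)
        then have "0 \<le> opnorm d S" using opnorm_bound[of d S v]
          by (metis vnorm_eq dot_self_nonneg order_trans real_sqrt_ge_zero zero_le_mult_iff not_le)
        then show ?thesis using vv by simp
      qed simp
      then show ?thesis using True by (simp add: n_def)
    next
      case False
      then show ?thesis using * n0 by (simp add: n_def[symmetric])
    qed
  qed
  have "frob2 d S \<le> (\<Sum>j<d. opnorm d S * dot d (unit_vec j) (mv d S (unit_vec j)))"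
    unfolding frob2_eq by (intro sum_mono col)
  also have "\<dots> = opnorm d S * mtrace d S"
    by (simp add: sum_distrib_left mtrace_def dot_unit_vec mv_unit_vec)
  finally show ?thesis .
qed

section \<open>Quadratic forms of a projected design row\<close>

definition mmul :: "nat \<Rightarrow> (nat \<Rightarrow> nat \<Rightarrow> real) \<Rightarrow> (nat \<Rightarrow> nat \<Rightarrow> real) \<Rightarrow> nat \<Rightarrow> nat \<Rightarrow> real" where
  "mmul d P Q = (\<lambda>i j. \<Sum>k<d. P i k * Q k j)"

lemma mv_mmul: "mv d (mmul d P Q) v i = mv d P (mv d Q v) i"
  unfolding mv_def mmul_def sum_distrib_left sum_distrib_right
  by (subst sum.swap) (simp add: mult.assoc)

text \<open>Entrywise \<open>2 x y \<le> x\<^sup>2 + y\<^sup>2\<close> on transposed positions. It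
  is needed for a product of a projector with \<open>S2\<close>, which need not be
  symmetric.\<close>

lemma trprod_self_le_frob2: "trprod d W W \<le> frob2 d W"
proof -
  have "2 * (W i j * W j i) \<le> (W i j)\<^sup>2 + (W j i)\<^sup>2" for i j
    using sum_squares_bound[of "W i j" "W j i"] by (simp add: mult.assoc)
  then have "2 * trprod d W W \<le> (\<Sum>i<d. \<Sum>j<d. (W i j)\<^sup>2 + (W j i)\<^sup>2)"
    unfolding trprod_def sum_distrib_left by (intro sum_mono)
  also have "\<dots> = frob2 d W + (\<Sum>i<d. \<Sum>j<d. (W j i)\<^sup>2)" by (simp add: frob2_def sum.distrib)
  also have "(\<Sum>i<d. \<Sum>j<d. (W j i)\<^sup>2) = frob2 d W" unfolding frob2_def by (rule sum.swap)
  finally show ?thesis by simp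
qed

lemma dot_mv_left: "dot d (mv d A g) w = (\<Sum>j<d. g j * dot d (\<lambda>i. A i j) w)"
  unfolding dot_def mv_def sum_distrib_left sum_distrib_right
  by (subst sum.swap) (intro sum.cong refl, simp)

lemma mv_mv_columns: "mv d P (mv d A g) i = (\<Sum>k<d. g k * mv d P (\<lambda>i. A i k) i)"
  unfolding mv_def sum_distrib_left by (subst sum.swap) (intro sum.cong refl, simp)

lemma dot_mv_mv_columns: "dot d u (mv d P (mv d A g)) = (\<Sum>k<d. dot d u (mv d P (\<lambda>i. A i k)) * g k)"
  unfolding dot_def mv_mv_columns sum_distrib_left sum_distrib_right
  by (subst sum.swap) (intro sum.cong refl, simp)

text \<open>The matrices of the forms \<open>\<parallel>P A g\<parallel>\<^sup>2\<close> (for a projector \<open>P\<close>) and \<open>\<parallel>A\<^sup>T P A g\<parallel>\<^sup>2\<close> in \<open>g\<close>.\<close>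
definition gform :: "nat \<Rightarrow> (nat \<Rightarrow> nat \<Rightarrow> real) \<Rightarrow> (nat \<Rightarrow> nat \<Rightarrow> real) \<Rightarrow> nat \<Rightarrow> nat \<Rightarrow> real" where
  "gform d A P = (\<lambda>j k. dot d (\<lambda>i. A i j) (mv d P (\<lambda>i. A i k)))"

definition gform2 :: "nat \<Rightarrow> (nat \<Rightarrow> nat \<Rightarrow> real) \<Rightarrow> (nat \<Rightarrow> nat \<Rightarrow> real) \<Rightarrow> nat \<Rightarrow> nat \<Rightarrow> real" where
  "gform2 d A P = (\<lambda>j k. \<Sum>l<d. gform d A P l j * gform d A P l k)"

lemma gform_row: "(\<Sum>k<d. gform d A P j k * g k) = dot d (\<lambda>i. A i j) (mv d P (mv d A g))"
  by (simp add: dot_mv_mv_columns gform_def)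

lemma quad_gform:
  assumes "projector d P"
  shows "quad {..<d} (gform d A P) g = dot d (mv d P (mv d A g)) (mv d P (mv d A g))"
proof -
  have "quad {..<d} (gform d A P) g = (\<Sum>j<d. g j * (\<Sum>k<d. gform d A P j k * g k))"
    by (simp add: quad_def sum_distrib_left mult.assoc)
  then show ?thesis by (simp add: gform_row dot_mv_left[symmetric] dot_projector[OF assms])
qed

lemma psd_on_gform:
  assumes "projector d P"
  shows "psd_on {..<d} (gform d A P)"
  unfolding psd_on_def
proof (intro conjI ballI allI)
  fix j k
  have "dot d (\<lambda>i. A i j) (mv d P (\<lambda>i. A i k)) = dot d (mv d P (\<lambda>i. A i j)) (\<lambda>i. A i k)"
    using assms by (intro dot_mv_symmetric[symmetric]) (simp add: projector_def)
  then show "gform d A P j k = gform d A P k j" unfolding gform_def by (simp add: dot_commute)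
next
  show "0 \<le> quad {..<d} (gform d A P) v" for v by (simp add: quad_gform[OF assms] dot_self_nonneg)
qed

lemma quad_gform2: "quad {..<d} (gform2 d A P) g = (\<Sum>l<d. (dot d (\<lambda>i. A i l) (mv d P (mv d A g)))\<^sup>2)"
proof -
  have "(\<Sum>l<d. (\<Sum>k<d. gform d A P l k * g k)\<^sup>2)
      = (\<Sum>l<d. \<Sum>j<d. \<Sum>k<d. g j * (gform d A P l j * gform d A P l k) * g k)"
    unfolding power2_eq_square sum_product by (intro sum.cong refl) simp
  also have "\<dots> = (\<Sum>j<d. \<Sum>l<d. \<Sum>k<d. g j * (gform d A P l j * gform d A P l k) * g k)" by (rule sum.swap)
  also have "\<dots> = (\<Sum>j<d. \<Sum>k<d. \<Sum>l<d. g j * (gform d A P l j * gform d A P l k) * g k)"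
    by (intro sum.cong refl sum.swap)
  also have "\<dots> = quad {..<d} (gform2 d A P) g"
    by (simp add: quad_def gform2_def sum_distrib_left sum_distrib_right)
  finally show ?thesis by (simp add: gform_row)
qed

lemma psd_on_gform2: "psd_on {..<d} (gform2 d A P)"
  unfolding psd_on_def quad_gform2 by (simp add: gform2_def mult.commute sum_nonneg)

lemma trace_gform2: "(\<Sum>j<d. gform2 d A P j j) = frob2 d (gform d A P)"
  unfolding gform2_def frob2_def by (subst sum.swap) (simp add: power2_eq_square)

text \<open>The factor \<open>A\<close> mixes the two parts of the covariance. Only after projecting
  by \<open>Q0\<close>, or by any later stage of Gram-Schmidt started from it, do the traces and
  forms below depend on \<open>S2\<close> alone.\<close>

locale cov_projection =
  fixes d :: nat and A S S1 S2 Q0 :: "nat \<Rightarrow> nat \<Rightarrow> real"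
  assumes S_eq: "\<forall>i<d. \<forall>j<d. S i j = (\<Sum>k<d. A i k * A j k)"
    and split: "cov_split d S S1 S2"
    and Q0: "projector d Q0"
    and Q0_S1: "\<And>v i. i < d \<Longrightarrow> mv d Q0 (mv d S1 v) i = 0"
    and Q0_S2: "\<And>v i. i < d \<Longrightarrow> mv d Q0 (mv d S2 v) i = mv d S2 v i"
begin

lemma mv_S: "i < d \<Longrightarrow> mv d S v i = mv d S1 v i + 1 * mv d S2 v i"
  using split unfolding cov_split_def mv_def by (simp add: sum.distrib[symmetric] distrib_right)

lemma gs_S1: "i < d \<Longrightarrow> mv d (gram_schmidt d Q0 x m) (mv d S1 v) i = 0"
  by (rule gram_schmidt_zero[OF Q0 Q0_S1])

lemma gs_S:
  assumes "i < d"
  shows "mv d (gram_schmidt d Q0 x m) (mv d S v) i = mv d (gram_schmidt d Q0 x m) (mv d S2 v) i"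
proof -
  have "mv d (gram_schmidt d Q0 x m) (mv d S v) = mv d (gram_schmidt d Q0 x m) (\<lambda>i. mv d S1 v i + 1 * mv d S2 v i)"
    by (intro mv_cong mv_S)
  then show ?thesis using gs_S1[OF assms] by (simp only: mv_add)
qed

lemma projector_gs: "projector d (gram_schmidt d Q0 x m)"
  by (rule projector_gram_schmidt[OF Q0])

lemma sum_columns: "(\<Sum>k<d. dot d (\<lambda>i. A i k) (mv d B (\<lambda>i. A i k))) = trprod d B S"
proof -
  have "(\<Sum>k<d. dot d (\<lambda>i. A i k) (mv d B (\<lambda>i. A i k))) = (\<Sum>k<d. \<Sum>i<d. \<Sum>l<d. B i l * (A l k * A i k))"
    unfolding dot_def mv_def sum_distrib_left by (intro sum.cong refl) simp
  also have "\<dots> = (\<Sum>i<d. \<Sum>k<d. \<Sum>l<d. B i l * (A l k * A i k))" by (rule sum.swap)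
  also have "\<dots> = (\<Sum>i<d. \<Sum>l<d. \<Sum>k<d. B i l * (A l k * A i k))" by (intro sum.cong refl sum.swap)
  also have "\<dots> = trprod d B S" using S_eq by (simp add: trprod_def sum_distrib_left)
  finally show ?thesis .
qed

lemma sum_columns_sq: "(\<Sum>l<d. (dot d (\<lambda>i. A i l) y)\<^sup>2) = dot d y (mv d S y)"
proof -
  have "(\<Sum>l<d. (dot d (\<lambda>i. A i l) y)\<^sup>2) = (\<Sum>l<d. \<Sum>i<d. \<Sum>j<d. y i * (A i l * A j l * y j))"
    unfolding dot_def power2_eq_square sum_product by (intro sum.cong refl) simp
  also have "\<dots> = (\<Sum>i<d. \<Sum>l<d. \<Sum>j<d. y i * (A i l * A j l * y j))" by (rule sum.swap)
  also have "\<dots> = (\<Sum>i<d. \<Sum>j<d. \<Sum>l<d. y i * (A i l * A j l * y j))" by (intro sum.cong refl sum.swap)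
  also have "\<dots> = dot d y (mv d S y)"
    using S_eq by (simp add: dot_def mv_def sum_distrib_left sum_distrib_right)
  finally show ?thesis .
qed

text \<open>The conditional mean of \<open>D\<close> given the earlier rows: the trace of
  \<open>A\<^sup>T P A\<close> is that of \<open>P S\<close>, and \<open>P\<close> annihilates
  \<open>S1\<close>.\<close>

lemma trace_gform: "(\<Sum>k<d. gform d A (gram_schmidt d Q0 x m) k k) = trprod d (gram_schmidt d Q0 x m) S2"
  unfolding gform_def sum_columns by (simp add: trprod_eq gs_S)

text \<open>The squared Frobenius norm of \<open>A\<^sup>T P A\<close> is the trace of
  \<open>P S P S\<close>. Since \<open>P\<close> kills \<open>S1\<close>, this is the trace of
  \<open>W\<^sup>2\<close> for \<open>W = P S2\<close>, hence at most the squared Frobenius norm of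
  \<open>W\<close>, and a projector only shrinks columns.\<close>

lemma frob2_gform_le: "frob2 d (gform d A (gram_schmidt d Q0 x m)) \<le> frob2 d S2"
proof -
  define P where "P = gram_schmidt d Q0 x m"
  define W where "W = mmul d P S2"
  have P: "projector d P" unfolding P_def by (rule projector_gs)
  have "frob2 d (gform d A P) = (\<Sum>k<d. \<Sum>j<d. (dot d (\<lambda>i. A i j) (mv d P (\<lambda>i. A i k)))\<^sup>2)"
    unfolding frob2_def gform_def by (rule sum.swap)
  also have "\<dots> = (\<Sum>k<d. dot d (\<lambda>i. A i k) (mv d (mmul d P (mmul d S P)) (\<lambda>i. A i k)))"
    unfolding sum_columns_sq using P
    by (intro sum.cong refl) (simp add: dot_mv_symmetric projector_def mv_mmul[abs_def])
  also have "\<dots> = (\<Sum>i<d. mv d P (mv d S (mv d P (mv d S (unit_vec i)))) i)"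
    unfolding sum_columns trprod_eq by (simp add: mv_mmul[abs_def])
  also have "\<dots> = (\<Sum>i<d. mv d P (mv d S2 (mv d P (mv d S2 (unit_vec i)))) i)"
  proof (intro sum.cong refl)
    fix i assume "i \<in> {..<d}"
    then have "mv d P (mv d S (mv d P (mv d S (unit_vec i)))) i = mv d P (mv d S2 (mv d P (mv d S (unit_vec i)))) i"
      unfolding P_def by (simp add: gs_S)
    also have "mv d S2 (mv d P (mv d S (unit_vec i))) = mv d S2 (mv d P (mv d S2 (unit_vec i)))"
      unfolding P_def by (intro mv_cong gs_S)
    finally show "mv d P (mv d S (mv d P (mv d S (unit_vec i)))) i = mv d P (mv d S2 (mv d P (mv d S2 (unit_vec i)))) i" .
  qed
  also have "\<dots> = trprod d W W" by (simp add: trprod_eq W_def mv_mmul[abs_def])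
  also have "\<dots> \<le> frob2 d W" by (rule trprod_self_le_frob2)
  also have "\<dots> = (\<Sum>j<d. dot d (mv d P (mv d S2 (unit_vec j))) (mv d P (mv d S2 (unit_vec j))))"
    unfolding frob2_eq by (simp add: W_def mv_mmul[abs_def])
  also have "\<dots> \<le> frob2 d S2" unfolding frob2_eq[of d S2] by (intro sum_mono projector_contraction[OF P])
  finally show ?thesis by (simp add: P_def)
qed

text \<open>As \<open>w\<close> lies in the range of a projector that annihilates \<open>S1\<close>,
  the forms of \<open>S\<close> and \<open>S2\<close> agree at \<open>w\<close>. This exhibits
  \<open>N\<close> as a quadratic form in the Gaussian row, with trace controlled by
  \<open>frob2_gform_le\<close>.\<close>

lemma quad_gform2_gs:
  fixes x m g defines "w \<equiv> mv d (gram_schmidt d Q0 x m) (mv d A g)"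
  shows "quad {..<d} (gform2 d A (gram_schmidt d Q0 x m)) g = dot d w (mv d S2 w)"
proof -
  have sym: "symmetric d (gram_schmidt d Q0 x m)" using projector_gs unfolding projector_def by blast
  have "dot d w (mv d S1 w) = 0"
    unfolding w_def dot_mv_symmetric[OF sym] by (subst dot_def) (simp add: gs_S1)
  moreover have "dot d w (mv d S w) = dot d w (\<lambda>i. mv d S1 w i + 1 * mv d S2 w i)"
    by (intro dot_cong mv_S) auto
  ultimately show ?thesis
    unfolding quad_gform2 w_def[symmetric] sum_columns_sq by (simp only: dot_add_right)
qed

lemma trprod_Q0: "trprod d Q0 S2 = mtrace d S2"
  by (simp add: trprod_eq Q0_S2 mtrace_def mv_unit_vec)

lemma trprod_gs_ge: "mtrace d S2 - sqrt (real m * frob2 d S2) \<le> trprod d (gram_schmidt d Q0 x m) S2"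
  using trprod_gram_schmidt_ge[OF Q0, of S2 m x] split trprod_Q0 psd_symmetric by (simp add: cov_split_def)

end

text \<open>Fubini as a bound on conditional expectations: \<open>f\<close> ignores the block
  \<open>B\<close>, so a bound on the integral of \<open>g\<close> over \<open>B\<close> that is
  uniform in the other coordinates can be pulled out.\<close>

lemma nn_integral_block_le:
  fixes f g :: "('i \<Rightarrow> real) \<Rightarrow> ennreal"
  assumes I: "finite I" "B \<subseteq> I"
    and f [measurable]: "f \<in> borel_measurable (PiM I (\<lambda>_. N01))"
    and g [measurable]: "g \<in> borel_measurable (PiM I (\<lambda>_. N01))"
    and inv: "\<And>\<omega> \<omega>'. (\<And>i. i \<in> I - B \<Longrightarrow> \<omega> i = \<omega>' i) \<Longrightarrow> f \<omega> = f \<omega>'"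
    and le: "\<And>x. (\<integral>\<^sup>+y. g (merge (I - B) B (x, y)) \<partial>PiM B (\<lambda>_. N01)) \<le> c"
  shows "(\<integral>\<^sup>+\<omega>. f \<omega> * g \<omega> \<partial>PiM I (\<lambda>_. N01)) \<le> c * (\<integral>\<^sup>+\<omega>. f \<omega> \<partial>PiM I (\<lambda>_. N01))"
proof -
  let ?J = "I - B"
  have IJ: "?J \<inter> B = {}" "finite ?J" "finite B" "?J \<union> B = I" using I by (auto intro: finite_subset)
  have fold: "(\<integral>\<^sup>+\<omega>. h \<omega> \<partial>PiM I (\<lambda>_. N01))
      = (\<integral>\<^sup>+x. (\<integral>\<^sup>+y. h (merge ?J B (x, y)) \<partial>PiM B (\<lambda>_. N01)) \<partial>PiM ?J (\<lambda>_. N01))"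
    if "h \<in> borel_measurable (PiM I (\<lambda>_. N01))" for h :: "('i \<Rightarrow> real) \<Rightarrow> ennreal"
    using PN.product_nn_integral_fold[OF IJ(1-3), of h] that IJ(4) by simp
  \<comment> \<open>Since \<open>f\<close> ignores the block, an arbitrary point may be filled in
    there.\<close>
  define y0 :: "'i \<Rightarrow> real" where "y0 = (\<lambda>i\<in>B. 0)"
  have y0: "y0 \<in> space (PiM B (\<lambda>_. N01))" by (simp add: y0_def space_PiM)
  define F where "F x = f (merge ?J B (x, y0))" for x
  have f_inv: "f (merge ?J B (x, y)) = F x" for x y
    unfolding F_def by (rule inv) (simp add: merge_def)
  have mm [measurable]: "merge ?J B \<in> measurable (PiM ?J (\<lambda>_. N01) \<Otimes>\<^sub>M PiM B (\<lambda>_. N01)) (PiM I (\<lambda>_. N01))"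
    using measurable_merge[of ?J B "\<lambda>_. N01"] IJ(4) by simp
  have [measurable]: "F \<in> borel_measurable (PiM ?J (\<lambda>_. N01))"
    unfolding F_def using y0 by measurable
  have [measurable]: "(\<lambda>y. g (merge ?J B (x, y))) \<in> borel_measurable (PiM B (\<lambda>_. N01))" if "x \<in> space (PiM ?J (\<lambda>_. N01))" for x
    using that by measurable
  have "(\<integral>\<^sup>+\<omega>. f \<omega> * g \<omega> \<partial>PiM I (\<lambda>_. N01))
      = (\<integral>\<^sup>+x. (\<integral>\<^sup>+y. F x * g (merge ?J B (x, y)) \<partial>PiM B (\<lambda>_. N01)) \<partial>PiM ?J (\<lambda>_. N01))"
    by (subst fold) (simp_all add: f_inv)
  also have "\<dots> = (\<integral>\<^sup>+x. F x * (\<integral>\<^sup>+y. g (merge ?J B (x, y)) \<partial>PiM B (\<lambda>_. N01)) \<partial>PiM ?J (\<lambda>_. N01))"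
    by (intro nn_integral_cong nn_integral_cmult) simp
  also have "\<dots> \<le> (\<integral>\<^sup>+x. F x * c \<partial>PiM ?J (\<lambda>_. N01))"
    by (intro nn_integral_mono mult_left_mono le) auto
  also have "\<dots> = c * (\<integral>\<^sup>+x. F x \<partial>PiM ?J (\<lambda>_. N01))"
    by (subst nn_integral_multc) (auto simp: mult.commute)
  also have "(\<integral>\<^sup>+x. F x \<partial>PiM ?J (\<lambda>_. N01)) = (\<integral>\<^sup>+\<omega>. f \<omega> \<partial>PiM I (\<lambda>_. N01))"
    by (subst fold[OF f]) (simp add: f_inv PN.emeasure_space_1)
  finally show ?thesis .
qed

section \<open>Design rows as blocks of coordinates\<close>

type_synonym idx = "(nat \<times> nat) + nat"

definition row_idx :: "nat \<Rightarrow> nat \<Rightarrow> idx set" where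
  "row_idx d k = (\<lambda>j. Inl (k, j)) ` {..<d}"

text \<open>Transports a \<open>d\<close> by \<open>d\<close> matrix to the coordinates of one row,
  where the moment bounds over arbitrary index sets apply.\<close>

definition row_form :: "(nat \<Rightarrow> nat \<Rightarrow> real) \<Rightarrow> idx \<Rightarrow> idx \<Rightarrow> real" where
  "row_form M = (\<lambda>a b. M (snd (projl a)) (snd (projl b)))"

lemma inj_row: "inj_on (\<lambda>j. Inl (k, j)) X"
  by (auto simp: inj_on_def)

lemma quad_row_form: "quad (row_idx d k) (row_form M) \<omega> = quad {..<d} M (\<lambda>j. \<omega> (Inl (k, j)))"
  by (simp add: quad_def row_idx_def sum.reindex[OF inj_row] row_form_def)

lemma psd_on_row_form: "psd_on {..<d} M \<Longrightarrow> psd_on (row_idx d k) (row_form M)"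
  unfolding psd_on_def quad_row_form by (auto simp: row_idx_def row_form_def)

lemma trace_row_form: "(\<Sum>a\<in>row_idx d k. row_form M a a) = (\<Sum>j<d. M j j)"
  by (simp add: row_idx_def sum.reindex[OF inj_row] row_form_def)

lemma frob_row_form: "(\<Sum>a\<in>row_idx d k. \<Sum>b\<in>row_idx d k. (row_form M a b)\<^sup>2) = frob2 d M"
  by (simp add: row_idx_def sum.reindex[OF inj_row] row_form_def frob2_def)

lemma design_eq: "design d A \<omega> k = mv d A (\<lambda>j. \<omega> (Inl (k, j)))"
  by (simp add: design_def mv_def mult.commute)

lemma measurable_gs [measurable (raw)]:
  assumes [measurable]: "\<And>k j. k < m \<Longrightarrow> j < d \<Longrightarrow> (\<lambda>\<omega>. X \<omega> k j) \<in> borel_measurable M"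
    and "k \<le> m"
  shows "(\<lambda>\<omega>. gram_schmidt d Q (X \<omega>) k i j) \<in> borel_measurable M"
  using assms(2)
proof (induction k arbitrary: i j)
  case (Suc k)
  then have [measurable]: "(\<lambda>\<omega>. gram_schmidt d Q (X \<omega>) k i j) \<in> borel_measurable M" for i j by simp
  have [measurable]: "(\<lambda>\<omega>. X \<omega> k j) \<in> borel_measurable M" if "j < d" for j using assms(1) Suc.prems that by simp
  have [measurable]: "(\<lambda>\<omega>. mv d (gram_schmidt d Q (X \<omega>) k) (X \<omega> k) i) \<in> borel_measurable M" for i
    unfolding mv_def by measurable
  show ?case by (simp add: remove_dir_def dot_def)
qed simp

section \<open>Concentration along the Gram--Schmidt process\<close>

lemma (in prob_space) prob_ge_le_exp:
  assumes [measurable]: "g \<in> borel_measurable M"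
    and le: "(\<integral>\<^sup>+\<omega>. ennreal (exp (g \<omega>)) \<partial>M) \<le> ennreal (exp c)"
  shows "prob {\<omega> \<in> space M. a \<le> g \<omega>} \<le> exp (c - a)"
proof -
  have "emeasure M {\<omega> \<in> space M. a \<le> g \<omega>} = (\<integral>\<^sup>+\<omega>. indicator {\<omega> \<in> space M. a \<le> g \<omega>} \<omega> \<partial>M)"
    by simp
  also have "\<dots> \<le> (\<integral>\<^sup>+\<omega>. ennreal (exp (- a)) * ennreal (exp (g \<omega>)) \<partial>M)"
    by (intro nn_integral_mono) (auto simp: indicator_def one_le_exp_iff simp flip: ennreal_mult exp_add)
  also have "\<dots> = ennreal (exp (- a)) * (\<integral>\<^sup>+\<omega>. ennreal (exp (g \<omega>)) \<partial>M)"
    by (rule nn_integral_cmult) auto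
  also have "\<dots> \<le> ennreal (exp (- a)) * ennreal (exp c)"
    by (intro mult_left_mono le) auto
  also have "\<dots> = ennreal (exp (c - a))" by (simp flip: ennreal_mult exp_add)
  finally show ?thesis by (simp add: emeasure_eq_measure)
qed

text \<open>Stated by existence of a solution in a ball, because in this form the event is visibly
  unchanged when the equations are rotated.\<close>

definition solvable :: "nat \<Rightarrow> nat \<Rightarrow> (nat \<Rightarrow> nat \<Rightarrow> real) \<Rightarrow> (nat \<Rightarrow> real) \<Rightarrow> real \<Rightarrow> bool" where
  "solvable d n x z \<rho> \<longleftrightarrow> (\<exists>u. (\<forall>k<n. dot d (x k) u = z k) \<and> dot d u u \<le> \<rho>)"

text \<open>If the ball contains a solution, it contains the minimal one. The existential becomes
  finitely many conditions on one explicit vector, which gives measurability.\<close>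

lemma solvable_iff_min_sol:
  "solvable d n x z \<rho> \<longleftrightarrow> (\<forall>k<n. dot d (x k) (min_sol d x z n) = z k) \<and> dot d (min_sol d x z n) (min_sol d x z n) \<le> \<rho>"
proof
  assume "solvable d n x z \<rho>"
  then obtain u where u: "\<And>k. k < n \<Longrightarrow> dot d (x k) u = z k" and "dot d u u \<le> \<rho>"
    unfolding solvable_def by blast
  moreover have "dot d (min_sol d x z n) (min_sol d x z n) \<le> dot d u u" by (intro min_sol_minimal u)
  ultimately show "(\<forall>k<n. dot d (x k) (min_sol d x z n) = z k) \<and> dot d (min_sol d x z n) (min_sol d x z n) \<le> \<rho>"
    using min_sol_solves[of n d x u z] u by simp
qed (auto simp: solvable_def)

lemma solvable_cong:
  "(\<And>k j. k < n \<Longrightarrow> j < d \<Longrightarrow> x k j = x' k j) \<Longrightarrow> (\<And>k. k < n \<Longrightarrow> z k = z' k) \<Longrightarrow> solvable d n x z \<rho> = solvable d n x' z' \<rho>"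
  unfolding solvable_def dot_def by simp

lemma measurable_min_sol [measurable (raw)]:
  assumes [measurable]: "\<And>k j. k < n \<Longrightarrow> j < d \<Longrightarrow> (\<lambda>\<omega>. X \<omega> k j) \<in> borel_measurable M"
    and [measurable]: "\<And>k. k < n \<Longrightarrow> (\<lambda>\<omega>. Z \<omega> k) \<in> borel_measurable M"
    and "k \<le> n"
  shows "(\<lambda>\<omega>. min_sol d (X \<omega>) (Z \<omega>) k i) \<in> borel_measurable M"
  using assms(3)
proof (induction k arbitrary: i)
  case (Suc k)
  then have [measurable]: "(\<lambda>\<omega>. min_sol d (X \<omega>) (Z \<omega>) k i) \<in> borel_measurable M" for i by simp
  have X [measurable]: "(\<lambda>\<omega>. X \<omega> k j) \<in> borel_measurable M" if "j < d" for j using assms(1) Suc.prems that by simp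
  have [measurable]: "(\<lambda>\<omega>. Z \<omega> k) \<in> borel_measurable M" using assms(2) Suc.prems by simp
  have [measurable]: "(\<lambda>\<omega>. gram_schmidt d id_mat (X \<omega>) k i j) \<in> borel_measurable M" for i j
    using Suc.prems by (intro measurable_gs[of n d]) auto
  have [measurable]: "(\<lambda>\<omega>. mv d (gram_schmidt d id_mat (X \<omega>) k) (X \<omega> k) i) \<in> borel_measurable M" for i
    unfolding mv_def by measurable
  show ?case by (simp add: Let_def dot_def)
qed simp

lemma measurable_solvable:
  assumes [measurable]: "\<And>k j. k < n \<Longrightarrow> j < d \<Longrightarrow> (\<lambda>\<omega>. X \<omega> k j) \<in> borel_measurable M"
    and [measurable]: "\<And>k. k < n \<Longrightarrow> (\<lambda>\<omega>. Z \<omega> k) \<in> borel_measurable M"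
  shows "{\<omega> \<in> space M. solvable d n (X \<omega>) (Z \<omega>) \<rho>} \<in> sets M"
proof -
  have [measurable]: "(\<lambda>\<omega>. min_sol d (X \<omega>) (Z \<omega>) n i) \<in> borel_measurable M" for i
    by (rule measurable_min_sol[of n]) auto
  have [measurable]: "(\<lambda>\<omega>. dot d (X \<omega> k) (min_sol d (X \<omega>) (Z \<omega>) n)) \<in> borel_measurable M" if "k < n" for k
    unfolding dot_def using that by measurable
  have [measurable]: "(\<lambda>\<omega>. dot d (min_sol d (X \<omega>) (Z \<omega>) n) (min_sol d (X \<omega>) (Z \<omega>) n)) \<in> borel_measurable M"
    unfolding dot_def by measurable
  have "{\<omega> \<in> space M. solvable d n (X \<omega>) (Z \<omega>) \<rho>} =
    {\<omega> \<in> space M. (\<forall>k\<in>{..<n}. dot d (X \<omega> k) (min_sol d (X \<omega>) (Z \<omega>) n) = Z \<omega> k) \<and>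
       dot d (min_sol d (X \<omega>) (Z \<omega>) n) (min_sol d (X \<omega>) (Z \<omega>) n) \<le> \<rho>}"
    unfolding solvable_iff_min_sol by auto
  also have "\<dots> \<in> sets M"
    by (intro sets.sets_Collect_conj sets.sets_Collect_finite_All) auto
  finally show ?thesis .
qed

locale random_design = cov_projection +
  fixes n :: nat and I :: "idx set"
  assumes finite_I: "finite I" and rows_I: "k < n \<Longrightarrow> row_idx d k \<subseteq> I"
begin

abbreviation "MI \<equiv> PiM I (\<lambda>_. N01)"

definition "Qm \<omega> k = gram_schmidt d Q0 (design d A \<omega>) k"
definition "res \<omega> k = mv d (Qm \<omega> k) (design d A \<omega> k)"
definition "D \<omega> k = dot d (res \<omega> k) (res \<omega> k)"
definition "N \<omega> k = dot d (res \<omega> k) (mv d S2 (res \<omega> k))"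
definition "T \<omega> k = trprod d (Qm \<omega> k) S2"

abbreviation "F2 \<equiv> frob2 d S2"
abbreviation "t \<equiv> mtrace d S2"

lemma measurable_design [measurable]:
  assumes "k < n" shows "(\<lambda>\<omega>. design d A \<omega> k j) \<in> borel_measurable MI"
proof -
  have "(\<lambda>\<omega>. \<omega> (Inl (k, i))) \<in> borel_measurable MI" if "i < d" for i
  proof -
    have "Inl (k, i) \<in> I" using rows_I[OF assms] that by (auto simp: row_idx_def)
    then have "(\<lambda>\<omega>. \<omega> (Inl (k, i))) \<in> measurable MI N01" by (rule measurable_component_singleton)
    then show ?thesis by simp
  qed
  then show ?thesis unfolding design_def by (intro borel_measurable_sum borel_measurable_times) auto
qed

lemma measurable_Qm [measurable]: "k \<le> n \<Longrightarrow> (\<lambda>\<omega>. Qm \<omega> k i j) \<in> borel_measurable MI"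
  unfolding Qm_def by (rule measurable_gs[of n]) auto

lemma measurable_res [measurable]: "k < n \<Longrightarrow> (\<lambda>\<omega>. res \<omega> k i) \<in> borel_measurable MI"
  unfolding res_def mv_def by (intro borel_measurable_sum borel_measurable_times measurable_Qm measurable_design) auto

lemma measurable_D [measurable]: "k < n \<Longrightarrow> (\<lambda>\<omega>. D \<omega> k) \<in> borel_measurable MI"
  unfolding D_def dot_def by measurable

lemma measurable_N [measurable]: "k < n \<Longrightarrow> (\<lambda>\<omega>. N \<omega> k) \<in> borel_measurable MI"
  unfolding N_def dot_def mv_def[of d S2] by measurable

lemma measurable_T [measurable]: "k \<le> n \<Longrightarrow> (\<lambda>\<omega>. T \<omega> k) \<in> borel_measurable MI"
  unfolding T_def trprod_def by (intro borel_measurable_sum borel_measurable_times measurable_Qm borel_measurable_const)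

lemma N_nonneg: "0 \<le> N \<omega> k"
  using split psd_dot_nonneg unfolding N_def cov_split_def by blast

lemma T_Suc: "T \<omega> (Suc k) = T \<omega> k - N \<omega> k / D \<omega> k"
  by (simp add: T_def Qm_def trprod_remove_dir N_def D_def res_def)

lemma T_0: "T \<omega> 0 = t"
  by (simp add: T_def Qm_def trprod_Q0)

lemma T_ge: "t - sqrt (real k * F2) \<le> T \<omega> k"
  unfolding T_def Qm_def by (rule trprod_gs_ge)

lemma row_eq_imp_design_eq:
  "(\<And>j. j < d \<Longrightarrow> \<omega> (Inl (k, j)) = \<omega>' (Inl (k, j))) \<Longrightarrow> design d A \<omega> k = design d A \<omega>' k"
  unfolding design_eq by (rule mv_cong) auto

lemma Qm_cong:
  assumes "\<And>l j. l < k \<Longrightarrow> j < d \<Longrightarrow> \<omega> (Inl (l, j)) = \<omega>' (Inl (l, j))"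
  shows "Qm \<omega> k = Qm \<omega>' k"
proof -
  have "design d A \<omega> l = design d A \<omega>' l" if "l < k" for l
    using row_eq_imp_design_eq[of \<omega> l \<omega>'] assms that by simp
  then show ?thesis unfolding Qm_def by (intro gram_schmidt_cong)
qed

lemma N_cong:
  assumes "\<And>l j. l \<le> k \<Longrightarrow> j < d \<Longrightarrow> \<omega> (Inl (l, j)) = \<omega>' (Inl (l, j))"
  shows "N \<omega> k = N \<omega>' k"
  using Qm_cong[of k \<omega> \<omega>'] row_eq_imp_design_eq[of \<omega> k \<omega>'] assms by (simp add: N_def res_def)

text \<open>Conditioning on all coordinates outside row \<open>k\<close>. The projector at stage
  \<open>k\<close> sees only earlier rows, so it may be computed at \<open>\<omega>0\<close>, where
  row \<open>k\<close> is zero; \<open>D\<close> and \<open>N\<close> become quadratic forms in the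
  fresh Gaussian row \<open>y\<close>.\<close>

lemma frozen_rows:
  fixes k x y
  assumes k: "k < n"
  defines "\<omega> \<equiv> merge (I - row_idx d k) (row_idx d k) (x, y)"
    and "\<omega>0 \<equiv> merge (I - row_idx d k) (row_idx d k) (x, (\<lambda>_. 0))"
  shows "T \<omega> k = T \<omega>0 k"
    "D \<omega> k = quad (row_idx d k) (row_form (gform d A (Qm \<omega>0 k))) y"
    "N \<omega> k = quad (row_idx d k) (row_form (gform2 d A (Qm \<omega>0 k))) y"
proof -
  have eq: "\<omega> (Inl (l, j)) = \<omega>0 (Inl (l, j))" if "l < k" "j < d" for l j
    using that by (auto simp: \<omega>_def \<omega>0_def merge_def row_idx_def)
  have Q: "Qm \<omega> k = Qm \<omega>0 k" by (intro Qm_cong eq)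
  then show "T \<omega> k = T \<omega>0 k" by (simp add: T_def)
  have row: "design d A \<omega> k = mv d A (\<lambda>j. y (Inl (k, j)))"
    unfolding design_eq by (rule mv_cong) (auto simp: \<omega>_def merge_def row_idx_def)
  show "D \<omega> k = quad (row_idx d k) (row_form (gform d A (Qm \<omega>0 k))) y"
    unfolding D_def res_def Q row quad_row_form unfolding Qm_def by (rule quad_gform[OF projector_gs, symmetric])
  show "N \<omega> k = quad (row_idx d k) (row_form (gform2 d A (Qm \<omega>0 k))) y"
    unfolding N_def res_def Q row quad_row_form unfolding Qm_def by (rule quad_gform2_gs[symmetric])
qed

lemma finite_row: "finite (row_idx d k)"
  by (simp add: row_idx_def)

text \<open>Given the other coordinates, \<open>T\<close> is the mean of \<open>D\<close> and
  cancels the first-order term of the moment bound. What remains depends only on \<open>F2\<close>,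
  so the block lemma applies with the constant function 1.\<close>

lemma nn_integral_exp_D:
  assumes k: "k < n" and \<theta>: "0 \<le> \<theta>"
  shows "(\<integral>\<^sup>+\<omega>. ennreal (exp (\<theta> * (T \<omega> k - D \<omega> k))) \<partial>MI) \<le> ennreal (exp (\<theta>\<^sup>2 * F2))"
proof -
  have [measurable]: "(\<lambda>\<omega>. D \<omega> k) \<in> borel_measurable MI" "(\<lambda>\<omega>. T \<omega> k) \<in> borel_measurable MI" using k by auto
  have "(\<integral>\<^sup>+\<omega>. 1 * ennreal (exp (\<theta> * (T \<omega> k - D \<omega> k))) \<partial>MI) \<le> ennreal (exp (\<theta>\<^sup>2 * F2)) * (\<integral>\<^sup>+\<omega>. 1 \<partial>MI)"
  proof (rule nn_integral_block_le[where B = "row_idx d k"])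
    fix x :: "idx \<Rightarrow> real"
    define \<omega>0 where "\<omega>0 = merge (I - row_idx d k) (row_idx d k) (x, (\<lambda>_. 0))"
    define M where "M = gform d A (Qm \<omega>0 k)"
    have M: "psd_on {..<d} M" "(\<Sum>j<d. M j j) = T \<omega>0 k" "frob2 d M \<le> F2"
      unfolding M_def T_def Qm_def by (rule psd_on_gform projector_gs trace_gform frob2_gform_le)+
    note fr = frozen_rows[OF k, of x, folded \<omega>0_def]
    have "(\<integral>\<^sup>+y. ennreal (exp (\<theta> * (T (merge (I - row_idx d k) (row_idx d k) (x, y)) k - D (merge (I - row_idx d k) (row_idx d k) (x, y)) k))) \<partial>PiM (row_idx d k) (\<lambda>_. N01))
      = (\<integral>\<^sup>+y. ennreal (exp (\<theta> * T \<omega>0 k)) * ennreal (exp (- \<theta> * quad (row_idx d k) (row_form M) y)) \<partial>PiM (row_idx d k) (\<lambda>_. N01))"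
      unfolding fr M_def[symmetric]
      by (intro nn_integral_cong) (simp add: right_diff_distrib flip: ennreal_mult exp_add)
    also have "\<dots> = ennreal (exp (\<theta> * T \<omega>0 k)) * (\<integral>\<^sup>+y. ennreal (exp (- \<theta> * quad (row_idx d k) (row_form M) y)) \<partial>PiM (row_idx d k) (\<lambda>_. N01))"
      by (intro nn_integral_cmult) auto
    also have "\<dots> \<le> ennreal (exp (\<theta> * T \<omega>0 k)) * ennreal (exp (- \<theta> * T \<omega>0 k + \<theta>\<^sup>2 * frob2 d M))"
      using nn_integral_exp_quad_lower[OF finite_row psd_on_row_form[OF M(1)] \<theta>, of k]
      by (intro mult_left_mono) (simp_all add: trace_row_form frob_row_form M(2))
    also have "\<dots> = ennreal (exp (\<theta>\<^sup>2 * frob2 d M))" by (simp flip: ennreal_mult exp_add)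
    also have "\<dots> \<le> ennreal (exp (\<theta>\<^sup>2 * F2))" using M(3) by (intro ennreal_leI) (auto intro: mult_left_mono)
    finally show "(\<integral>\<^sup>+y. ennreal (exp (\<theta> * (T (merge (I - row_idx d k) (row_idx d k) (x, y)) k - D (merge (I - row_idx d k) (row_idx d k) (x, y)) k))) \<partial>PiM (row_idx d k) (\<lambda>_. N01)) \<le> ennreal (exp (\<theta>\<^sup>2 * F2))" .
  qed (use finite_I rows_I[OF k] in auto)
  then show ?thesis by (simp add: PN.emeasure_space_1)
qed

lemma D_lower_tail:
  assumes k: "k < n" and s: "0 \<le> s" and F: "0 < F2"
  shows "measure MI {\<omega> \<in> space MI. D \<omega> k \<le> T \<omega> k - s} \<le> exp (- s\<^sup>2 / (4 * F2))"
proof (cases "s = 0")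
  case False
  then have s: "s > 0" using s by simp
  have [measurable]: "(\<lambda>\<omega>. D \<omega> k) \<in> borel_measurable MI" "(\<lambda>\<omega>. T \<omega> k) \<in> borel_measurable MI" using k by auto
  \<comment> \<open>The minimizer of \<open>\<theta>\<^sup>2 * F2 - \<theta> * s\<close>.\<close>
  define \<theta> where "\<theta> = s / (2 * F2)"
  have \<theta>: "\<theta> > 0" using s F by (simp add: \<theta>_def)
  have "measure MI {\<omega> \<in> space MI. D \<omega> k \<le> T \<omega> k - s} = measure MI {\<omega> \<in> space MI. \<theta> * s \<le> \<theta> * (T \<omega> k - D \<omega> k)}"
    using \<theta> by (intro arg_cong[where f = "measure MI"] Collect_cong) (auto simp: mult_le_cancel_left_pos)
  also have "\<dots> \<le> exp (\<theta>\<^sup>2 * F2 - \<theta> * s)"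
    using nn_integral_exp_D[OF k, of \<theta>] \<theta> by (intro PN.prob_ge_le_exp) auto
  also have "\<theta>\<^sup>2 * F2 - \<theta> * s = - s\<^sup>2 / (4 * F2)"
    using F by (simp add: \<theta>_def field_simps power2_eq_square)
  finally show ?thesis .
qed simp

text \<open>Whatever the earlier rows are, the form of \<open>N\<close> in the next row has trace at
  most \<open>F2\<close>. Hence each row multiplies the moment by a fixed factor, although the terms
  of the sum are dependent.\<close>

lemma nn_integral_exp_N:
  assumes F: "0 < F2" and m: "m \<le> n"
  shows "(\<integral>\<^sup>+\<omega>. ennreal (exp ((\<Sum>k<m. N \<omega> k) / (4 * F2))) \<partial>MI) \<le> ennreal (exp (real m / 2))"
  using m
proof (induction m)
  case 0
  then show ?case by (simp add: PN.emeasure_space_1)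
next
  case (Suc m)
  \<comment> \<open>This makes \<open>2 * \<theta>\<close> times the trace at most 1/2, so a row
    costs a factor \<open>1 / sqrt (1/2)\<close>, which is at most \<open>exp (1/2)\<close> since
    \<open>exp 1 \<ge> 2\<close>.\<close>
  define \<theta> where "\<theta> = 1 / (4 * F2)"
  have \<theta>: "\<theta> > 0" using F by (simp add: \<theta>_def)
  have k: "m < n" using Suc.prems by simp
  have [measurable]: "(\<lambda>\<omega>. N \<omega> k) \<in> borel_measurable MI" if "k \<le> m" for k using k that by auto
  have sqrt2: "1 / sqrt (1 - 1/2) \<le> exp (1/2 :: real)"
  proof -
    have "(1 / sqrt (1 - 1/2))\<^sup>2 \<le> (exp (1/2 :: real))\<^sup>2"
      using exp_ge_add_one_self[of 1] by (simp add: power_divide flip: exp_double)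
    then show ?thesis by (rule power2_le_imp_le) simp
  qed
  have "(\<integral>\<^sup>+\<omega>. ennreal (exp ((\<Sum>k<m. N \<omega> k) / (4 * F2))) * ennreal (exp (\<theta> * N \<omega> m)) \<partial>MI)
     \<le> ennreal (exp (1/2)) * (\<integral>\<^sup>+\<omega>. ennreal (exp ((\<Sum>k<m. N \<omega> k) / (4 * F2))) \<partial>MI)"
  proof (rule nn_integral_block_le[where B = "row_idx d m"])
    fix x :: "idx \<Rightarrow> real"
    define \<omega>0 where "\<omega>0 = merge (I - row_idx d m) (row_idx d m) (x, (\<lambda>_. 0))"
    define M where "M = gform2 d A (Qm \<omega>0 m)"
    have tr: "(\<Sum>j<d. M j j) \<le> F2"
      unfolding M_def trace_gform2 Qm_def by (rule frob2_gform_le)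
    have "2 * \<theta> * (\<Sum>j<d. M j j) \<le> 2 * \<theta> * F2" using tr \<theta> by (intro mult_left_mono) auto
    then have h: "2 * \<theta> * (\<Sum>j<d. M j j) \<le> 1/2" using F by (simp add: \<theta>_def)
    note fr = frozen_rows(3)[OF k, of x, folded \<omega>0_def]
    have psd: "psd_on (row_idx d m) (row_form M)" unfolding M_def by (intro psd_on_row_form psd_on_gform2)
    have "(\<integral>\<^sup>+y. ennreal (exp (\<theta> * N (merge (I - row_idx d m) (row_idx d m) (x, y)) m)) \<partial>PiM (row_idx d m) (\<lambda>_. N01))
      \<le> ennreal (1 / sqrt (1 - 2 * \<theta> * (\<Sum>j<d. M j j)))"
      unfolding fr M_def[symmetric] using nn_integral_exp_quad_upper[OF finite_row psd, of \<theta>] \<theta> h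
      by (simp add: trace_row_form)
    also have "\<dots> \<le> ennreal (1 / sqrt (1 - 1/2))"
      using h by (intro ennreal_leI divide_left_mono real_sqrt_le_mono mult_pos_pos) auto
    also have "\<dots> \<le> ennreal (exp (1/2))" by (intro ennreal_leI sqrt2)
    finally show "(\<integral>\<^sup>+y. ennreal (exp (\<theta> * N (merge (I - row_idx d m) (row_idx d m) (x, y)) m)) \<partial>PiM (row_idx d m) (\<lambda>_. N01)) \<le> ennreal (exp (1/2))" .
  next
    fix \<omega> \<omega>' :: "idx \<Rightarrow> real"
    assume eq: "\<And>i. i \<in> I - row_idx d m \<Longrightarrow> \<omega> i = \<omega>' i"
    have "\<omega> (Inl (l, j)) = \<omega>' (Inl (l, j))" if "l < m" "j < d" for l j
      using rows_I[of l] that k by (intro eq) (auto simp: row_idx_def)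
    then have "N \<omega> l = N \<omega>' l" if "l < m" for l using that by (intro N_cong) auto
    then show "ennreal (exp ((\<Sum>k<m. N \<omega> k) / (4 * F2))) = ennreal (exp ((\<Sum>k<m. N \<omega>' k) / (4 * F2)))"
      by simp
  qed (use finite_I rows_I[OF k] in auto)
  also have "\<dots> \<le> ennreal (exp (1/2)) * ennreal (exp (real m / 2))"
    using Suc by (intro mult_left_mono) auto
  finally show ?case
    by (simp add: \<theta>_def add_divide_distrib exp_add flip: ennreal_mult)
qed

lemma N_upper_tail:
  assumes F: "0 < F2" and m: "m \<le> n"
  shows "measure MI {\<omega> \<in> space MI. 4 * F2 * (real m / 2 + s) \<le> (\<Sum>k<m. N \<omega> k)} \<le> exp (- s)"
proof -
  have [measurable]: "(\<lambda>\<omega>. N \<omega> k) \<in> borel_measurable MI" if "k < m" for k using m that by auto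
  have "measure MI {\<omega> \<in> space MI. 4 * F2 * (real m / 2 + s) \<le> (\<Sum>k<m. N \<omega> k)}
     = measure MI {\<omega> \<in> space MI. real m / 2 + s \<le> (\<Sum>k<m. N \<omega> k) / (4 * F2)}"
    using F by (intro arg_cong[where f = "measure MI"] Collect_cong) (auto simp: field_simps)
  also have "\<dots> \<le> exp (real m / 2 - (real m / 2 + s))"
    using nn_integral_exp_N[OF F m] by (intro PN.prob_ge_le_exp) auto
  finally show ?thesis by simp
qed

text \<open>The deterministic half of the argument. Once \<open>D \<omega> k \<ge> t / 2\<close>, a
  step of the recursion for \<open>T\<close> loses at most \<open>(2 / t) * N \<omega> k\<close>;
  after subtracting the total \<open>2 * K / t\<close> and the deviation \<open>s\<close> of the
  last row, \<open>D0\<close> still lies below \<open>D \<omega> m\<close>.\<close>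

lemma solvable_if_good:
  assumes t: "0 < t" and D: "\<And>k. k < m \<Longrightarrow> t / 2 \<le> D \<omega> k" and N: "(\<Sum>k<m. N \<omega> k) \<le> K"
    and Dm: "T \<omega> m - s \<le> D \<omega> m" and D0: "0 < D0" "D0 \<le> t - 2 * K / t - s"
  shows "solvable d (Suc m) (design d A \<omega>) (\<lambda>k. if k = m then \<zeta> else 0) (\<zeta>\<^sup>2 / D0)"
proof -
  have "t - (2 / t) * (\<Sum>k<j. N \<omega> k) \<le> T \<omega> j" if "j \<le> m" for j
    using that
  proof (induction j)
    case 0
    then show ?case by (simp add: T_0)
  next
    case (Suc j)
    have "N \<omega> j / D \<omega> j \<le> N \<omega> j / (t / 2)"
      using D[of j] Suc.prems t N_nonneg[of \<omega> j] by (intro divide_left_mono) auto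
    then show ?case using Suc by (simp add: T_Suc distrib_left algebra_simps)
  qed
  from this[of m] have "t - (2 / t) * (\<Sum>k<m. N \<omega> k) \<le> T \<omega> m" by simp
  moreover have "(2 / t) * (\<Sum>k<m. N \<omega> k) \<le> (2 / t) * K" using N t by (intro mult_left_mono) auto
  ultimately have DD: "D0 \<le> D \<omega> m" using Dm D0 by simp
  \<comment> \<open>The residual is orthogonal to the earlier rows and has inner product
    \<open>D \<omega> m\<close> with row \<open>m\<close>, which fixes the coefficient. The summand
    0 gives \<open>u\<close> the shape of \<open>dot_add_right\<close>.\<close>
  define u where "u = (\<lambda>i. 0 + (\<zeta> / D \<omega> m) * res \<omega> m i)"
  have sym: "symmetric d (Qm \<omega> m)" using projector_gs unfolding projector_def Qm_def by blast
  have "dot d (design d A \<omega> k) u = (if k = m then \<zeta> else 0)" if "k < Suc m" for k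
  proof (cases "k = m")
    case True
    have "dot d (design d A \<omega> m) (res \<omega> m) = D \<omega> m"
      using dot_projector[OF projector_gs[of "design d A \<omega>" m], of "design d A \<omega> m" "design d A \<omega> m"]
      by (simp add: D_def res_def Qm_def)
    then show ?thesis using DD D0 True unfolding u_def dot_add_right by (simp add: dot_def[of d _ "\<lambda>i. 0"])
  next
    case False
    then have "k < m" using that by simp
    then have "mv d (Qm \<omega> m) (design d A \<omega> k) i = 0" if "i < d" for i
      unfolding Qm_def using gram_schmidt_kills[OF Q0 _ that] by blast
    then have "dot d (design d A \<omega> k) (res \<omega> m) = 0"
      unfolding res_def dot_mv_symmetric[OF sym, symmetric] by (simp add: dot_def)
    then show ?thesis using False unfolding u_def dot_add_right by (simp add: dot_def[of d _ "\<lambda>i. 0"])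
  qed
  moreover have "dot d u u \<le> \<zeta>\<^sup>2 / D0"
  proof -
    have "dot d u u = (\<zeta> / D \<omega> m)\<^sup>2 * D \<omega> m"
      unfolding u_def D_def[of \<omega> m, unfolded dot_def] dot_def sum_distrib_left
      by (intro sum.cong refl) (simp add: power2_eq_square)
    also have "\<dots> = \<zeta>\<^sup>2 / D \<omega> m" using DD D0 by (simp add: power2_eq_square)
    also have "\<dots> \<le> \<zeta>\<^sup>2 / D0" using DD D0 by (intro divide_left_mono) auto
    finally show ?thesis .
  qed
  ultimately show ?thesis unfolding solvable_def by blast
qed

lemma measurable_solvable_design:
  "{\<omega> \<in> space MI. solvable d n (design d A \<omega>) z \<rho>} \<in> sets MI"
  by (rule measurable_solvable) auto

text \<open>A union bound over three kinds of failure. Earlier rows only have to keep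
  \<open>D\<close> above \<open>t / 2\<close>, so they are allowed the coarse deviation
  \<open>t / 4\<close>, and its tail survives a sum over the rows; the fine deviation
  \<open>s\<close> is charged to the last row only.\<close>

lemma prob_solvable_last:
  assumes n: "n = Suc m" and t: "0 < t" and F: "0 < F2" and R: "16 * real n * F2 \<le> t\<^sup>2"
    and p1: "real n * exp (- t\<^sup>2 / (64 * F2)) \<le> p"
    and p2: "exp (- s1) \<le> p" and p3: "exp (- s\<^sup>2 / (4 * F2)) \<le> p" and s: "0 \<le> s"
    and D0: "0 < D0" "D0 \<le> t - 2 * (4 * F2 * (real n / 2 + s1)) / t - s"
    and \<rho>: "\<zeta>\<^sup>2 / D0 \<le> \<rho>"
  shows "1 - 3 * p \<le> measure MI {\<omega> \<in> space MI. solvable d n (design d A \<omega>) (\<lambda>k. if k = m then \<zeta> else 0) \<rho>}"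
proof -
  let ?G = "{\<omega> \<in> space MI. solvable d n (design d A \<omega>) (\<lambda>k. if k = m then \<zeta> else 0) \<rho>}"
  define E1 where "E1 k = {\<omega> \<in> space MI. D \<omega> k \<le> T \<omega> k - t / 4}" for k
  define K where "K = 4 * F2 * (real m / 2 + s1)"
  define E2 where "E2 = {\<omega> \<in> space MI. K \<le> (\<Sum>k<m. N \<omega> k)}"
  define E3 where "E3 = {\<omega> \<in> space MI. D \<omega> m \<le> T \<omega> m - s}"
  have [measurable]: "(\<lambda>\<omega>. D \<omega> k) \<in> borel_measurable MI" "(\<lambda>\<omega>. T \<omega> k) \<in> borel_measurable MI"
    "(\<lambda>\<omega>. N \<omega> k) \<in> borel_measurable MI" if "k \<le> m" for k using n that by auto
  have m_ev [measurable]: "k < m \<Longrightarrow> E1 k \<in> sets MI" "E2 \<in> sets MI" "E3 \<in> sets MI" for k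
    unfolding E1_def E2_def E3_def by auto
  let ?B = "(\<Union>k<m. E1 k) \<union> E2 \<union> E3"
  have G: "?G \<in> sets MI" by (rule measurable_solvable_design)
  have "space MI - ?G \<subseteq> ?B"
  proof (rule subsetI, rule ccontr)
    fix \<omega> assume \<omega>: "\<omega> \<in> space MI - ?G" "\<omega> \<notin> ?B"
    have Dk: "t / 2 \<le> D \<omega> k" if "k < m" for k
    proof -
      \<comment> \<open>The assumption \<open>R\<close> brings the deterministic loss of trace down
        to \<open>t / 4\<close>, so \<open>T \<omega> k \<ge> 3 t / 4\<close>; a further deviation
        of \<open>t / 4\<close> leaves \<open>t / 2\<close>.\<close>
      have "real k * F2 \<le> real n * F2" using that n F by (intro mult_right_mono) auto
      then have "real k * F2 \<le> (t / 4)\<^sup>2" using R by (simp add: power_divide)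
      then have "sqrt (real k * F2) \<le> t / 4" using t by (intro real_le_lsqrt) auto
      moreover have "T \<omega> k - t / 4 < D \<omega> k" using \<omega> that by (auto simp: E1_def not_le)
      ultimately show ?thesis using T_ge[of k \<omega>] by linarith
    qed
    have N: "(\<Sum>k<m. N \<omega> k) \<le> K" and Dm: "T \<omega> m - s \<le> D \<omega> m"
      using \<omega> by (auto simp: E2_def E3_def)
    have "K \<le> 4 * F2 * (real n / 2 + s1)" unfolding K_def using F n by (intro mult_left_mono) auto
    then have "2 * K / t \<le> 2 * (4 * F2 * (real n / 2 + s1)) / t"
      using t by (intro divide_right_mono mult_left_mono) auto
    then have "D0 \<le> t - 2 * K / t - s" using D0 by linarith
    from solvable_if_good[OF t Dk N Dm D0(1) this, of \<zeta>]
    have "solvable d n (design d A \<omega>) (\<lambda>k. if k = m then \<zeta> else 0) \<rho>"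
      unfolding solvable_def n using \<rho> by (meson order_trans)
    then show False using \<omega> by simp
  qed
  then have "measure MI (space MI - ?G) \<le> measure MI ?B" by (intro PN.finite_measure_mono) auto
  also have "\<dots> \<le> measure MI (\<Union>k<m. E1 k) + measure MI E2 + measure MI E3"
    using measure_Un_le[of "(\<Union>k<m. E1 k) \<union> E2" MI E3] measure_Un_le[of "\<Union>k<m. E1 k" MI E2] m_ev by auto
  also have "measure MI (\<Union>k<m. E1 k) \<le> (\<Sum>k<m. measure MI (E1 k))"
    using m_ev by (intro measure_UNION_le) auto
  also have "\<dots> \<le> (\<Sum>k<m. exp (- t\<^sup>2 / (64 * F2)))"
  proof (rule sum_mono)
    fix k assume "k \<in> {..<m}"
    then show "measure MI (E1 k) \<le> exp (- t\<^sup>2 / (64 * F2))"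
      using D_lower_tail[of k "t / 4"] t F n by (simp add: E1_def power_divide)
  qed
  also have "\<dots> \<le> p" using p1 n by (simp add: algebra_simps) (smt (verit) exp_gt_zero)
  also have "measure MI E2 \<le> p" using N_upper_tail[OF F, of m s1] n p2 by (simp add: E2_def K_def)
  also have "measure MI E3 \<le> p" using D_lower_tail[of m s] n s F p3 by (simp add: E3_def)
  finally have "measure MI (space MI - ?G) \<le> 3 * p" by simp
  then show ?thesis using PN.prob_compl[OF G] by simp
qed

end

section \<open>Rotation invariance\<close>

text \<open>Two one-dimensional affine substitutions, both possible because
  \<open>s \<noteq> 0\<close>: for fixed \<open>x\<close> put \<open>v = c * x + s * y\<close>, so
  that the second argument becomes \<open>(c * v - x) / s\<close>; then for fixed \<open>v\<close>
  take this as the new variable. The factors \<open>\<bar>s\<bar>\<close> of the two steps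
  cancel.\<close>

lemma nn_integral_rotation_lborel:
  fixes c s :: real
  assumes g [measurable]: "g \<in> borel_measurable (borel \<Otimes>\<^sub>M borel)" and cs: "c\<^sup>2 + s\<^sup>2 = 1" and s: "s \<noteq> 0"
  shows "(\<integral>\<^sup>+y. \<integral>\<^sup>+x. g (c * x + s * y, c * y - s * x) \<partial>lborel \<partial>lborel)
    = (\<integral>\<^sup>+y. \<integral>\<^sup>+x. g (x, y) \<partial>lborel \<partial>lborel)"
proof -
  have Fubini: "(\<integral>\<^sup>+y. \<integral>\<^sup>+x. f (x, y) \<partial>lborel \<partial>lborel) = (\<integral>\<^sup>+x. \<integral>\<^sup>+y. f (x, y) \<partial>lborel \<partial>lborel)"
    if "f \<in> borel_measurable (borel \<Otimes>\<^sub>M borel)" for f :: "real \<times> real \<Rightarrow> ennreal"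
    using lborel_pair.Fubini[of f] that by simp
  have "ennreal \<bar>s\<bar> * (\<integral>\<^sup>+y. \<integral>\<^sup>+x. g (c * x + s * y, c * y - s * x) \<partial>lborel \<partial>lborel)
    = ennreal \<bar>s\<bar> * (\<integral>\<^sup>+x. \<integral>\<^sup>+y. g (c * x + s * y, c * y - s * x) \<partial>lborel \<partial>lborel)"
    using Fubini[of "\<lambda>p. g (c * fst p + s * snd p, c * snd p - s * fst p)"] by simp
  also have "\<dots> = (\<integral>\<^sup>+x. ennreal \<bar>s\<bar> * (\<integral>\<^sup>+y. g (c * x + s * y, c * y - s * x) \<partial>lborel) \<partial>lborel)"
    by (rule nn_integral_cmult[symmetric]) simp
  also have "\<dots> = (\<integral>\<^sup>+x. \<integral>\<^sup>+v. g (v, (c * v - x) / s) \<partial>lborel \<partial>lborel)"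
  proof (intro nn_integral_cong)
    fix x
    have e: "(c * (c * x + s * y) - x) / s = c * y - s * x" for y
    proof -
      have "c * (c * x + s * y) - x = (c\<^sup>2 + s\<^sup>2 - 1) * x + s * (c * y - s * x)"
        by (simp add: power2_eq_square algebra_simps)
      then show ?thesis using cs s by simp
    qed
    show "ennreal \<bar>s\<bar> * (\<integral>\<^sup>+y. g (c * x + s * y, c * y - s * x) \<partial>lborel) = (\<integral>\<^sup>+v. g (v, (c * v - x) / s) \<partial>lborel)"
      by (subst nn_integral_real_affine[OF _ s, of _ "c * x"]) (simp_all add: e)
  qed
  also have "\<dots> = (\<integral>\<^sup>+v. \<integral>\<^sup>+x. g (v, (c * v - x) / s) \<partial>lborel \<partial>lborel)"
    using Fubini[of "\<lambda>p. g (fst p, (c * fst p - snd p) / s)"] by simp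
  also have "\<dots> = (\<integral>\<^sup>+v. ennreal \<bar>s\<bar> * (\<integral>\<^sup>+w. g (v, w) \<partial>lborel) \<partial>lborel)"
  proof (intro nn_integral_cong)
    fix v
    have "ennreal \<bar>s\<bar> * (\<integral>\<^sup>+w. g (v, w) \<partial>lborel)
      = ennreal \<bar>s\<bar> * (ennreal \<bar>- 1 / s\<bar> * (\<integral>\<^sup>+x. g (v, c * v / s + - 1 / s * x) \<partial>lborel))"
      using s by (subst nn_integral_real_affine[of _ "- 1 / s" "c * v / s"]) simp_all
    also have "\<dots> = (\<integral>\<^sup>+x. g (v, (c * v - x) / s) \<partial>lborel)"
      using s by (simp add: mult.assoc[symmetric] diff_divide_distrib flip: ennreal_mult)
    finally show "(\<integral>\<^sup>+x. g (v, (c * v - x) / s) \<partial>lborel) = ennreal \<bar>s\<bar> * (\<integral>\<^sup>+w. g (v, w) \<partial>lborel)" ..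
  qed
  also have "\<dots> = ennreal \<bar>s\<bar> * (\<integral>\<^sup>+v. \<integral>\<^sup>+w. g (v, w) \<partial>lborel \<partial>lborel)"
    by (rule nn_integral_cmult) simp
  also have "(\<integral>\<^sup>+v. \<integral>\<^sup>+w. g (v, w) \<partial>lborel \<partial>lborel) = (\<integral>\<^sup>+y. \<integral>\<^sup>+x. g (x, y) \<partial>lborel \<partial>lborel)"
    by (rule Fubini[symmetric]) simp
  finally show ?thesis using s by (simp add: ennreal_mult_cancel_left)
qed

lemma nn_integral_N01_pair:
  assumes [measurable]: "h \<in> borel_measurable (borel \<Otimes>\<^sub>M borel)"
  shows "(\<integral>\<^sup>+y. \<integral>\<^sup>+x. h (x, y) \<partial>N01 \<partial>N01)
    = (\<integral>\<^sup>+y. \<integral>\<^sup>+x. ennreal (std_normal_density x * std_normal_density y) * h (x, y) \<partial>lborel \<partial>lborel)"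
proof -
  have "(\<integral>\<^sup>+y. \<integral>\<^sup>+x. h (x, y) \<partial>N01 \<partial>N01)
    = (\<integral>\<^sup>+y. ennreal (std_normal_density y) * (\<integral>\<^sup>+x. ennreal (std_normal_density x) * h (x, y) \<partial>lborel) \<partial>lborel)"
    by (simp add: nn_integral_density)
  also have "\<dots> = (\<integral>\<^sup>+y. \<integral>\<^sup>+x. ennreal (std_normal_density y) * (ennreal (std_normal_density x) * h (x, y)) \<partial>lborel \<partial>lborel)"
    by (intro nn_integral_cong nn_integral_cmult[symmetric]) simp
  also have "\<dots> = (\<integral>\<^sup>+y. \<integral>\<^sup>+x. ennreal (std_normal_density x * std_normal_density y) * h (x, y) \<partial>lborel \<partial>lborel)"
    by (intro nn_integral_cong) (simp add: ennreal_mult mult_ac)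
  finally show ?thesis .
qed

text \<open>The product density depends on \<open>x\<^sup>2 + y\<^sup>2\<close> only, which the
  rotation preserves.\<close>

lemma nn_integral_rotation_N01:
  fixes c s :: real
  assumes [measurable]: "h \<in> borel_measurable (borel \<Otimes>\<^sub>M borel)" and cs: "c\<^sup>2 + s\<^sup>2 = 1" and s: "s \<noteq> 0"
  shows "(\<integral>\<^sup>+y. \<integral>\<^sup>+x. h (c * x + s * y, c * y - s * x) \<partial>N01 \<partial>N01)
    = (\<integral>\<^sup>+y. \<integral>\<^sup>+x. h (x, y) \<partial>N01 \<partial>N01)"
proof -
  define g where "g = (\<lambda>p. ennreal (std_normal_density (fst p) * std_normal_density (snd p)) * h p)"
  have [measurable]: "g \<in> borel_measurable (borel \<Otimes>\<^sub>M borel)" unfolding g_def by measurable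
  have dens: "std_normal_density (c * x + s * y) * std_normal_density (c * y - s * x)
      = std_normal_density x * std_normal_density y" for x y
  proof -
    have "(c * x + s * y)\<^sup>2 + (c * y - s * x)\<^sup>2 = (c\<^sup>2 + s\<^sup>2) * (x\<^sup>2 + y\<^sup>2)"
      by (simp add: power2_eq_square algebra_simps)
    then have "- (c * x + s * y)\<^sup>2 / 2 + - (c * y - s * x)\<^sup>2 / 2 = - x\<^sup>2 / 2 + - y\<^sup>2 / 2"
      unfolding cs by (simp add: field_simps)
    then have "exp (- (c * x + s * y)\<^sup>2 / 2) * exp (- (c * y - s * x)\<^sup>2 / 2) = exp (- x\<^sup>2 / 2) * exp (- y\<^sup>2 / 2)"
      unfolding exp_add[symmetric] by (rule arg_cong)
    then show ?thesis unfolding std_normal_density_def by simp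
  qed
  have "(\<integral>\<^sup>+y. \<integral>\<^sup>+x. h (c * x + s * y, c * y - s * x) \<partial>N01 \<partial>N01)
    = (\<integral>\<^sup>+y. \<integral>\<^sup>+x. g (c * x + s * y, c * y - s * x) \<partial>lborel \<partial>lborel)"
    using nn_integral_N01_pair[of "\<lambda>p. h (c * fst p + s * snd p, c * snd p - s * fst p)"]
    by (simp add: g_def dens)
  also have "\<dots> = (\<integral>\<^sup>+y. \<integral>\<^sup>+x. g (x, y) \<partial>lborel \<partial>lborel)"
    by (rule nn_integral_rotation_lborel[OF _ cs s]) simp
  also have "\<dots> = (\<integral>\<^sup>+y. \<integral>\<^sup>+x. h (x, y) \<partial>N01 \<partial>N01)"
    unfolding g_def by (subst nn_integral_N01_pair) simp_all
  finally show ?thesis .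
qed

text \<open>A Givens rotation in two coordinates of any function. It acts both on the Gaussian
  variables and on the right-hand side \<open>z\<close>.\<close>

definition rot :: "'i \<Rightarrow> 'i \<Rightarrow> real \<Rightarrow> real \<Rightarrow> ('i \<Rightarrow> real) \<Rightarrow> 'i \<Rightarrow> real" where
  "rot a b c s \<omega> = fun_upd (fun_upd \<omega> a (c * \<omega> a + s * \<omega> b)) b (c * \<omega> b - s * \<omega> a)"

lemma measurable_rot:
  assumes "a \<in> I" "b \<in> I"
  shows "rot a b c s \<in> measurable (PiM I (\<lambda>_. N01)) (PiM I (\<lambda>_. N01))"
proof -
  have [measurable]: "(\<lambda>\<omega>. \<omega> i) \<in> borel_measurable (PiM I (\<lambda>_. N01))" if "i \<in> I" for i
    using measurable_component_singleton[OF that, of "\<lambda>_. N01"] by simp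
  show ?thesis unfolding rot_def[abs_def]
    using assms by (intro measurable_fun_upd[where J = I] measurable_ident) auto
qed

lemma nn_integral_rot:
  fixes f :: "('i \<Rightarrow> real) \<Rightarrow> ennreal"
  assumes I: "finite I" "a \<in> I" "b \<in> I" "a \<noteq> b" and cs: "c\<^sup>2 + s\<^sup>2 = 1" "s \<noteq> 0"
    and f: "f \<in> borel_measurable (PiM I (\<lambda>_. N01))"
  shows "(\<integral>\<^sup>+\<omega>. f (rot a b c s \<omega>) \<partial>PiM I (\<lambda>_. N01)) = (\<integral>\<^sup>+\<omega>. f \<omega> \<partial>PiM I (\<lambda>_. N01))"
proof -
  define J where "J = I - {a, b}"
  have J: "finite J" "b \<notin> J" "a \<notin> insert b J" "I = insert a (insert b J)" using I by (auto simp: J_def)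
  have fold: "(\<integral>\<^sup>+\<omega>. F \<omega> \<partial>PiM I (\<lambda>_. N01))
     = (\<integral>\<^sup>+w. \<integral>\<^sup>+y. \<integral>\<^sup>+x. F (w(b := y, a := x)) \<partial>N01 \<partial>N01 \<partial>PiM J (\<lambda>_. N01))"
    if F: "F \<in> borel_measurable (PiM I (\<lambda>_. N01))" for F :: "('i \<Rightarrow> real) \<Rightarrow> ennreal"
  proof -
    have [measurable]: "F \<in> borel_measurable (PiM (insert a (insert b J)) (\<lambda>_. N01))" using F J(4) by simp
    have m [measurable]: "(\<lambda>w. \<integral>\<^sup>+x. F (w(a := x)) \<partial>N01) \<in> borel_measurable (PiM (insert b J) (\<lambda>_. N01))"
      by (intro N01.borel_measurable_nn_integral) measurable
    have "(\<integral>\<^sup>+\<omega>. F \<omega> \<partial>PiM I (\<lambda>_. N01)) = (\<integral>\<^sup>+w. \<integral>\<^sup>+x. F (w(a := x)) \<partial>N01 \<partial>PiM (insert b J) (\<lambda>_. N01))"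
      unfolding J(4) using J by (intro PN.product_nn_integral_insert) auto
    also have "\<dots> = (\<integral>\<^sup>+w. \<integral>\<^sup>+y. \<integral>\<^sup>+x. F (w(b := y, a := x)) \<partial>N01 \<partial>N01 \<partial>PiM J (\<lambda>_. N01))"
      using J by (intro PN.product_nn_integral_insert m) auto
    finally show ?thesis .
  qed
  have "(\<integral>\<^sup>+\<omega>. f (rot a b c s \<omega>) \<partial>PiM I (\<lambda>_. N01))
    = (\<integral>\<^sup>+w. \<integral>\<^sup>+y. \<integral>\<^sup>+x. f (rot a b c s (w(b := y, a := x))) \<partial>N01 \<partial>N01 \<partial>PiM J (\<lambda>_. N01))"
    by (intro fold measurable_compose[OF measurable_rot f] I)
  also have "\<dots> = (\<integral>\<^sup>+w. \<integral>\<^sup>+y. \<integral>\<^sup>+x. f (w(b := y, a := x)) \<partial>N01 \<partial>N01 \<partial>PiM J (\<lambda>_. N01))"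
  proof (rule nn_integral_cong)
    fix w assume w: "w \<in> space (PiM J (\<lambda>_. N01))"
    have "(\<lambda>p. w(b := snd p, a := fst p)) \<in> measurable (borel \<Otimes>\<^sub>M borel) (PiM I (\<lambda>_. N01))"
      using w by (intro measurable_fun_upd[where J = "insert b J"] measurable_fun_upd[where J = J] measurable_const)
        (auto simp: J(4))
    then have "(\<lambda>p. f (w(b := snd p, a := fst p))) \<in> borel_measurable (borel \<Otimes>\<^sub>M borel)"
      by (rule measurable_compose[OF _ f])
    from nn_integral_rotation_N01[OF this cs]
    have "(\<integral>\<^sup>+y. \<integral>\<^sup>+x. f (w(b := c * y - s * x, a := c * x + s * y)) \<partial>N01 \<partial>N01)
      = (\<integral>\<^sup>+y. \<integral>\<^sup>+x. f (w(b := y, a := x)) \<partial>N01 \<partial>N01)" by simp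
    moreover have "rot a b c s (w(b := y, a := x)) = w(b := c * y - s * x, a := c * x + s * y)" for x y
      using I(4) by (auto simp: rot_def fun_eq_iff)
    ultimately show "(\<integral>\<^sup>+y. \<integral>\<^sup>+x. f (rot a b c s (w(b := y, a := x))) \<partial>N01 \<partial>N01)
      = (\<integral>\<^sup>+y. \<integral>\<^sup>+x. f (w(b := y, a := x)) \<partial>N01 \<partial>N01)" by simp
  qed
  also have "\<dots> = (\<integral>\<^sup>+\<omega>. f \<omega> \<partial>PiM I (\<lambda>_. N01))" by (rule fold[OF f, symmetric])
  finally show ?thesis .
qed

text \<open>Rows \<open>p\<close> and \<open>q\<close> are rotated by one angle, column after
  column; each factor rotates just two coordinates and preserves the product measure.\<close>

primrec rot_rows :: "nat \<Rightarrow> nat \<Rightarrow> real \<Rightarrow> real \<Rightarrow> nat \<Rightarrow> (idx \<Rightarrow> real) \<Rightarrow> idx \<Rightarrow> real" where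
  "rot_rows p q c s 0 \<omega> = \<omega>"
| "rot_rows p q c s (Suc m) \<omega> = rot (Inl (p, m)) (Inl (q, m)) c s (rot_rows p q c s m \<omega>)"

lemma rot_rows_Inl:
  assumes "p \<noteq> q"
  shows "rot_rows p q c s m \<omega> (Inl (r, k)) =
    (if k < m \<and> r = p then c * \<omega> (Inl (p, k)) + s * \<omega> (Inl (q, k))
     else if k < m \<and> r = q then c * \<omega> (Inl (q, k)) - s * \<omega> (Inl (p, k)) else \<omega> (Inl (r, k)))"
  using assms by (induction m arbitrary: r k) (auto simp: rot_def less_Suc_eq)

text \<open>Equations \<open>p\<close> and \<open>q\<close> are replaced by two combinations that
  the transposed rotation undoes, so both systems have the same solutions.\<close>

lemma solvable_rot:
  assumes pq: "p < n" "q < n" "p \<noteq> q" and cs: "c\<^sup>2 + s\<^sup>2 = 1"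
    and x': "\<And>i. i < d \<Longrightarrow> x' p i = c * x p i + s * x q i" "\<And>i. i < d \<Longrightarrow> x' q i = c * x q i - s * x p i"
      "\<And>k i. k \<noteq> p \<Longrightarrow> k \<noteq> q \<Longrightarrow> i < d \<Longrightarrow> x' k i = x k i"
  shows "solvable d n x' (rot p q c s z) \<rho> \<longleftrightarrow> solvable d n x z \<rho>"
proof -
  have "(\<forall>k<n. dot d (x' k) u = rot p q c s z k) \<longleftrightarrow> (\<forall>k<n. dot d (x k) u = z k)" for u
  proof -
    define a where "a = dot d (x p) u"
    define b where "b = dot d (x q) u"
    have p: "dot d (x' p) u = c * a + s * b"
      unfolding a_def b_def using x'(1) by (simp add: dot_def sum.distrib sum_distrib_left algebra_simps)
    have q: "dot d (x' q) u = c * b - s * a"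
    proof -
      have "dot d (x' q) u = (\<Sum>i<d. c * (x q i * u i) - s * (x p i * u i))"
        unfolding dot_def by (intro sum.cong refl) (simp add: x'(2) left_diff_distrib)
      then show ?thesis by (simp add: a_def b_def dot_def sum_subtractf sum_distrib_left)
    qed
    have o: "dot d (x' k) u = dot d (x k) u" if "k \<noteq> p" "k \<noteq> q" for k
      using x'(3)[OF that] by (intro dot_cong) auto
    have "c * a + s * b = c * z p + s * z q \<and> c * b - s * a = c * z q - s * z p \<longleftrightarrow> a = z p \<and> b = z q"
    proof
      assume h: "c * a + s * b = c * z p + s * z q \<and> c * b - s * a = c * z q - s * z p"
      have "(c\<^sup>2 + s\<^sup>2) * a = c * (c * a + s * b) - s * (c * b - s * a)" by (simp add: power2_eq_square algebra_simps)
      also have "\<dots> = c * (c * z p + s * z q) - s * (c * z q - s * z p)" using h by simp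
      also have "\<dots> = (c\<^sup>2 + s\<^sup>2) * z p" by (simp add: power2_eq_square algebra_simps)
      finally have a: "a = z p" using cs by simp
      have "(c\<^sup>2 + s\<^sup>2) * b = s * (c * a + s * b) + c * (c * b - s * a)" by (simp add: power2_eq_square algebra_simps)
      also have "\<dots> = s * (c * z p + s * z q) + c * (c * z q - s * z p)" using h by simp
      also have "\<dots> = (c\<^sup>2 + s\<^sup>2) * z q" by (simp add: power2_eq_square algebra_simps)
      finally show "a = z p \<and> b = z q" using a cs by simp
    qed auto
    then have pq': "(dot d (x' p) u = rot p q c s z p \<and> dot d (x' q) u = rot p q c s z q)
        \<longleftrightarrow> (dot d (x p) u = z p \<and> dot d (x q) u = z q)"
      using pq(3) by (simp add: p q rot_def a_def[symmetric] b_def[symmetric])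
    have o': "rot p q c s z k = z k" if "k \<noteq> p" "k \<noteq> q" for k using that by (simp add: rot_def)
    have split: "(\<forall>k<n. P k) \<longleftrightarrow> (P p \<and> P q) \<and> (\<forall>k<n. k \<noteq> p \<longrightarrow> k \<noteq> q \<longrightarrow> P k)" for P
      using pq by blast
    show ?thesis
      unfolding split[of "\<lambda>k. dot d (x' k) u = _ k"] split[of "\<lambda>k. dot d (x k) u = _ k"] pq' using o o' by simp
  qed
  then show ?thesis unfolding solvable_def by simp
qed

context random_design
begin

lemma rot_rows_invariant:
  assumes pq: "p < n" "q < n" "p \<noteq> q" and cs: "c\<^sup>2 + s\<^sup>2 = 1" "s \<noteq> 0"
    and f: "f \<in> borel_measurable MI" and m: "m \<le> d"
  shows "rot_rows p q c s m \<in> measurable MI MI"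
    and "(\<integral>\<^sup>+\<omega>. f (rot_rows p q c s m \<omega>) \<partial>MI) = (\<integral>\<^sup>+\<omega>. f \<omega> \<partial>MI)"
  using f m
proof (induction m arbitrary: f)
  case 0
  { case 1 show ?case by simp }
  { case 2 show ?case by simp }
next
  case (Suc m)
  have mem: "Inl (p, m) \<in> I" "Inl (q, m) \<in> I" "Inl (p, m) \<noteq> (Inl (q, m) :: idx)" if "Suc m \<le> d"
    using rows_I[OF pq(1)] rows_I[OF pq(2)] pq(3) that by (auto simp: row_idx_def)
  { case 1
    show ?case using measurable_compose[OF Suc.IH(1) measurable_rot[OF mem(1,2)], of _ c s] 1 by simp }
  { case 2
    have "(\<lambda>\<omega>. f (rot (Inl (p, m)) (Inl (q, m)) c s \<omega>)) \<in> borel_measurable MI"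
      using 2 by (intro measurable_compose[OF measurable_rot 2(1)] mem)
    then have "(\<integral>\<^sup>+\<omega>. f (rot_rows p q c s (Suc m) \<omega>) \<partial>MI) = (\<integral>\<^sup>+\<omega>. f (rot (Inl (p, m)) (Inl (q, m)) c s \<omega>) \<partial>MI)"
      using Suc.IH(2)[of "\<lambda>\<omega>. f (rot (Inl (p, m)) (Inl (q, m)) c s \<omega>)"] 2 by simp
    also have "\<dots> = (\<integral>\<^sup>+\<omega>. f \<omega> \<partial>MI)" using 2 by (intro nn_integral_rot finite_I mem cs)
    finally show ?case . }
qed

definition "psolve z \<rho> = measure MI {\<omega> \<in> space MI. solvable d n (design d A \<omega>) z \<rho>}"

text \<open>Rotating rows and right-hand side together preserves the solutions, and rotating the
  rows alone preserves the law of the design. Hence rotating the right-hand side alone leaves the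
  probability unchanged.\<close>

lemma psolve_rot:
  assumes pq: "p < n" "q < n" "p \<noteq> q" and cs: "c\<^sup>2 + s\<^sup>2 = 1" "s \<noteq> 0"
  shows "psolve (rot p q c s z) \<rho> = psolve z \<rho>"
proof -
  let ?E = "\<lambda>z. {\<omega> \<in> space MI. solvable d n (design d A \<omega>) z \<rho>}"
  have m: "rot_rows p q c s d \<in> measurable MI MI" by (rule rot_rows_invariant[OF pq cs, of "\<lambda>_. 0"]) auto
  have "solvable d n (design d A (rot_rows p q c s d \<omega>)) (rot p q c s z) \<rho> = solvable d n (design d A \<omega>) z \<rho>" for \<omega>
    by (rule solvable_rot[OF pq cs(1)])
       (use pq(3) in \<open>auto simp: design_def rot_rows_Inl sum.distrib sum_subtractf sum_distrib_left algebra_simps\<close>)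
  then have "indicator (?E (rot p q c s z)) (rot_rows p q c s d \<omega>) = (indicator (?E z) \<omega> :: ennreal)" if "\<omega> \<in> space MI" for \<omega>
    using measurable_space[OF m that] that by (simp add: indicator_def)
  then have "(\<integral>\<^sup>+\<omega>. indicator (?E z) \<omega> \<partial>MI) = (\<integral>\<^sup>+\<omega>. indicator (?E (rot p q c s z)) (rot_rows p q c s d \<omega>) \<partial>MI)"
    by (intro nn_integral_cong) simp
  also have "\<dots> = (\<integral>\<^sup>+\<omega>. indicator (?E (rot p q c s z)) \<omega> \<partial>MI)"
    using measurable_solvable_design by (intro rot_rows_invariant(2)[OF pq cs]) auto
  finally show ?thesis unfolding psolve_def using measurable_solvable_design
    by (simp add: measure_def)
qed

lemma psolve_cong: "(\<And>k. k < n \<Longrightarrow> z k = z' k) \<Longrightarrow> psolve z \<rho> = psolve z' \<rho>"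
  unfolding psolve_def using solvable_cong[of n d _ _ z z' \<rho>] by simp

text \<open>Givens rotations move all the mass of \<open>z\<close> into its last coordinate.\<close>
lemma psolve_canonical:
  assumes n: "n = Suc m"
  shows "\<exists>\<zeta>. \<zeta>\<^sup>2 = (\<Sum>k<n. (z k)\<^sup>2) \<and> psolve z \<rho> = psolve (\<lambda>k. if k = m then \<zeta> else 0) \<rho>"
proof -
  have "\<exists>z'. (\<forall>k<j. z' k = 0) \<and> (\<Sum>k<n. (z' k)\<^sup>2) = (\<Sum>k<n. (z k)\<^sup>2) \<and> psolve z \<rho> = psolve z' \<rho>" if "j \<le> m" for j
    using that
  proof (induction j)
    case (Suc j)
    then obtain z' where z': "\<forall>k<j. z' k = 0" "(\<Sum>k<n. (z' k)\<^sup>2) = (\<Sum>k<n. (z k)\<^sup>2)" "psolve z \<rho> = psolve z' \<rho>" by auto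
    show ?case
    proof (cases "z' j = 0")
      case True
      then show ?thesis using z' by (auto simp: less_Suc_eq)
    next
      case False
      \<comment> \<open>The angle moves the mass of entry \<open>j\<close> into entry
        \<open>Suc j\<close>. Here \<open>s \<noteq> 0\<close> because
        \<open>z' j \<noteq> 0\<close>; a zero entry was skipped without rotating.\<close>
      define r where "r = sqrt ((z' j)\<^sup>2 + (z' (Suc j))\<^sup>2)"
      have rr: "0 < (z' j)\<^sup>2 + (z' (Suc j))\<^sup>2" using False by (simp add: sum_power2_gt_zero_iff)
      then have r: "r > 0" "r\<^sup>2 = (z' j)\<^sup>2 + (z' (Suc j))\<^sup>2" by (auto simp: r_def)
      define c where "c = z' (Suc j) / r"
      define s where "s = - z' j / r"
      have cs: "c\<^sup>2 + s\<^sup>2 = 1" "s \<noteq> 0" using r False rr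
        by (simp_all add: c_def s_def power_divide add.commute flip: add_divide_distrib)
      have jn: "j < n" "Suc j < n" "j \<noteq> Suc j" using Suc.prems n by auto
      let ?w = "rot j (Suc j) c s z'"
      have w: "?w j = 0" "?w (Suc j) = r"
      proof -
        show "?w j = 0" using r by (simp add: rot_def c_def s_def)
        have "c * z' (Suc j) - s * z' j = r\<^sup>2 / r" unfolding r(2) c_def s_def by (simp add: power2_eq_square add_divide_distrib)
        then show "?w (Suc j) = r" using r(1) by (simp add: rot_def power2_eq_square)
      qed
      have o: "?w k = z' k" if "k \<noteq> j" "k \<noteq> Suc j" for k using that by (simp add: rot_def)
      have split: "(\<Sum>k<n. (y k)\<^sup>2) = (y j)\<^sup>2 + (y (Suc j))\<^sup>2 + (\<Sum>k\<in>{..<n} - {j} - {Suc j}. (y k)\<^sup>2)" for y :: "nat \<Rightarrow> real"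
        using jn by (simp add: sum.remove[of "{..<n}" j] sum.remove[of "{..<n} - {j}" "Suc j"])
      have "(\<Sum>k\<in>{..<n} - {j} - {Suc j}. (?w k)\<^sup>2) = (\<Sum>k\<in>{..<n} - {j} - {Suc j}. (z' k)\<^sup>2)"
        using o by (intro sum.cong refl) auto
      then have "(\<Sum>k<n. (?w k)\<^sup>2) = (\<Sum>k<n. (z' k)\<^sup>2)"
        unfolding split[of ?w] split[of z'] w using r(2) by simp
      moreover have "\<forall>k<Suc j. ?w k = 0" using z'(1) w(1) o by (auto simp: less_Suc_eq)
      ultimately show ?thesis using z' psolve_rot[OF jn cs, of z' \<rho>] by metis
    qed
  qed auto
  from this[of m] obtain z' where z': "\<forall>k<m. z' k = 0" "(\<Sum>k<n. (z' k)\<^sup>2) = (\<Sum>k<n. (z k)\<^sup>2)" "psolve z \<rho> = psolve z' \<rho>" by auto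
  have "psolve z' \<rho> = psolve (\<lambda>k. if k = m then z' m else 0) \<rho>"
    using z'(1) n by (intro psolve_cong) (auto simp: less_Suc_eq)
  moreover have "(z' m)\<^sup>2 = (\<Sum>k<n. (z' k)\<^sup>2)" using z'(1) n by simp
  ultimately show ?thesis using z' by metis
qed

end

lemma noise_tail:
  fixes s :: real
  assumes s: "0 \<le> s" "s \<le> 2"
  shows "measure (PiM (Inr ` {..<n}) (\<lambda>_. N01)) {y \<in> space (PiM (Inr ` {..<n}) (\<lambda>_. N01)). real n * (1 + s) \<le> (\<Sum>i<n. (y (Inr i :: idx))\<^sup>2)}
    \<le> exp (- real n * s\<^sup>2 / 16)"
proof (cases "s = 0")
  case False
  let ?J = "Inr ` {..<n} :: idx set" and ?M = "PiM (Inr ` {..<n} :: idx set) (\<lambda>_. N01)"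
  \<comment> \<open>The minimizer of \<open>4 * \<theta>\<^sup>2 - \<theta> * s\<close>, the
    exponent per coordinate. The bound \<open>s \<le> 2\<close> keeps
    \<open>2 * \<theta> \<le> 1/2\<close>, the range of the lower bound on
    \<open>ln (1 - 2 * \<theta>)\<close>.\<close>
  define \<theta> where "\<theta> = s / 8"
  have \<theta>: "0 < \<theta>" "\<theta> \<le> 1/4" using s False by (auto simp: \<theta>_def)
  have [measurable]: "(\<lambda>y. y (Inr i)) \<in> borel_measurable ?M" if "i < n" for i
    using measurable_component_singleton[of "Inr i" ?J "\<lambda>_. N01"] that by simp
  have reidx: "(\<Sum>i<n. (y (Inr i :: idx))\<^sup>2) = (\<Sum>a\<in>?J. (y a)\<^sup>2)" for y :: "idx \<Rightarrow> real"
    by (subst sum.reindex) (auto simp: inj_on_def)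
  have one: "(\<integral>\<^sup>+x. ennreal (exp (\<theta> * x\<^sup>2)) \<partial>N01) \<le> ennreal (exp (\<theta> + 4 * \<theta>\<^sup>2))"
  proof -
    have "- (2 * \<theta>) - 2 * (2 * \<theta>)\<^sup>2 \<le> ln (1 - 2 * \<theta>)"
      using \<theta> by (intro ln_one_minus_pos_lower_bound) auto
    then have "exp (- 2 * (\<theta> + 4 * \<theta>\<^sup>2)) \<le> 1 - 2 * \<theta>"
      using \<theta> by (subst (asm) ln_ge_iff) (auto simp: algebra_simps power2_eq_square)
    then have "sqrt (exp (- (\<theta> + 4 * \<theta>\<^sup>2)) ^ 2) \<le> sqrt (1 - 2 * \<theta>)"
      by (intro real_sqrt_le_mono) (simp add: algebra_simps flip: exp_double)
    then have "1 / sqrt (1 - 2 * \<theta>) \<le> 1 / exp (- (\<theta> + 4 * \<theta>\<^sup>2))"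
      using \<theta> by (intro divide_left_mono) auto
    also have "\<dots> = exp (\<theta> + 4 * \<theta>\<^sup>2)" by (metis exp_minus inverse_eq_divide minus_minus)
    finally show ?thesis using nn_integral_N01_exp_quadratic[of \<theta> 0] \<theta> by simp
  qed
  have "(\<integral>\<^sup>+y. ennreal (exp (\<theta> * (\<Sum>i<n. (y (Inr i))\<^sup>2))) \<partial>?M) = (\<integral>\<^sup>+y. (\<Prod>a\<in>?J. ennreal (exp (\<theta> * (y a)\<^sup>2))) \<partial>?M)"
    unfolding reidx by (simp add: prod_ennreal exp_sum sum_distrib_left)
  also have "\<dots> = (\<Prod>a\<in>?J. (\<integral>\<^sup>+x. ennreal (exp (\<theta> * x\<^sup>2)) \<partial>N01))"
    by (rule PN.product_nn_integral_prod) auto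
  also have "\<dots> \<le> (\<Prod>a\<in>?J. ennreal (exp (\<theta> + 4 * \<theta>\<^sup>2)))" by (intro prod_mono_ennreal one)
  also have "\<dots> = ennreal (exp (real n * (\<theta> + 4 * \<theta>\<^sup>2)))"
    by (simp add: card_image exp_of_nat_mult ennreal_power)
  finally have "measure ?M {y \<in> space ?M. \<theta> * (real n * (1 + s)) \<le> \<theta> * (\<Sum>i<n. (y (Inr i))\<^sup>2)}
     \<le> exp (real n * (\<theta> + 4 * \<theta>\<^sup>2) - \<theta> * (real n * (1 + s)))"
    by (intro PN.prob_ge_le_exp) auto
  also have "real n * (\<theta> + 4 * \<theta>\<^sup>2) - \<theta> * (real n * (1 + s)) = - real n * s\<^sup>2 / 16"
    by (simp add: \<theta>_def power2_eq_square field_simps)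
  finally show ?thesis using \<theta> by (simp add: mult_le_cancel_left_pos)
qed simp

section \<open>The norm of the interpolator\<close>

lemma (in random_design) prob_solvable:
  assumes n: "n = Suc m" and t: "0 < t" and F: "0 < F2" and R: "16 * real n * F2 \<le> t\<^sup>2"
    and p: "real n * exp (- t\<^sup>2 / (64 * F2)) \<le> p" "exp (- s1) \<le> p" "exp (- s\<^sup>2 / (4 * F2)) \<le> p" "0 \<le> s"
    and D0: "0 < D0" "D0 \<le> t - 2 * (4 * F2 * (real n / 2 + s1)) / t - s"
    and \<rho>: "(\<Sum>k<n. (z k)\<^sup>2) / D0 \<le> \<rho>"
  shows "1 - 3 * p \<le> measure MI {\<omega> \<in> space MI. solvable d n (design d A \<omega>) z \<rho>}"
proof -
  obtain \<zeta> where \<zeta>: "\<zeta>\<^sup>2 = (\<Sum>k<n. (z k)\<^sup>2)" "psolve z \<rho> = psolve (\<lambda>k. if k = m then \<zeta> else 0) \<rho>"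
    using psolve_canonical[OF n] by blast
  have "1 - 3 * p \<le> psolve (\<lambda>k. if k = m then \<zeta> else 0) \<rho>"
    unfolding psolve_def using \<rho> \<zeta>(1) by (intro prob_solvable_last[OF n t F R p D0]) simp
  then show ?thesis using \<zeta>(2) by (simp add: psolve_def)
qed

section \<open>Averaging over the noise\<close>

abbreviation design_idx :: "nat \<Rightarrow> nat \<Rightarrow> idx set" where
  "design_idx n d \<equiv> Inl ` ({..<n} \<times> {..<d})"

abbreviation noise_idx :: "nat \<Rightarrow> idx set" where
  "noise_idx n \<equiv> Inr ` {..<n}"

text \<open>The noise comes first in the union so that folding the product integrates over the
  design inside and over the noise outside.\<close>

lemma gauss_space_eq: "gauss_space n d = PiM (noise_idx n \<union> design_idx n d) (\<lambda>_. N01)"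
  by (simp add: gauss_space_def Plus_def Un_commute)

lemma prob_space_gauss_space: "prob_space (gauss_space n d)"
  unfolding gauss_space_eq by (intro prob_space_PiM prob_space_N01)

lemma row_idx_subset: "k < n \<Longrightarrow> row_idx d k \<subseteq> design_idx n d"
  by (auto simp: row_idx_def)

lemma measurable_gauss_design:
  assumes "k < n"
  shows "(\<lambda>\<omega>. design d A \<omega> k j) \<in> borel_measurable (gauss_space n d)"
proof -
  have "(\<lambda>\<omega>. \<omega> (Inl (k, i))) \<in> borel_measurable (gauss_space n d)" if "i < d" for i
    using measurable_component_singleton[of "Inl (k, i)" "noise_idx n \<union> design_idx n d" "\<lambda>_. N01"] that assms
    by (auto simp: gauss_space_eq)
  then show ?thesis unfolding design_def by (intro borel_measurable_sum borel_measurable_times) auto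
qed

lemma measurable_gauss_noise:
  assumes "k < n"
  shows "(\<lambda>\<omega>. \<omega> (Inr k)) \<in> borel_measurable (gauss_space n d)"
  using measurable_component_singleton[of "Inr k" "noise_idx n \<union> design_idx n d" "\<lambda>_. N01"] assms
  by (auto simp: gauss_space_eq)

text \<open>The rotation argument is for a fixed right-hand side, so the noise is frozen first. Off
  the event \<open>?B\<close> its squared norm is at most \<open>real n * (1 + s0)\<close>, and the
  bound for the design is uniform in it.\<close>

lemma prob_solvable_gauss:
  assumes cov: "cov_projection d A S S1 S2 Q0"
    and n: "n = Suc m" and t: "0 < mtrace d S2" and F: "0 < frob2 d S2"
    and R: "16 * real n * frob2 d S2 \<le> (mtrace d S2)\<^sup>2"
    and p: "real n * exp (- (mtrace d S2)\<^sup>2 / (64 * frob2 d S2)) \<le> p" "exp (- s1) \<le> p"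
      "exp (- s\<^sup>2 / (4 * frob2 d S2)) \<le> p" "0 \<le> s"
    and D0: "0 < D0" "D0 \<le> mtrace d S2 - 2 * (4 * frob2 d S2 * (real n / 2 + s1)) / mtrace d S2 - s"
    and s0: "0 \<le> s0" "s0 \<le> 2" "exp (- real n * s0\<^sup>2 / 16) \<le> p"
    and p3: "p \<le> 1/3" and \<rho>: "real n * (1 + s0) / D0 \<le> \<rho>"
  shows "1 - 4 * p \<le> measure (gauss_space n d)
    {\<omega> \<in> space (gauss_space n d). solvable d n (design d A \<omega>) (\<lambda>i. \<omega> (Inr i)) \<rho>}"
proof -
  let ?I = "design_idx n d" and ?J = "noise_idx n"
  let ?MI = "PiM (design_idx n d) (\<lambda>_. N01)" and ?MJ = "PiM (noise_idx n) (\<lambda>_. N01)"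
  interpret random_design d A S S1 S2 Q0 n ?I
    using cov row_idx_subset by (simp add: random_design_def random_design_axioms_def)
  interpret G: prob_space "gauss_space n d" by (rule prob_space_gauss_space)
  let ?E = "{\<omega> \<in> space (gauss_space n d). solvable d n (design d A \<omega>) (\<lambda>i. \<omega> (Inr i)) \<rho>}"
  let ?Ez = "\<lambda>z. {x \<in> space ?MI. solvable d n (design d A x) (\<lambda>i. z (Inr i)) \<rho>}"
  let ?B = "{y \<in> space ?MJ. real n * (1 + s0) \<le> (\<Sum>i<n. (y (Inr i))\<^sup>2)}"
  have [measurable]: "(\<lambda>y. y (Inr i)) \<in> borel_measurable ?MJ" if "i < n" for i
    using measurable_component_singleton[of "Inr i" ?J "\<lambda>_. N01"] that by simp
  have B [measurable]: "?B \<in> sets ?MJ" by measurable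
  have E: "?E \<in> sets (gauss_space n d)"
    by (intro measurable_solvable measurable_gauss_design measurable_gauss_noise)
  have inner: "indicator ?E (merge ?J ?I (z, x)) = (indicator (?Ez z) x :: ennreal)"
    if "z \<in> space ?MJ" "x \<in> space ?MI" for z x
  proof -
    have "merge ?J ?I (z, x) \<in> space (gauss_space n d)"
      using measurable_space[OF measurable_merge[of ?J ?I "\<lambda>_. N01"]] that
      by (simp add: gauss_space_eq space_pair_measure)
    moreover have "solvable d n (design d A (merge ?J ?I (z, x))) (\<lambda>i. merge ?J ?I (z, x) (Inr i)) \<rho>
        = solvable d n (design d A x) (\<lambda>i. z (Inr i)) \<rho>"
    proof (rule solvable_cong)
      fix k j assume "k < n"
      then have "design d A (merge ?J ?I (z, x)) k = design d A x k"
        by (intro row_eq_imp_design_eq) (auto simp: merge_def)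
      then show "design d A (merge ?J ?I (z, x)) k j = design d A x k j" by simp
    qed (auto simp: merge_def)
    ultimately show ?thesis using that by (simp add: indicator_def)
  qed
  have Pz: "ennreal (1 - 3 * p) \<le> emeasure ?MI (?Ez z)" if "z \<in> space ?MJ - ?B" for z
  proof -
    have "(\<Sum>i<n. (z (Inr i))\<^sup>2) / D0 \<le> real n * (1 + s0) / D0"
      using that D0(1) by (intro divide_right_mono) auto
    then have "1 - 3 * p \<le> measure ?MI (?Ez z)" using \<rho> by (intro prob_solvable[OF n t F R p D0]) simp
    then show ?thesis by (simp add: PN.emeasure_eq_measure)
  qed
  have "measure ?MJ ?B \<le> p" using noise_tail[OF s0(1,2), of n] s0(3) by simp
  then have PB: "1 - p \<le> measure ?MJ (space ?MJ - ?B)" using PN.prob_compl[OF B] by simp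
  \<comment> \<open>\<open>p \<le> 1/3\<close> makes the factor \<open>1 - 3 * p\<close>
    nonnegative, as the passage to \<open>ennreal\<close> requires.\<close>
  have "ennreal ((1 - 3 * p) * (1 - p)) \<le> ennreal (1 - 3 * p) * emeasure ?MJ (space ?MJ - ?B)"
    using PB p3 by (simp add: ennreal_mult' PN.emeasure_eq_measure mult_left_mono)
  also have "\<dots> = (\<integral>\<^sup>+z. ennreal (1 - 3 * p) * indicator (space ?MJ - ?B) z \<partial>?MJ)"
    using B by (subst nn_integral_cmult_indicator) auto
  also have "\<dots> \<le> (\<integral>\<^sup>+z. emeasure ?MI (?Ez z) \<partial>?MJ)"
    using Pz by (intro nn_integral_mono) (auto simp: indicator_def)
  also have "\<dots> = (\<integral>\<^sup>+z. \<integral>\<^sup>+x. indicator ?E (merge ?J ?I (z, x)) \<partial>?MI \<partial>?MJ)"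
  proof (rule nn_integral_cong)
    fix z assume z: "z \<in> space ?MJ"
    have "emeasure ?MI (?Ez z) = (\<integral>\<^sup>+x. indicator (?Ez z) x \<partial>?MI)"
      using measurable_solvable_design by simp
    also have "\<dots> = (\<integral>\<^sup>+x. indicator ?E (merge ?J ?I (z, x)) \<partial>?MI)"
      by (intro nn_integral_cong) (simp only: inner[OF z])
    finally show "emeasure ?MI (?Ez z) = (\<integral>\<^sup>+x. indicator ?E (merge ?J ?I (z, x)) \<partial>?MI)" .
  qed
  also have "\<dots> = (\<integral>\<^sup>+\<omega>. indicator ?E \<omega> \<partial>gauss_space n d)"
    unfolding gauss_space_eq using E
    by (intro PN.product_nn_integral_fold[symmetric]) (auto simp: gauss_space_eq)
  also have "\<dots> = ennreal (measure (gauss_space n d) ?E)"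
    using E by (simp add: G.emeasure_eq_measure)
  finally have "(1 - 3 * p) * (1 - p) \<le> measure (gauss_space n d) ?E" by simp
  moreover have "1 - 4 * p \<le> (1 - 3 * p) * (1 - p)" by (simp add: algebra_simps)
  ultimately show ?thesis by linarith
qed

section \<open>From solvability to the interpolator\<close>

lemma vnorm_triangle: "vnorm d (\<lambda>i. u i + c * v i) \<le> vnorm d u + \<bar>c\<bar> * vnorm d v"
proof -
  have "vnorm d (\<lambda>i. u i + c * v i) \<le> vnorm d u + vnorm d (\<lambda>i. c * v i)"
    using L2_set_triangle_ineq[of u "\<lambda>i. c * v i" "{..<d}"] by (simp add: vnorm_def L2_set_def)
  also have "vnorm d (\<lambda>i. c * v i) = \<bar>c\<bar> * vnorm d v"
    by (simp add: vnorm_def power_mult_distrib sum_distrib_left[symmetric] real_sqrt_mult)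
  finally show ?thesis .
qed

text \<open>Replaces the quantifier over all minimizers by a condition on one measurable vector. If
  the system is inconsistent, both sides hold vacuously.\<close>

lemma min_norm_interp_le_iff:
  "(\<forall>w. min_norm_interp n d X Y w \<longrightarrow> vnorm d w \<le> B) \<longleftrightarrow>
   ((\<forall>k<n. dot d (X k) (min_sol d X Y n) = Y k) \<longrightarrow> vnorm d (min_sol d X Y n) \<le> B)"
  (is "?lhs \<longleftrightarrow> (?sol \<longrightarrow> ?le)")
proof
  have le: "vnorm d (min_sol d X Y n) \<le> vnorm d v" if "\<forall>k<n. mv d X v k = Y k" for v
    using min_sol_minimal[of n d X v Y] that by (simp add: vnorm_eq mv_eq_dot)
  { assume l: ?lhs
    show "?sol \<longrightarrow> ?le"
    proof
      assume ?sol
      then have "min_norm_interp n d X Y (min_sol d X Y n)"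
        using le by (simp add: min_norm_interp_def mv_eq_dot)
      then show ?le using l by blast
    qed }
  { assume r: "?sol \<longrightarrow> ?le"
    show ?lhs
    proof (intro allI impI)
      fix w assume w: "min_norm_interp n d X Y w"
      then have "\<And>k. k < n \<Longrightarrow> dot d (X k) w = Y k" by (simp add: min_norm_interp_def mv_eq_dot)
      then have sol: ?sol using min_sol_solves[of n d X w Y] by blast
      then have "vnorm d w \<le> vnorm d (min_sol d X Y n)"
        using w by (simp add: min_norm_interp_def mv_eq_dot)
      then show "vnorm d w \<le> B" using r sol by simp
    qed }
qed

text \<open>Monotonicity of \<open>measure\<close> is applied with this event as the larger set, so
  its measurability has to be established.\<close>

lemma measurable_min_norm_interp:
  "{\<omega> \<in> space (gauss_space n d). \<forall>w. min_norm_interp n d (design d A \<omega>) (response d A wstar \<sigma> \<omega>) w \<longrightarrow> vnorm d w \<le> B}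
    \<in> sets (gauss_space n d)"
proof -
  let ?X = "design d A" and ?Y = "response d A wstar \<sigma>"
  have X [measurable]: "(\<lambda>\<omega>. ?X \<omega> k j) \<in> borel_measurable (gauss_space n d)" if "k < n" for k j
    using that by (rule measurable_gauss_design)
  have Y [measurable]: "(\<lambda>\<omega>. ?Y \<omega> k) \<in> borel_measurable (gauss_space n d)" if "k < n" for k
  proof -
    have [measurable]: "(\<lambda>\<omega>. \<omega> (Inr k)) \<in> borel_measurable (gauss_space n d)"
      using that by (rule measurable_gauss_noise)
    show ?thesis unfolding response_def mv_def using that by measurable
  qed
  have [measurable]: "(\<lambda>\<omega>. min_sol d (?X \<omega>) (?Y \<omega>) n i) \<in> borel_measurable (gauss_space n d)" for i
    by (rule measurable_min_sol[of n]) auto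
  have [measurable]: "(\<lambda>\<omega>. dot d (?X \<omega> k) (min_sol d (?X \<omega>) (?Y \<omega>) n)) \<in> borel_measurable (gauss_space n d)" if "k < n" for k
    unfolding dot_def using that by measurable
  have [measurable]: "(\<lambda>\<omega>. vnorm d (min_sol d (?X \<omega>) (?Y \<omega>) n)) \<in> borel_measurable (gauss_space n d)"
    unfolding vnorm_def by measurable
  have "{\<omega> \<in> space (gauss_space n d). (\<forall>k\<in>{..<n}. dot d (?X \<omega> k) (min_sol d (?X \<omega>) (?Y \<omega>) n) = ?Y \<omega> k) \<longrightarrow>
      vnorm d (min_sol d (?X \<omega>) (?Y \<omega>) n) \<le> B} \<in> sets (gauss_space n d)"
    by (intro sets.sets_Collect_imp sets.sets_Collect_finite_All) auto
  then show ?thesis unfolding min_norm_interp_le_iff by (simp only: Ball_def lessThan_iff)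
qed

text \<open>The competitor \<open>wstar + \<sigma> u\<close> interpolates when \<open>u\<close>
  solves the system with the noise on the right, and the minimizer is no longer than it.\<close>

lemma solvable_imp_min_norm_le:
  assumes "solvable d n (design d A \<omega>) (\<lambda>i. \<omega> (Inr i)) \<rho>" "0 \<le> \<sigma>"
    and w: "min_norm_interp n d (design d A \<omega>) (response d A wstar \<sigma> \<omega>) w"
  shows "vnorm d w \<le> vnorm d wstar + \<sigma> * sqrt \<rho>"
proof -
  obtain u where u: "\<forall>k<n. dot d (design d A \<omega> k) u = \<omega> (Inr k)" "dot d u u \<le> \<rho>"
    using assms(1) unfolding solvable_def by blast
  have "mv d (design d A \<omega>) (\<lambda>i. wstar i + \<sigma> * u i) k = response d A wstar \<sigma> \<omega> k" if "k < n" for k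
    using u(1) that unfolding mv_add by (simp add: response_def mv_eq_dot[of d _ u])
  then have "vnorm d w \<le> vnorm d (\<lambda>i. wstar i + \<sigma> * u i)" using w by (simp add: min_norm_interp_def)
  also have "\<dots> \<le> vnorm d wstar + \<sigma> * vnorm d u" using vnorm_triangle[of d wstar \<sigma> u] assms(2) by simp
  also have "\<dots> \<le> vnorm d wstar + \<sigma> * sqrt \<rho>"
    using u(2) assms(2) by (intro add_left_mono mult_left_mono) (auto simp: vnorm_eq)
  finally show ?thesis .
qed

text \<open>Because \<open>\<epsilon> \<le> 1\<close>, the product
  \<open>(1 + \<epsilon>) * (1 - 20 g - 3 a)\<close> is at least
  \<open>1 + \<epsilon> - 40 g - 6 a\<close>, so the claim reduces to
  \<open>6 b + 40 g + 6 a \<le> \<epsilon>\<close>.\<close>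

lemma rate_bound:
  fixes a b g t \<nu> :: real
  assumes nn: "0 \<le> a" "0 \<le> b" "0 \<le> g" "0 < t" "0 \<le> \<nu>" and \<epsilon>: "\<epsilon> = 256 * (a + b + g)" "\<epsilon> \<le> 1" and b: "s0 \<le> 6 * b"
  defines "D0 \<equiv> t * (1 - 20 * g - 3 * a)"
  shows "0 < D0" "\<nu> * (1 + s0) / D0 \<le> (1 + \<epsilon>) * \<nu> / t"
proof -
  let ?q = "1 - 20 * g - 3 * a"
  have q: "0 < ?q" using assms by auto
  then show D0: "0 < D0" using nn(4) unfolding D0_def by simp
  have "\<epsilon> * (20 * g + 3 * a) \<le> 1 * (20 * g + 3 * a)" using nn \<epsilon>(2) by (intro mult_right_mono) auto
  then have "1 + s0 \<le> (1 + \<epsilon>) * ?q" using nn \<epsilon>(1) b by (simp add: algebra_simps)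
  then have "\<nu> * (1 + s0) \<le> \<nu> * ((1 + \<epsilon>) * ?q)" using nn by (intro mult_left_mono) auto
  then have "\<nu> * (1 + s0) / D0 \<le> \<nu> * ((1 + \<epsilon>) * ?q) / D0" using D0 by (intro divide_right_mono) auto
  also have "\<dots> = (1 + \<epsilon>) * \<nu> / t" using q nn(4) by (simp add: D0_def)
  finally show "\<nu> * (1 + s0) / D0 \<le> (1 + \<epsilon>) * \<nu> / t" .
qed

lemma prob_min_norm_le:
  fixes n d :: nat and \<delta> \<sigma> :: real
  defines "rate S2 \<equiv> 256 * (sqrt (ln (1/\<delta>) / eff_r d S2) + sqrt (ln (1/\<delta>) / real n) + real n * ln (1/\<delta>) / eff_R d S2)"
  assumes \<delta>: "0 < \<delta>" "\<delta> \<le> 1/4" and \<sigma>: "0 \<le> \<sigma>" and n: "0 < n"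
    and S_eq: "\<forall>i<d. \<forall>j<d. S i j = (\<Sum>k<d. A i k * A j k)"
    and split: "cov_split d S S1 S2" and nz: "nonzero_mat d S2" and le1: "rate S2 \<le> 1"
  shows "1 - \<delta> \<le> measure (gauss_space n d) {\<omega> \<in> space (gauss_space n d).
      \<forall>w. min_norm_interp n d (design d A \<omega>) (response d A wstar \<sigma> \<omega>) w \<longrightarrow>
        vnorm d w \<le> vnorm d wstar + sqrt (1 + rate S2) * \<sigma> * sqrt (real n / mtrace d S2)}"
proof -
  obtain Q0 where "projector d Q0" "\<And>v i. i < d \<Longrightarrow> mv d Q0 (mv d S1 v) i = 0"
    "\<And>v i. i < d \<Longrightarrow> mv d Q0 (mv d S2 v) i = mv d S2 v i"
    by (rule cov_split_projector[OF split]) blast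
  then have cov: "cov_projection d A S S1 S2 Q0"
    using S_eq split by (intro cov_projection.intro) auto
  interpret G: prob_space "gauss_space n d" by (rule prob_space_gauss_space)
  define L where "L = ln (1/\<delta>)"
  define t where "t = mtrace d S2"
  define F where "F = frob2 d S2"
  define r where "r = eff_r d S2"
  define R where "R = eff_R d S2"
  have psd: "psd d S2" using split by (simp add: cov_split_def)
  obtain i j where ij: "i < d" "j < d" "S2 i j \<noteq> 0" using nz by (auto simp: nonzero_mat_def)
  have F: "0 < F"
  proof -
    have "0 < (S2 i j)\<^sup>2" using ij by simp
    also have "\<dots> \<le> (\<Sum>j<d. (S2 i j)\<^sup>2)" using ij by (intro member_le_sum) auto
    also have "\<dots> \<le> F" unfolding F_def frob2_def using ij
      by (intro member_le_sum[of i _ "\<lambda>i. \<Sum>j<d. (S2 i j)\<^sup>2"]) (auto intro: sum_nonneg)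
    finally show ?thesis .
  qed
  have t0: "0 \<le> t"
  proof -
    have "0 \<le> S2 i i" if "i < d" for i
      using psd_dot_nonneg[OF psd, of "unit_vec i"] that by (simp add: dot_unit_vec mv_unit_vec)
    then show ?thesis unfolding t_def mtrace_def by (intro sum_nonneg) simp
  qed
  have op: "F \<le> opnorm d S2 * t" unfolding F_def t_def by (rule frob2_le_opnorm_trace[OF psd])
  then have "0 < opnorm d S2 * t" using F by linarith
  then have t: "0 < t" and op0: "0 < opnorm d S2" using t0 by (auto simp: zero_less_mult_iff)
  have r: "r = t / opnorm d S2" "0 < r" using t op0 by (simp_all add: r_def eff_r_def t_def)
  have R: "R = t\<^sup>2 / F"
  proof -
    have "(\<Sum>i<d. \<Sum>j<d. S2 i j * S2 j i) = F"
      unfolding F_def frob2_def using psd_symmetric[OF psd] unfolding symmetric_def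
      by (intro sum.cong refl) (metis lessThan_iff power2_eq_square)
    then show ?thesis by (simp add: R_def eff_R_def t_def)
  qed
  have R0: "0 < R" using R t F by simp
  \<comment> \<open>This is \<open>r \<le> R\<close>; it later converts the deviation
    \<open>s\<close> into the term of the rate with \<open>sqrt (L / r)\<close>.\<close>
  have Fr: "F * r \<le> t\<^sup>2"
  proof -
    have "F * r \<le> opnorm d S2 * t * r" using op r(2) by (intro mult_right_mono) auto
    also have "\<dots> = t\<^sup>2" using r(1) op0 by (simp add: power2_eq_square)
    finally show ?thesis .
  qed
  have L: "1 \<le> L"
  proof -
    have "4 \<le> 1 / \<delta>" using \<delta> by (simp add: field_simps)
    then have "exp 1 \<le> 1 / \<delta>" using exp_le by linarith
    then show ?thesis unfolding L_def using \<delta> by (simp add: ln_ge_iff)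
  qed
  \<comment> \<open>All tails are tuned to \<open>exp (- (2 * L)) = \<delta>\<^sup>2\<close>, which
    is at most \<open>\<delta> / 4\<close> because \<open>\<delta> \<le> 1/4\<close>. Four such
    failures add up to \<open>\<delta>\<close>.\<close>
  have expL: "exp (- (2 * L)) \<le> \<delta> / 4"
  proof -
    have "exp (- L) = \<delta>" using \<delta> by (simp add: L_def ln_div)
    then have "exp (- (2 * L)) = \<delta> * \<delta>" by (metis exp_add mult_2 minus_add_distrib)
    also have "\<dots> \<le> \<delta> * (1/4)" using \<delta> by (intro mult_left_mono) auto
    finally show ?thesis by simp
  qed
  define a where "a = sqrt (L / r)"
  define b where "b = sqrt (L / real n)"
  define g where "g = real n * L / R"
  have nn: "0 \<le> a" "0 \<le> b" "0 \<le> g" using L r(2) R0 by (auto simp: a_def b_def g_def)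
  define \<epsilon> where "\<epsilon> = rate S2"
  have \<epsilon>: "\<epsilon> = 256 * (a + b + g)" "\<epsilon> \<le> 1"
    using le1 by (simp_all add: \<epsilon>_def rate_def a_def b_def g_def L_def r_def R_def)
  have n1: "1 \<le> real n" using n by simp
  have nL: "1 \<le> real n * L" "real n \<le> real n * L" "L \<le> real n * L"
    using n1 L mult_mono[of 1 "real n" 1 L] by (simp_all add: mult_le_cancel_left1 mult_le_cancel_right1)
  \<comment> \<open>The origin of 256: the union bound over rows has exponent \<open>R / 64\<close>,
    which becomes at least \<open>4 * real n * L\<close> and so exceeds
    \<open>real n + 2 * L\<close>. The part \<open>exp (- real n)\<close> pays for the number of
    rows.\<close>
  have R256: "256 * (real n * L) \<le> R"
  proof -
    have "256 * g \<le> \<epsilon>" unfolding \<epsilon>(1) using nn by simp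
    then have "256 * g \<le> 1" using \<epsilon>(2) by (rule order_trans)
    then show ?thesis using R0 by (simp add: g_def field_simps)
  qed
  \<comment> \<open>With these choices \<open>real n * s0\<^sup>2 / 16\<close> and
    \<open>s\<^sup>2 / (4 * F)\<close> both equal \<open>2 * L\<close>.\<close>
  define s0 where "s0 = 4 * sqrt (2 * L / real n)"
  define s where "s = sqrt (8 * L * F)"
  have s0: "0 \<le> s0" "s0 \<le> 6 * b" "s0\<^sup>2 = 32 * L / real n"
  proof -
    show "0 \<le> s0" using L by (simp add: s0_def)
    show sq: "s0\<^sup>2 = 32 * L / real n" using L by (simp add: s0_def power_mult_distrib)
    have "s0\<^sup>2 \<le> (6 * b)\<^sup>2" unfolding sq using L by (simp add: b_def power_mult_distrib divide_right_mono)
    then show "s0 \<le> 6 * b" by (rule power2_le_imp_le) (simp add: nn(2))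
  qed
  define D0 where "D0 = t * (1 - 20 * g - 3 * a)"
  note rb = rate_bound[OF nn t _ \<epsilon> s0(2), of "real n", folded D0_def]
  have tg: "t * g = F * (real n * L) / t" using t F by (simp add: g_def R power2_eq_square)
  have main: "1 - 4 * (\<delta> / 4) \<le> measure (gauss_space n d)
    {\<omega> \<in> space (gauss_space n d). solvable d n (design d A \<omega>) (\<lambda>i. \<omega> (Inr i)) ((1 + \<epsilon>) * real n / t)}"
  proof (rule prob_solvable_gauss[OF cov, where m = "n - 1" and s = s and ?s1.0 = "2 * L" and ?s0.0 = s0 and ?D0.0 = D0, folded t_def F_def])
    show "16 * real n * F \<le> t\<^sup>2"
    proof -
      have "16 * real n \<le> R" using R256 nL by linarith
      then show ?thesis using F by (simp add: R field_simps)
    qed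
    show "real n * exp (- t\<^sup>2 / (64 * F)) \<le> \<delta> / 4"
    proof -
      have "t\<^sup>2 / (64 * F) = R / 64" using F by (simp add: R)
      then have "- t\<^sup>2 / (64 * F) \<le> - real n + - (2 * L)" using R256 nL by simp
      then have "real n * exp (- t\<^sup>2 / (64 * F)) \<le> real n * (exp (- real n) * exp (- (2 * L)))"
        unfolding exp_add[symmetric] by (intro mult_left_mono) auto
      also have "\<dots> = (real n * exp (- real n)) * exp (- (2 * L))" by simp
      also have "\<dots> \<le> 1 * exp (- (2 * L))"
      proof (intro mult_right_mono)
        have "real n \<le> exp (real n)" using exp_ge_add_one_self[of "real n"] by linarith
        then show "real n * exp (- real n) \<le> 1" by (simp add: exp_minus field_simps)
      qed auto
      finally show ?thesis using expL by simp
    qed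
    show "exp (- (2 * L)) \<le> \<delta> / 4" by (rule expL)
    have "s\<^sup>2 / (4 * F) = 2 * L" using L F by (simp add: s_def)
    then show "exp (- s\<^sup>2 / (4 * F)) \<le> \<delta> / 4" using expL by simp
    show "0 \<le> s" using L F by (simp add: s_def)
    \<comment> \<open>Since \<open>real n / 2 + 2 * L \<le> 5/2 * (real n * L)\<close>, the trace
      loss is at most \<open>20 * (t * g)\<close>; and \<open>F \<le> t\<^sup>2 / r\<close> gives
      \<open>s \<le> 3 * t * a\<close>. These are the coefficients in \<open>D0\<close>.\<close>
    show "D0 \<le> t - 2 * (4 * F * (real n / 2 + 2 * L)) / t - s"
    proof -
      have "2 * (4 * F * (real n / 2 + 2 * L)) \<le> 2 * (4 * F * (5 / 2 * (real n * L)))"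
        using F nL by (intro mult_left_mono) auto
      then have "2 * (4 * F * (real n / 2 + 2 * L)) / t \<le> 2 * (4 * F * (5 / 2 * (real n * L))) / t"
        using t by (intro divide_right_mono) auto
      also have "\<dots> = 20 * (t * g)" unfolding tg by simp
      finally have 1: "2 * (4 * F * (real n / 2 + 2 * L)) / t \<le> 20 * (t * g)" .
      have "8 * L * F \<le> 9 * (t\<^sup>2 * (L / r))"
      proof -
        have "F \<le> t\<^sup>2 / r" using Fr r(2) by (simp add: field_simps)
        then have "8 * L * F \<le> 9 * L * (t\<^sup>2 / r)" using L F by (intro mult_mono) auto
        then show ?thesis by (simp add: mult_ac)
      qed
      also have "\<dots> = (3 * t * a)\<^sup>2" using L r(2) by (simp add: a_def power_mult_distrib)
      finally have "s \<le> 3 * t * a" unfolding s_def using t nn by (intro real_le_lsqrt) auto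
      then show ?thesis using 1 unfolding D0_def by (simp add: algebra_simps)
    qed
    show "s0 \<le> 2"
    proof -
      have "256 * b \<le> \<epsilon>" unfolding \<epsilon>(1) using nn by simp
      then show ?thesis using \<epsilon>(2) s0(2) by linarith
    qed
    show "exp (- real n * s0\<^sup>2 / 16) \<le> \<delta> / 4" using s0(3) n expL by simp
  qed (use n t F s0 \<delta> rb in auto)
  have bound: "sqrt (1 + \<epsilon>) * \<sigma> * sqrt (real n / t) = \<sigma> * sqrt ((1 + \<epsilon>) * real n / t)"
    unfolding times_divide_eq_right[symmetric] real_sqrt_mult by simp
  have "1 - \<delta> \<le> measure (gauss_space n d)
    {\<omega> \<in> space (gauss_space n d). solvable d n (design d A \<omega>) (\<lambda>i. \<omega> (Inr i)) ((1 + \<epsilon>) * real n / t)}"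
    using main by simp
  also have "\<dots> \<le> measure (gauss_space n d) {\<omega> \<in> space (gauss_space n d).
      \<forall>w. min_norm_interp n d (design d A \<omega>) (response d A wstar \<sigma> \<omega>) w \<longrightarrow>
        vnorm d w \<le> vnorm d wstar + sqrt (1 + \<epsilon>) * \<sigma> * sqrt (real n / t)}"
    unfolding bound using solvable_imp_min_norm_le[OF _ \<sigma>]
    by (intro G.finite_measure_mono measurable_min_norm_interp) blast
  finally show ?thesis unfolding \<epsilon>_def t_def .
qed

theorem theorem2:
  shows "\<exists>c C :: real. c > 0 \<and> C > 0 \<and>
    (\<forall>(n::nat) (d::nat) (\<delta>::real) S A S1 S2 wstar (\<sigma>::real).
       n \<le> d \<longrightarrow> 0 < \<delta> \<longrightarrow> \<delta> \<le> 1/4 \<longrightarrow> 0 \<le> \<sigma> \<longrightarrow>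
       psd d S \<longrightarrow> (\<forall>i<d. \<forall>j<d. S i j = (\<Sum>k<d. A i k * A j k)) \<longrightarrow>
       cov_split d S S1 S2 \<longrightarrow> nonzero_mat d S2 \<longrightarrow>
       (\<exists>\<epsilon>::real.
          \<epsilon> \<le> C * (sqrt (ln (1/\<delta>) / eff_r d S2) + sqrt (ln (1/\<delta>) / real n)
                    + real n * ln (1/\<delta>) / eff_R d S2) \<and>
          (\<epsilon> \<le> 1 \<and> eff_R d S2 \<ge> c * (ln (1/\<delta>))\<^sup>2 \<longrightarrow>
             measure (gauss_space n d)
               {\<omega> \<in> space (gauss_space n d).
                  \<forall>w. min_norm_interp n d (design d A \<omega>) (response d A wstar \<sigma> \<omega>) w \<longrightarrow>
                      vnorm d w \<le> vnorm d wstar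
                        + sqrt (1 + \<epsilon>) * \<sigma> * sqrt (real n / mtrace d S2)}
             \<ge> 1 - \<delta>)))"
proof -
  have main: "\<exists>\<epsilon>::real.
      \<epsilon> \<le> 256 * (sqrt (ln (1/\<delta>) / eff_r d S2) + sqrt (ln (1/\<delta>) / real n) + real n * ln (1/\<delta>) / eff_R d S2) \<and>
      (\<epsilon> \<le> 1 \<and> eff_R d S2 \<ge> 1 * (ln (1/\<delta>))\<^sup>2 \<longrightarrow>
        measure (gauss_space n d) {\<omega> \<in> space (gauss_space n d).
          \<forall>w. min_norm_interp n d (design d A \<omega>) (response d A wstar \<sigma> \<omega>) w \<longrightarrow>
            vnorm d w \<le> vnorm d wstar + sqrt (1 + \<epsilon>) * \<sigma> * sqrt (real n / mtrace d S2)} \<ge> 1 - \<delta>)"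
    if \<delta>: "0 < \<delta>" "\<delta> \<le> 1/4" and \<sigma>: "0 \<le> \<sigma>"
      and S: "\<forall>i<d. \<forall>j<d. S i j = (\<Sum>k<d. A i k * A j k)" "cov_split d S S1 S2" "nonzero_mat d S2"
    for n d :: nat and \<delta> \<sigma> :: real and S A S1 S2 wstar
  \<comment> \<open>The witness is the upper bound itself: the first conjunct is reflexivity, and
    \<open>\<epsilon> \<le> 1\<close> then makes all three terms of the rate small.\<close>
  proof (intro exI[where x = "256 * (sqrt (ln (1/\<delta>) / eff_r d S2) + sqrt (ln (1/\<delta>) / real n) + real n * ln (1/\<delta>) / eff_R d S2)"] conjI impI order_refl)
    assume le: "256 * (sqrt (ln (1/\<delta>) / eff_r d S2) + sqrt (ln (1/\<delta>) / real n) + real n * ln (1/\<delta>) / eff_R d S2) \<le> 1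
      \<and> 1 * (ln (1/\<delta>))\<^sup>2 \<le> eff_R d S2"
    let ?\<epsilon> = "256 * (sqrt (ln (1/\<delta>) / eff_r d S2) + sqrt (ln (1/\<delta>) / real n) + real n * ln (1/\<delta>) / eff_R d S2)"
    let ?G = "{\<omega> \<in> space (gauss_space n d).
      \<forall>w. min_norm_interp n d (design d A \<omega>) (response d A wstar \<sigma> \<omega>) w \<longrightarrow>
        vnorm d w \<le> vnorm d wstar + sqrt (1 + ?\<epsilon>) * \<sigma> * sqrt (real n / mtrace d S2)}"
    show "1 - \<delta> \<le> measure (gauss_space n d) ?G"
    \<comment> \<open>Without observations there is no last row, but then every vector interpolates,
      including \<open>wstar\<close>, and the bound holds everywhere.\<close>
    proof (cases "n = 0")
      case True
      interpret G: prob_space "gauss_space n d" by (rule prob_space_gauss_space)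
      have "vnorm d w \<le> vnorm d wstar" if "min_norm_interp n d X Y w" for X Y w
        using that True by (simp add: min_norm_interp_def)
      then have "?G = space (gauss_space n d)" using True by auto
      then show ?thesis using \<delta> by (simp add: G.prob_space)
    next
      case False
      then show ?thesis using prob_min_norm_le[OF \<delta> \<sigma> _ S, of n wstar] le by blast
    qed
  qed
  show ?thesis
    by (rule exI[where x = 1], rule exI[where x = 256]) (use main in \<open>simp only: zero_less_one zero_less_numeral simp_thms\<close>, blast)
qed

end
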